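(* Let $K/K_0$ be a PAC extension. Then $(K\cap K_{0s})/K_0$ is PAC and the restriction map $\mathrm{Gal}(K)\to\mathrm{Gal}(K\cap K_{0s})$ is an isomorphism.
   Context: A field extension $K/K_0$ is called PAC if for every absolutely irreducible variety $V$ of dimension $e\ge 1$ defined over $K$ and every separable dominant rational map $\nu\colon V\to\mathbb{A}^e$ defined over $K$ there exists $\mathbf b\in V(K)$ with $\nu(\mathbf b)\in K_0^e$. $K_{0s}$ is a separable closure of $K_0$ contained in a separable closure $K_s$ of $K$; $\mathrm{Gal}(\cdot)$ denotes the absolute Galois group. *)

theory Defs
  imports
    "HOL-Library.Poly_Mapping"
    "HOL-Library.FuncSet"
    "HOL-Analysis.Function_Topology"
    "HOL-Algebra.Bij"
    "HOL-Algebra.Generated_Fields"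
    "HOL-Algebra.Algebraic_Closure_Type"
begin

section \<open>Fields inside an algebraically closed field\<close>

abbreviation is_subfield :: "'a::field set \<Rightarrow> bool"
  where "is_subfield E \<equiv> subfield E ring_of_type_algebra"

definition is_min_poly :: "'a::field set \<Rightarrow> 'a \<Rightarrow> 'a poly \<Rightarrow> bool"
  where "is_min_poly E a p \<longleftrightarrow>
    (\<forall>i. Polynomial.coeff p i \<in> E) \<and> Polynomial.lead_coeff p = 1 \<and> poly p a = 0 \<and>
    (\<forall>q. (\<forall>i. Polynomial.coeff q i \<in> E) \<and> q \<noteq> 0 \<and> poly q a = 0 \<longrightarrow>
         Polynomial.degree p \<le> Polynomial.degree q)"

definition algebraic_over :: "'a::field set \<Rightarrow> 'a \<Rightarrow> bool"
  where "algebraic_over E a \<longleftrightarrow>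
    (\<exists>p. (\<forall>i. Polynomial.coeff p i \<in> E) \<and> p \<noteq> 0 \<and> poly p a = 0)"

text \<open>The ambient field is algebraically closed, so \<^const>\<open>rsquarefree\<close> (no multiple root in the
  ambient field) is separability of the minimal polynomial.\<close>

definition separable_over :: "'a::alg_closed_field set \<Rightarrow> 'a \<Rightarrow> bool"
  where "separable_over E a \<longleftrightarrow> (\<exists>p. is_min_poly E a p \<and> rsquarefree p)"

definition sep_closure :: "'a::alg_closed_field set \<Rightarrow> 'a set"
  where "sep_closure E = {a. separable_over E a}"


section \<open>Affine varieties\<close>

text \<open>Polynomials are finitely supported maps from monomials to coefficients.
  The set \<open>mpolys n E\<close> is the polynomial ring over \<open>E\<close> in the variables of index less than \<open>n\<close>;
  \<open>eval_mpoly h x p\<close> applies \<open>h\<close> to the coefficients of \<open>p\<close> and substitutes \<open>x\<close>.\<close>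

type_synonym 'a mpol = "(nat \<Rightarrow>\<^sub>0 nat) \<Rightarrow>\<^sub>0 'a"

definition mpolys :: "nat \<Rightarrow> 'a::zero set \<Rightarrow> 'a mpol set"
  where "mpolys n E =
    {p. \<forall>m\<in>Poly_Mapping.keys p. Poly_Mapping.lookup p m \<in> E \<and> Poly_Mapping.keys m \<subseteq> {..<n}}"

definition eval_mpoly :: "('a::zero \<Rightarrow> 'b::comm_ring_1) \<Rightarrow> (nat \<Rightarrow> 'b) \<Rightarrow> 'a mpol \<Rightarrow> 'b"
  where "eval_mpoly h x p =
    (\<Sum>m\<in>Poly_Mapping.keys p. h (Poly_Mapping.lookup p m) * (\<Prod>i\<in>Poly_Mapping.keys m. x i ^ Poly_Mapping.lookup m i))"

definition affine_space :: "nat \<Rightarrow> (nat \<Rightarrow> 'a) set"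
  where "affine_space n = {..<n} \<rightarrow>\<^sub>E UNIV"

definition zero_set :: "nat \<Rightarrow> 'a::comm_ring_1 mpol set \<Rightarrow> (nat \<Rightarrow> 'a) set"
  where "zero_set n S = {b \<in> affine_space n. \<forall>p\<in>S. eval_mpoly id b p = 0}"

definition vanishing_ideal :: "nat \<Rightarrow> (nat \<Rightarrow> 'a::comm_ring_1) set \<Rightarrow> 'a mpol set"
  where "vanishing_ideal n V = {p \<in> mpolys n UNIV. \<forall>b\<in>V. eval_mpoly id b p = 0}"

definition zariski_closed :: "nat \<Rightarrow> (nat \<Rightarrow> 'a::comm_ring_1) set \<Rightarrow> bool"
  where "zariski_closed n V \<longleftrightarrow> (\<exists>S. S \<subseteq> mpolys n UNIV \<and> V = zero_set n S)"

definition zariski_irreducible :: "nat \<Rightarrow> (nat \<Rightarrow> 'a::comm_ring_1) set \<Rightarrow> bool"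
  where "zariski_irreducible n V \<longleftrightarrow> V \<noteq> {} \<and>
    (\<forall>A B. zariski_closed n A \<and> zariski_closed n B \<and> V = A \<union> B \<longrightarrow> V = A \<or> V = B)"

definition zariski_closure :: "nat \<Rightarrow> (nat \<Rightarrow> 'a::comm_ring_1) set \<Rightarrow> (nat \<Rightarrow> 'a) set"
  where "zariski_closure n S = \<Inter>{A. zariski_closed n A \<and> S \<subseteq> A}"

text \<open>The ideal generated by \<open>S\<close> in the ring of polynomials in \<open>n\<close> variables.\<close>

definition ideal_gen :: "nat \<Rightarrow> 'a::comm_ring_1 mpol set \<Rightarrow> 'a mpol set"
  where "ideal_gen n S =
    {(\<Sum>q\<in>T. c q * q) | T c. finite T \<and> T \<subseteq> S \<and> (\<forall>q\<in>T. c q \<in> mpolys n UNIV)}"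

text \<open>Absolutely irreducible affine variety in \<open>n\<close>-space defined over \<open>K\<close>: irreducibility is over
  the algebraically closed ambient field, and being defined over \<open>K\<close> means that the full vanishing
  ideal, not merely the set, is given by polynomials over \<open>K\<close>; these differ when \<open>K\<close> is
  imperfect.\<close>

definition abs_irred_variety :: "'a::alg_closed_field set \<Rightarrow> nat \<Rightarrow> (nat \<Rightarrow> 'a) set \<Rightarrow> bool"
  where "abs_irred_variety K n V \<longleftrightarrow> zariski_closed n V \<and> zariski_irreducible n V \<and>
    vanishing_ideal n V = ideal_gen n (vanishing_ideal n V \<inter> mpolys n K)"

definition rational_points :: "'a set \<Rightarrow> nat \<Rightarrow> (nat \<Rightarrow> 'a) set \<Rightarrow> (nat \<Rightarrow> 'a) set"
  where "rational_points K n V = {b \<in> V. \<forall>i<n. b i \<in> K}"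


section \<open>Function fields\<close>

text \<open>Function fields are realised by generic points, as in Weil's foundations.
  The universal domain over \<open>\<Omega>\<close> is the algebraic closure of
  \<open>\<Omega>(X\<^sub>0, X\<^sub>1, \<dots>)\<close>. It is algebraically closed of infinite transcendence degree over \<open>\<Omega>\<close>, so
  every irreducible variety over \<open>\<Omega>\<close> has a generic point \<open>x\<close> in it; the function field of the
  variety over \<open>K\<close> is then \<open>K(x)\<close>, unique up to \<open>K\<close>-isomorphism.\<close>

type_synonym 'a universal_domain = "'a mpol fract alg_closure"

definition emb :: "'a::field \<Rightarrow> 'a universal_domain"
  where "emb a = to_ac (Fract (Poly_Mapping.single 0 a) 1)"

definition generic_point ::
    "nat \<Rightarrow> (nat \<Rightarrow> 'a::alg_closed_field) set \<Rightarrow> (nat \<Rightarrow> 'a universal_domain) \<Rightarrow> bool"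
  where "generic_point n V x \<longleftrightarrow> x \<in> affine_space n \<and>
    (\<forall>p\<in>mpolys n UNIV. eval_mpoly emb x p = 0 \<longleftrightarrow> p \<in> vanishing_ideal n V)"

text \<open>The field \<open>K(x\<^sub>0, \<dots>, x\<^sub>n\<^sub>-\<^sub>1)\<close>.\<close>

definition adjoin ::
    "'a::alg_closed_field set \<Rightarrow> nat \<Rightarrow> (nat \<Rightarrow> 'a universal_domain) \<Rightarrow> 'a universal_domain set"
  where "adjoin K n x = generate_field ring_of_type_algebra (emb ` K \<union> x ` {..<n})"

definition algebraically_independent ::
    "nat \<Rightarrow> (nat \<Rightarrow> 'a::alg_closed_field universal_domain) \<Rightarrow> bool"
  where "algebraically_independent d t \<longleftrightarrow>
    (\<forall>p\<in>mpolys d UNIV. eval_mpoly emb t p = 0 \<longrightarrow> p = 0)"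

text \<open>If \<open>x\<close> is a generic point of \<open>V\<close> in \<open>n\<close>-space, the following says that \<open>V\<close> has dimension
  \<open>d\<close>: its function field \<open>\<Omega>(x)\<close> has a transcendence basis over \<open>\<Omega>\<close> with \<open>d\<close> elements.\<close>

definition has_trdeg ::
    "nat \<Rightarrow> (nat \<Rightarrow> 'a::alg_closed_field universal_domain) \<Rightarrow> nat \<Rightarrow> bool"
  where "has_trdeg n x d \<longleftrightarrow>
    (\<exists>t. (\<forall>j<d. t j \<in> adjoin UNIV n x) \<and> algebraically_independent d t \<and>
         (\<forall>h\<in>adjoin UNIV n x. algebraic_over (adjoin UNIV d t) h))"


section \<open>Rational maps to affine space\<close>

text \<open>The rational function \<open>h\<close> in \<open>K(x)\<close> is defined at \<open>b\<close> with value \<open>c\<close>: some representation of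
  \<open>h\<close> as a quotient of polynomials over \<open>K\<close> has a denominator that does not vanish at \<open>b\<close>.\<close>

definition rat_fun_value ::
    "'a::alg_closed_field set \<Rightarrow> nat \<Rightarrow> (nat \<Rightarrow> 'a universal_domain) \<Rightarrow> 'a universal_domain
      \<Rightarrow> (nat \<Rightarrow> 'a) \<Rightarrow> 'a \<Rightarrow> bool"
  where "rat_fun_value K n x h b c \<longleftrightarrow>
    (\<exists>f\<in>mpolys n K. \<exists>g\<in>mpolys n K.
       eval_mpoly emb x g \<noteq> 0 \<and> h = eval_mpoly emb x f / eval_mpoly emb x g \<and>
       eval_mpoly id b g \<noteq> 0 \<and> c = eval_mpoly id b f / eval_mpoly id b g)"

text \<open>A rational map over \<open>K\<close> from a variety with generic point \<open>x\<close> to \<open>e\<close>-space is an \<open>e\<close>-tuple of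
  elements of its function field over \<open>K\<close>.\<close>

definition rational_map ::
    "'a::alg_closed_field set \<Rightarrow> nat \<Rightarrow> (nat \<Rightarrow> 'a universal_domain) \<Rightarrow> nat
      \<Rightarrow> (nat \<Rightarrow> 'a universal_domain) \<Rightarrow> bool"
  where "rational_map K n x e \<nu> \<longleftrightarrow> \<nu> \<in> {..<e} \<rightarrow>\<^sub>E adjoin K n x"

definition rat_map_value ::
    "'a::alg_closed_field set \<Rightarrow> nat \<Rightarrow> (nat \<Rightarrow> 'a universal_domain) \<Rightarrow> nat
      \<Rightarrow> (nat \<Rightarrow> 'a universal_domain) \<Rightarrow> (nat \<Rightarrow> 'a) \<Rightarrow> (nat \<Rightarrow> 'a) \<Rightarrow> bool"
  where "rat_map_value K n x e \<nu> b c \<longleftrightarrow>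
    c \<in> affine_space e \<and> (\<forall>j<e. rat_fun_value K n x (\<nu> j) b (c j))"

definition dominant_map ::
    "'a::alg_closed_field set \<Rightarrow> nat \<Rightarrow> (nat \<Rightarrow> 'a) set \<Rightarrow> (nat \<Rightarrow> 'a universal_domain) \<Rightarrow> nat
      \<Rightarrow> (nat \<Rightarrow> 'a universal_domain) \<Rightarrow> bool"
  where "dominant_map K n V x e \<nu> \<longleftrightarrow>
    zariski_closure e {c. \<exists>b\<in>V. rat_map_value K n x e \<nu> b c} = affine_space e"

text \<open>Separability of the extension \<open>K(x) / K(\<nu>)\<close>. It is only used for dominant maps from a variety
  of dimension \<open>e\<close> to \<open>e\<close>-space, where this extension is algebraic.\<close>

definition separable_map ::
    "'a::alg_closed_field set \<Rightarrow> nat \<Rightarrow> (nat \<Rightarrow> 'a universal_domain) \<Rightarrow> nat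
      \<Rightarrow> (nat \<Rightarrow> 'a universal_domain) \<Rightarrow> bool"
  where "separable_map K n x e \<nu> \<longleftrightarrow> (\<forall>h\<in>adjoin K n x. separable_over (adjoin K e \<nu>) h)"


section \<open>PAC extensions\<close>

text \<open>Varieties are embedded affine ones. Abstract varieties give the same notion, since every
  variety has a non-empty affine open subvariety over \<open>K\<close>, to which a rational map restricts.\<close>

definition pac_extension :: "'a::alg_closed_field set \<Rightarrow> 'a set \<Rightarrow> bool"
  where "pac_extension K K0 \<longleftrightarrow> is_subfield K \<and> is_subfield K0 \<and> K0 \<subseteq> K \<and>
    (\<forall>n e V x \<nu>.
       1 \<le> e \<and> abs_irred_variety K n V \<and> generic_point n V x \<and> has_trdeg n x e \<and>
       rational_map K n x e \<nu> \<and> dominant_map K n V x e \<nu> \<and> separable_map K n x e \<nu> \<longrightarrow>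
       (\<exists>b\<in>rational_points K n V. \<exists>c. rat_map_value K n x e \<nu> b c \<and> (\<forall>j<e. c j \<in> K0)))"


section \<open>Absolute Galois groups\<close>

definition abs_galois_group :: "'a::alg_closed_field set \<Rightarrow> ('a \<Rightarrow> 'a) monoid"
  where "abs_galois_group K = BijGroup (sep_closure K) \<lparr>carrier :=
    {\<sigma> \<in> Bij (sep_closure K).
       (\<forall>a\<in>sep_closure K. \<forall>b\<in>sep_closure K. \<sigma> (a + b) = \<sigma> a + \<sigma> b \<and> \<sigma> (a * b) = \<sigma> a * \<sigma> b) \<and>
       (\<forall>a\<in>K. \<sigma> a = a)}\<rparr>"

text \<open>The Krull topology is the topology of pointwise convergence for the discrete topology.\<close>

definition krull_topology :: "'a::alg_closed_field set \<Rightarrow> ('a \<Rightarrow> 'a) topology"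
  where "krull_topology K =
    subtopology (product_topology (\<lambda>_. discrete_topology (sep_closure K)) (sep_closure K))
      (carrier (abs_galois_group K))"

definition galois_restriction :: "'a::alg_closed_field set \<Rightarrow> ('a \<Rightarrow> 'a) \<Rightarrow> 'a \<Rightarrow> 'a"
  where "galois_restriction E \<sigma> = restrict \<sigma> (sep_closure E)"

end

theory Submission
  imports Defs "Jordan_Normal_Form.Char_Poly"
begin

text \<open>
  Let \<open>M = K \<inter> K\<^sub>0\<^sub>s\<close>. Given a variety \<open>V\<close> and a map \<open>\<nu>\<close> over \<open>M\<close>, the PAC property of \<open>K / K\<^sub>0\<close>
  yields a point \<open>b \<in> V(K)\<close> with \<open>\<nu>(b)\<close> over \<open>K\<^sub>0\<close>, outside any prescribed hypersurface. Outside a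
  suitable one, simple roots specialise to simple roots; then the coordinates of \<open>b\<close> are separable
  over \<open>K\<^sub>0\<close>, so \<open>b \<in> V(M)\<close>.

  For the Galois groups, let \<open>\<alpha>\<close> be separable of degree \<open>e\<close> over \<open>K\<close> with conjugates \<open>\<alpha>\<^sub>i\<close>, and send
  a point \<open>x\<close> of affine \<open>e\<close>-space to the coefficients of \<open>\<Prod>\<^sub>i (Y - \<Sum>\<^sub>j x\<^sub>j \<alpha>\<^sub>i\<^sup>j)\<close>. This is a dominant
  separable map over \<open>K\<close>, so some \<open>b \<in> K\<^sup>e\<close> outside the locus where
  \<open>\<beta> = \<Sum>\<^sub>j b\<^sub>j \<alpha>\<^sup>j\<close> fails to generate \<open>K(\<alpha>)\<close> has its image over \<open>K\<^sub>0\<close>; then \<open>\<beta>\<close> is separable over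
  \<open>K\<^sub>0\<close> and \<open>\<alpha> \<in> K(\<beta>)\<close>. Hence \<open>K\<^sub>s = K K\<^sub>0\<^sub>s\<close>, which makes the restriction map injective with
  continuous inverse. It is surjective because an element of \<open>K\<^sub>0\<^sub>s\<close> has the same minimal
  polynomial over \<open>M\<close> and over \<open>K\<close>.
\<close>

text \<open>A PAC extension promises only one rational point, and both halves need one off a
  hypersurface \<open>D = 0\<close>. An extra coordinate equal to \<open>1 / D\<close> turns the
  complement into an affine variety with the same function field. Dominance survives this, and any
  change of base field, because it amounts to algebraic independence of the components of
  \<open>\<nu>\<close>. Separability is tested by \<open>simple_root_over\<close>. Having no
  minimality in it, the test passes to larger fields and to specialisations; that the accepted
  elements form a field is proved through towers, with a separate argument in characteristic p. In
  the second half the coordinates of a point are recovered from the conjugates of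
  \<open>\<beta>\<close> by Lagrange interpolation, which yields both dominance and separability of
  the map. The determinant \<open>gdet\<close> controls the rest: off its zeros each \<alpha>_i is
  the same polynomial in \<beta>_i, so the \<beta>_i are distinct too. An automorphism \<tau>
  extends by r(\<beta>) -> r(\<tau> \<beta>). Primitive elements, available as \<open>M\<close> is
  infinite, reduce well-definedness to one generator.\<close>

hide_const (open) Poly_Mapping.degree Polynomials.degree UnivPoly.monom

section \<open>Subfields and polynomials over them\<close>

lemma carrier_ring_of_type_algebra [simp]: "carrier ring_of_type_algebra = UNIV"
  and mult_ring_of_type_algebra [simp]: "x \<otimes>\<^bsub>ring_of_type_algebra\<^esub> y = x * y"
  and add_ring_of_type_algebra [simp]: "x \<oplus>\<^bsub>ring_of_type_algebra\<^esub> y = x + y"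
  and one_ring_of_type_algebra [simp]: "\<one>\<^bsub>ring_of_type_algebra\<^esub> = 1"
  and zero_ring_of_type_algebra [simp]: "\<zero>\<^bsub>ring_of_type_algebra\<^esub> = 0"
  by (simp_all add: ring_of_type_algebra_def)

lemma a_inv_ring_of_type_algebra [simp]:
  "\<ominus>\<^bsub>ring_of_type_algebra\<^esub> (x :: 'a::field) = - x"
proof -
  interpret R: field "ring_of_type_algebra :: 'a ring"
    by (rule field_from_type_algebra)
  show ?thesis
    by (rule R.minus_equality) simp_all
qed

lemma m_inv_ring_of_type_algebra [simp]:
  assumes "(x :: 'a::field) \<noteq> 0"
  shows "inv\<^bsub>ring_of_type_algebra\<^esub> x = inverse x"
proof -
  interpret R: field "ring_of_type_algebra :: 'a ring"
    by (rule field_from_type_algebra)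
  show ?thesis
    by (rule R.comm_inv_char) (use assms in simp_all)
qed

text \<open>The convention \<open>inverse 0 = 0\<close> allows closure under inverses to be asked of
  every element; zero itself arises as \<open>1 + (- 1)\<close>.\<close>

lemma is_subfield_iff:
  "is_subfield (E :: 'a::field set) \<longleftrightarrow> 1 \<in> E \<and>
     (\<forall>x\<in>E. - x \<in> E \<and> inverse x \<in> E \<and> (\<forall>y\<in>E. x + y \<in> E \<and> x * y \<in> E))"
proof -
  interpret R: field "ring_of_type_algebra :: 'a ring"
    by (rule field_from_type_algebra)
  show ?thesis
  proof
    assume E: "is_subfield E"
    note S = subringE[OF subfieldE(1)[OF E]]
    have "inverse x \<in> E" if "x \<in> E" for x
    proof (cases "x = 0")
      case False
      then show ?thesis using R.subfield_m_inv(1)[OF E, of x] that by simp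
    qed (use that in simp)
    with S show "1 \<in> E \<and>
     (\<forall>x\<in>E. - x \<in> E \<and> inverse x \<in> E \<and> (\<forall>y\<in>E. x + y \<in> E \<and> x * y \<in> E))"
      by simp
  next
    assume *: "1 \<in> E \<and>
     (\<forall>x\<in>E. - x \<in> E \<and> inverse x \<in> E \<and> (\<forall>y\<in>E. x + y \<in> E \<and> x * y \<in> E))"
    then show "is_subfield E"
      by (intro R.subfieldI' R.subringI) auto
  qed
qed

locale subfld =
  fixes E :: "'a::field set"
  assumes is_subfield: "is_subfield E"
begin

lemma one [simp, intro]: "1 \<in> E"
  and uminus [simp, intro]: "x \<in> E \<Longrightarrow> - x \<in> E"
  and inverse [simp, intro]: "x \<in> E \<Longrightarrow> inverse x \<in> E"
  and add [simp, intro]: "x \<in> E \<Longrightarrow> y \<in> E \<Longrightarrow> x + y \<in> E"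
  and mult [simp, intro]: "x \<in> E \<Longrightarrow> y \<in> E \<Longrightarrow> x * y \<in> E"
  using is_subfield unfolding is_subfield_iff by auto

lemma zero [simp, intro]: "0 \<in> E"
  using add[of 1 "- 1"] uminus[of 1] one by simp

lemma diff [simp, intro]: "x \<in> E \<Longrightarrow> y \<in> E \<Longrightarrow> x - y \<in> E"
  using add[of x "- y"] by simp

lemma divide [simp, intro]: "x \<in> E \<Longrightarrow> y \<in> E \<Longrightarrow> x / y \<in> E"
  by (simp add: divide_inverse)

lemma power [simp, intro]: "x \<in> E \<Longrightarrow> x ^ n \<in> E"
  by (induction n) auto

lemma sum [intro]: "(\<And>i. i \<in> I \<Longrightarrow> f i \<in> E) \<Longrightarrow> sum f I \<in> E"
  by (induction I rule: infinite_finite_induct) auto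

lemma prod [intro]: "(\<And>i. i \<in> I \<Longrightarrow> f i \<in> E) \<Longrightarrow> prod f I \<in> E"
  by (induction I rule: infinite_finite_induct) auto

lemma of_nat [simp, intro]: "of_nat n \<in> E"
  by (induction n) auto

end

section \<open>Polynomials with coefficients in a subfield\<close>

definition polys_over :: "'a::zero set \<Rightarrow> 'a poly set"
  where "polys_over E = {p. \<forall>i. coeff p i \<in> E}"

lemma polys_over_mono: "E \<subseteq> F \<Longrightarrow> polys_over E \<subseteq> polys_over F"
  by (auto simp: polys_over_def)

lemma polys_overI: "(\<And>i. coeff p i \<in> E) \<Longrightarrow> p \<in> polys_over E"
  by (simp add: polys_over_def)

lemma polys_overD: "p \<in> polys_over E \<Longrightarrow> coeff p i \<in> E"
  by (simp add: polys_over_def)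

context subfld
begin

lemma polys_zero [simp, intro]: "0 \<in> polys_over E"
  and polys_one [simp, intro]: "1 \<in> polys_over E"
  and polys_add [simp, intro]: "p \<in> polys_over E \<Longrightarrow> q \<in> polys_over E \<Longrightarrow> p + q \<in> polys_over E"
  and polys_diff [simp, intro]: "p \<in> polys_over E \<Longrightarrow> q \<in> polys_over E \<Longrightarrow> p - q \<in> polys_over E"
  and polys_uminus [simp, intro]: "p \<in> polys_over E \<Longrightarrow> - p \<in> polys_over E"
  and polys_smult [simp, intro]: "a \<in> E \<Longrightarrow> p \<in> polys_over E \<Longrightarrow> Polynomial.smult a p \<in> polys_over E"
  and polys_mult [simp, intro]: "p \<in> polys_over E \<Longrightarrow> q \<in> polys_over E \<Longrightarrow> p * q \<in> polys_over E"
  and polys_monom [simp, intro]: "a \<in> E \<Longrightarrow> monom a n \<in> polys_over E"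
  and polys_pderiv [simp, intro]: "p \<in> polys_over E \<Longrightarrow> pderiv p \<in> polys_over E"
  by (auto simp: polys_over_def coeff_1 coeff_mult coeff_pderiv when_def)

lemma polys_pCons [simp, intro]: "a \<in> E \<Longrightarrow> p \<in> polys_over E \<Longrightarrow> pCons a p \<in> polys_over E"
  by (auto simp: polys_over_def coeff_pCons split: nat.splits)

lemma polys_sum [intro]: "(\<And>i. i \<in> I \<Longrightarrow> f i \<in> polys_over E) \<Longrightarrow> sum f I \<in> polys_over E"
  by (induction I rule: infinite_finite_induct) auto

lemma polys_prod [intro]: "(\<And>i. i \<in> I \<Longrightarrow> f i \<in> polys_over E) \<Longrightarrow> prod f I \<in> polys_over E"
  by (induction I rule: infinite_finite_induct) auto

lemma polys_power [simp, intro]: "p \<in> polys_over E \<Longrightarrow> p ^ n \<in> polys_over E"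
  by (induction n) auto

lemma polys_eval [simp, intro]: "p \<in> polys_over E \<Longrightarrow> a \<in> E \<Longrightarrow> poly p a \<in> E"
  by (auto simp: poly_altdef polys_over_def)

lemma polys_pcompose [simp, intro]:
  assumes "p \<in> polys_over E" "q \<in> polys_over E"
  shows "pcompose p q \<in> polys_over E"
  using assms(1)
proof (induction p)
  case (pCons a p)
  then have "a \<in> E" "p \<in> polys_over E"
    by (auto simp: polys_over_def coeff_pCons split: nat.splits)
  with pCons assms(2) show ?case by (auto simp: pcompose_pCons)
qed simp

text \<open>Schoolbook division: the leading term is cancelled by a monomial whose coefficient is a
  quotient of elements of \<open>E\<close>, so quotient and remainder stay over
  \<open>E\<close>.\<close>

lemma polys_division:
  assumes "p \<in> polys_over E" "g \<in> polys_over E" "g \<noteq> 0"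
  obtains q r where "q \<in> polys_over E" "r \<in> polys_over E" "p = q * g + r"
    "r = 0 \<or> degree r < degree g"
proof -
  have "\<exists>q\<in>polys_over E. \<exists>r\<in>polys_over E. p = q * g + r \<and> (r = 0 \<or> degree r < degree g)"
    using assms(1)
  \<comment> \<open>The measure puts the zero polynomial strictly below the nonzero constants, so
    that a division step ending in 0 also decreases it.\<close>
  proof (induction "if p = 0 then 0 else Suc (degree p)" arbitrary: p rule: less_induct)
    case less
    show ?case
    proof (cases "p = 0 \<or> degree p < degree g")
      case True
      then show ?thesis using less.prems by (intro bexI[of _ 0] bexI[of _ p]) auto
    next
      case False
      define c where "c = lead_coeff p / lead_coeff g"
      define t where "t = monom c (degree p - degree g)"
      have t: "t \<in> polys_over E"
        unfolding t_def c_def using less.prems assms by (auto intro!: polys_monom divide polys_overD)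
      have c0: "c \<noteq> 0" using False assms by (auto simp: c_def)
      have dt: "degree (t * g) = degree p" "lead_coeff (t * g) = lead_coeff p"
      proof -
        show d: "degree (t * g) = degree p"
          using c0 False assms by (auto simp: t_def degree_mult_eq degree_monom_eq)
        have "lead_coeff t = c" using c0 by (simp add: t_def degree_monom_eq)
        then show "lead_coeff (t * g) = lead_coeff p"
          using assms(3) by (simp only: lead_coeff_mult) (simp add: c_def)
      qed
      have lt: "(if p - t * g = 0 then 0 else Suc (degree (p - t * g)))
          < (if p = 0 then 0 else Suc (degree p))"
      proof (cases "p - t * g = 0")
        case nz: False
        have "degree (p - t * g) \<le> degree p"
          using degree_diff_le_max[of p "t * g"] dt by simp
        moreover have "coeff (p - t * g) (degree p) = 0"
          using dt by simp
        ultimately have "degree (p - t * g) < degree p"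
          using nz by (metis le_neq_implies_less leading_coeff_0_iff)
        with nz False show ?thesis by simp
      qed (use False in simp)
      have pt: "p - t * g \<in> polys_over E" using t assms less.prems by auto
      from less.hyps[OF lt pt] obtain q r where
        "q \<in> polys_over E" "r \<in> polys_over E" "p - t * g = q * g + r" "r = 0 \<or> degree r < degree g"
        by blast
      then show ?thesis
        using t by (intro bexI[of _ "q + t"] bexI[of _ r]) (auto simp: algebra_simps)
    qed
  qed
  then show ?thesis using that by blast
qed

section \<open>Minimal polynomials\<close>

lemma min_poly_exists:
  assumes "algebraic_over E a"
  obtains m where "is_min_poly E a m"
proof -
  define P where "P = (\<lambda>p. p \<in> polys_over E \<and> p \<noteq> 0 \<and> poly p a = 0)"
  have "\<exists>p. P p"
    using assms by (auto simp: algebraic_over_def P_def polys_over_def)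
  then obtain p where p: "P p" and min: "\<And>q. P q \<Longrightarrow> degree p \<le> degree q"
    using ex_has_least_nat[of P _ degree] by blast
  define m where "m = Polynomial.smult (inverse (lead_coeff p)) p"
  have "is_min_poly E a m"
    unfolding is_min_poly_def
  proof (intro conjI allI impI)
    show "coeff m i \<in> E" for i
      using p by (auto simp: m_def P_def polys_over_def)
    show "lead_coeff m = 1" "poly m a = 0"
      using p by (auto simp: m_def P_def lead_coeff_smult)
    fix q assume "(\<forall>i. coeff q i \<in> E) \<and> q \<noteq> 0 \<and> poly q a = 0"
    then have "degree p \<le> degree q" by (intro min) (simp add: P_def polys_over_def)
    then show "degree m \<le> degree q" by (simp add: m_def)
  qed
  then show ?thesis using that by blast
qed

lemma min_polyD:
  assumes "is_min_poly E a m"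
  shows "m \<in> polys_over E" "lead_coeff m = 1" "poly m a = 0" "m \<noteq> 0"
    "\<And>q. q \<in> polys_over E \<Longrightarrow> poly q a = 0 \<Longrightarrow> q \<noteq> 0 \<Longrightarrow> degree m \<le> degree q"
  using assms by (auto simp: is_min_poly_def polys_over_def)

lemma min_poly_dvd:
  assumes "is_min_poly E a m" "p \<in> polys_over E" "poly p a = 0"
  obtains q where "q \<in> polys_over E" "p = q * m"
proof -
  note m = min_polyD[OF assms(1)]
  obtain q r where qr: "q \<in> polys_over E" "r \<in> polys_over E" "p = q * m + r"
      "r = 0 \<or> degree r < degree m"
    using polys_division[OF assms(2) m(1,4)] by blast
  have "poly r a = 0" using qr(3) assms(3) m(3) by simp
  with m(5)[OF qr(2)] qr(4) have "r = 0" by force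
  with qr that show ?thesis by simp
qed

lemma min_poly_degree_pos:
  assumes "is_min_poly E a m"
  shows "degree m > 0"
proof (rule ccontr)
  assume "\<not> degree m > 0"
  then obtain c where "m = [:c:]" by (metis degree_eq_zeroE gr0I)
  with min_polyD[OF assms] show False by auto
qed

text \<open>Irreducibility in disguise. If \<open>n\<close> is minimal for \<open>b\<close> and
  \<open>m = q * n\<close>, then \<open>a\<close> is a root of \<open>q\<close> or of
  \<open>n\<close>; the degree of \<open>q\<close> is too small, so \<open>n\<close> vanishes at
  \<open>a\<close> and has the degree of \<open>m\<close>.\<close>

lemma min_poly_conjugate:
  assumes m: "is_min_poly E a m" and b: "poly m b = 0"
  shows "is_min_poly E b m"
proof -
  note m' = min_polyD[OF m]
  have "algebraic_over E b"
    using m' b by (auto simp: algebraic_over_def polys_over_def)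
  then obtain n where n: "is_min_poly E b n" by (rule min_poly_exists)
  obtain q where q: "q \<in> polys_over E" "m = q * n"
    using min_poly_dvd[OF n m'(1) b] .
  have nz: "q \<noteq> 0" "n \<noteq> 0" using q m' by auto
  have dm: "degree m = degree q + degree n" using q(2) nz by (simp add: degree_mult_eq)
  have "poly q a * poly n a = 0" using m'(3) q(2) by simp
  moreover have "poly q a \<noteq> 0"
    using m'(5)[OF q(1) _ nz(1)] dm min_poly_degree_pos[OF n] by auto
  ultimately have "poly n a = 0" by simp
  then have "degree m \<le> degree n" by (intro m'(5) min_polyD(1)[OF n] nz) auto
  then show ?thesis
    using m' b min_polyD[OF n] unfolding is_min_poly_def by (auto simp: polys_over_def intro: order_trans)
qed

lemma min_poly_root_transfer:
  assumes "is_min_poly E a m" "poly m b = 0" "p \<in> polys_over E" "poly p a = 0"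
  shows "poly p b = 0"
proof -
  obtain q where "p = q * m" using min_poly_dvd[OF assms(1,3,4)] .
  then show ?thesis using assms(2) by simp
qed

lemma min_poly_unique_degree:
  assumes "is_min_poly E a m" "p \<in> polys_over E" "poly p a = 0" "degree p < degree m"
  shows "p = 0"
  using min_polyD(5)[OF assms(1-3)] assms(4) by force

end

section \<open>Simple roots and separability\<close>

lemma poly_simple_root_iff_order:
  fixes p :: "'a::field poly"
  assumes "p \<noteq> 0" "poly p a = 0"
  shows "poly (pderiv p) a \<noteq> 0 \<longleftrightarrow> Polynomial.order a p = 1"
proof -
  obtain q where q: "p = [:- a, 1:] * q" using assms by (auto simp: poly_eq_0_iff_dvd)
  have q0: "q \<noteq> 0" using q assms by auto
  have "poly (pderiv p) a = poly q a"
    unfolding q pderiv_mult by (simp add: pderiv_pCons)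
  moreover have "Polynomial.order a p = 1 + Polynomial.order a q"
    using assms(1) unfolding q by (subst order_mult) (auto simp: order_linear')
  ultimately show ?thesis using q0 by (simp add: order_root)
qed

lemma rsquarefree_iff:
  fixes p :: "'a::field poly"
  assumes "p \<noteq> 0"
  shows "rsquarefree p \<longleftrightarrow> (\<forall>a. poly p a = 0 \<longrightarrow> poly (pderiv p) a \<noteq> 0)"
proof -
  have "(poly p a = 0 \<longrightarrow> poly (pderiv p) a \<noteq> 0) \<longleftrightarrow> Polynomial.order a p = 0 \<or> Polynomial.order a p = 1"
    for a using poly_simple_root_iff_order[OF assms, of a] assms by (metis order_root)
  then show ?thesis using assms by (simp add: rsquarefree_def)
qed

text \<open>Separability without reference to a minimal polynomial. A witness stays a witness over a
  larger field, and specialising its coefficients keeps it one as long as the derivative does not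
  vanish.\<close>

definition simple_root_over :: "'a::field set \<Rightarrow> 'a \<Rightarrow> bool"
  where "simple_root_over E a \<longleftrightarrow> (\<exists>p\<in>polys_over E. poly p a = 0 \<and> poly (pderiv p) a \<noteq> 0)"

text \<open>A simple root of a multiple of \<open>m\<close> is a simple root of \<open>m\<close>. At
  any other root, \<open>m\<close> is again the minimal polynomial, and its derivative, of smaller
  degree and nonzero by its value at \<open>a\<close>, cannot vanish there.\<close>

lemma separable_over_iff:
  assumes "is_subfield (E :: 'a::alg_closed_field set)"
  shows "separable_over E a \<longleftrightarrow> simple_root_over E a"
proof -
  interpret E: subfld E by (rule subfld.intro) fact
  show ?thesis
  proof
    assume "separable_over E a"
    then show "simple_root_over E a"
      unfolding separable_over_def simple_root_over_def
      using E.min_polyD rsquarefree_iff by metis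
  next
    assume "simple_root_over E a"
    then obtain p where p: "p \<in> polys_over E" "poly p a = 0" "poly (pderiv p) a \<noteq> 0"
      by (auto simp: simple_root_over_def)
    then have "algebraic_over E a"
      by (auto simp: algebraic_over_def polys_over_def intro!: exI[of _ p])
    then obtain m where m: "is_min_poly E a m" by (rule E.min_poly_exists)
    note m' = E.min_polyD[OF m]
    obtain q where q: "q \<in> polys_over E" "p = q * m" using E.min_poly_dvd[OF m p(1,2)] .
    have d0: "poly (pderiv m) a \<noteq> 0"
      using p(3) m'(3) by (auto simp: q(2) pderiv_mult)
    have "poly (pderiv m) b \<noteq> 0" if "poly m b = 0" for b
    proof
      assume *: "poly (pderiv m) b = 0"
      have "is_min_poly E b m" by (rule E.min_poly_conjugate[OF m that])
      from E.min_poly_unique_degree[OF this E.polys_pderiv[OF m'(1)] *] E.min_poly_degree_pos[OF m]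
      have "pderiv m = 0" using degree_pderiv_le[of m] by linarith
      with d0 show False by simp
    qed
    then have "rsquarefree m" using m'(4) by (simp add: rsquarefree_iff)
    with m show "separable_over E a" by (auto simp: separable_over_def)
  qed
qed

lemma simple_root_over_mono: "E \<subseteq> F \<Longrightarrow> simple_root_over E a \<Longrightarrow> simple_root_over F a"
  using polys_over_mono unfolding simple_root_over_def by blast

lemma simple_root_over_self:
  assumes "is_subfield E" "a \<in> E"
  shows "simple_root_over E a"
proof -
  interpret E: subfld E by (rule subfld.intro) fact
  show ?thesis unfolding simple_root_over_def
    by (rule bexI[of _ "[:-a, 1:]"]) (use assms in \<open>auto simp: pderiv_pCons\<close>)
qed

section \<open>Separable closures\<close>

abbreviation genf :: "'a::field set \<Rightarrow> 'a set"
  where "genf S \<equiv> generate_field ring_of_type_algebra S"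

lemma genf_is_subfield [simp, intro]: "is_subfield (genf S)"
  by (rule field.generate_field_is_subfield[OF field_from_type_algebra]) simp

lemma genf_incl: "S \<subseteq> genf S"
  by (auto intro: generate_field.incl)

lemma genf_least: "is_subfield E \<Longrightarrow> S \<subseteq> E \<Longrightarrow> genf S \<subseteq> E"
  by (rule field.generate_field_min_subfield1[OF field_from_type_algebra]) simp_all

lemma genf_mono: "S \<subseteq> T \<Longrightarrow> genf S \<subseteq> genf T"
  using genf_incl by (intro genf_least) auto

definition fext :: "'a::field set \<Rightarrow> 'a \<Rightarrow> 'a set"
  where "fext E a = genf (insert a E)"

lemma fext_is_subfield [simp, intro]: "is_subfield (fext E a)"
  and fext_base: "E \<subseteq> fext E a"
  and fext_gen [simp, intro]: "a \<in> fext E a"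
  using genf_incl[of "insert a E"] by (auto simp: fext_def)

lemma fext_least: "is_subfield F \<Longrightarrow> E \<subseteq> F \<Longrightarrow> a \<in> F \<Longrightarrow> fext E a \<subseteq> F"
  unfolding fext_def by (rule genf_least) auto

lemma fext_mono: "E \<subseteq> F \<Longrightarrow> fext E a \<subseteq> fext F a"
  unfolding fext_def by (rule genf_mono) auto

text \<open>The fractions in \<open>a\<close> form a subfield containing \<open>E\<close> and
  \<open>a\<close>, hence exhaust the extension; the inverse of 0 is represented as 0 / 1.\<close>

lemma fext_quotient:
  assumes "is_subfield E" "c \<in> fext E a"
  obtains r s where "r \<in> polys_over E" "s \<in> polys_over E" "poly s a \<noteq> 0" "c = poly r a / poly s a"
proof -
  interpret E: subfld E by (rule subfld.intro) fact
  define Q where "Q = {poly r a / poly s a |r s. r \<in> polys_over E \<and> s \<in> polys_over E \<and> poly s a \<noteq> 0}"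
  have Q1: "1 \<in> Q" unfolding Q_def by (intro CollectI exI[of _ 1]) auto
  have QI: "poly r a / poly s a \<in> Q" if "r \<in> polys_over E" "s \<in> polys_over E" "poly s a \<noteq> 0" for r s
    using that by (auto simp: Q_def)
  have "is_subfield Q"
    unfolding is_subfield_iff
  proof (intro conjI ballI)
    fix x y assume "x \<in> Q" "y \<in> Q"
    then obtain r s u v where x: "x = poly r a / poly s a" and y: "y = poly u a / poly v a"
      and P: "r \<in> polys_over E" "s \<in> polys_over E" "u \<in> polys_over E" "v \<in> polys_over E"
      and nz: "poly s a \<noteq> 0" "poly v a \<noteq> 0" by (auto simp: Q_def)
    show "- x \<in> Q" using QI[of "- r" s] P nz by (simp add: x)
    show "inverse x \<in> Q"
      using QI[of s r] QI[of 0 1] P nz by (cases "poly r a = 0") (auto simp: x)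
    show "x + y \<in> Q"
      using QI[of "r * v + u * s" "s * v"] P nz by (simp add: x y add_frac_eq)
    show "x * y \<in> Q"
      using QI[of "r * u" "s * v"] P nz by (simp add: x y)
  qed (fact Q1)
  moreover have "E \<subseteq> Q"
  proof
    fix e assume "e \<in> E"
    then show "e \<in> Q" using QI[of "[:e:]" 1] by simp
  qed
  moreover have "a \<in> Q" using QI[of "[:0,1:]" 1] by simp
  ultimately have "fext E a \<subseteq> Q" by (intro fext_least)
  with assms that show ?thesis by (auto simp: Q_def)
qed

text \<open>Bezout: a nonzero combination of \<open>m\<close> and \<open>s\<close> of least degree
  divides both. It does not vanish at \<open>a\<close> because \<open>s\<close> does not, so by
  minimality of \<open>m\<close> it is a constant, and the combination evaluated at \<open>a\<close>
  exhibits the inverse.\<close>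

lemma algebraic_inverse_poly:
  assumes "is_subfield E" "is_min_poly E a m" "s \<in> polys_over E" "poly s a \<noteq> 0"
  obtains v where "v \<in> polys_over E" "inverse (poly s a) = poly v a"
proof -
  interpret E: subfld E by (rule subfld.intro) fact
  note m = E.min_polyD[OF assms(2)]
  define P where "P = (\<lambda>d. d \<noteq> 0 \<and> d \<in> polys_over E \<and> (\<exists>u\<in>polys_over E. \<exists>v\<in>polys_over E. d = u * m + v * s))"
  have "P m" unfolding P_def using m by (intro conjI bexI[of _ 1] bexI[of _ 0]) auto
  then obtain d where d: "P d" and min: "\<And>e. P e \<Longrightarrow> degree d \<le> degree e"
    using ex_has_least_nat[of P m degree] by blast
  from d obtain u v where uv: "u \<in> polys_over E" "v \<in> polys_over E" "d = u * m + v * s"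
    and d0: "d \<noteq> 0" "d \<in> polys_over E" by (auto simp: P_def)
  have dvd: "\<exists>q\<in>polys_over E. p = q * d" if p: "p \<in> polys_over E" "u' \<in> polys_over E" "v' \<in> polys_over E" "p = u' * m + v' * s" for p u' v'
  proof -
    obtain q r where qr: "q \<in> polys_over E" "r \<in> polys_over E" "p = q * d + r" "r = 0 \<or> degree r < degree d"
      using E.polys_division[OF p(1) d0(2,1)] .
    have "r = (u' - q * u) * m + (v' - q * v) * s" using qr(3) p(4) uv(3) by (simp add: algebra_simps)
    then have "r \<noteq> 0 \<Longrightarrow> P r" unfolding P_def using qr p uv
      by (intro conjI bexI[of _ "u' - q * u"] bexI[of _ "v' - q * v"]) auto
    with min[of r] qr(4) have "r = 0" by force
    with qr show ?thesis by auto
  qed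
  obtain q where q: "q \<in> polys_over E" "m = q * d" using dvd[of m 1 0] m by auto
  obtain q' where q': "q' \<in> polys_over E" "s = q' * d" using dvd[of s 0 1] assms by auto
  have "poly d a \<noteq> 0" using q'(2) assms(4) by auto
  then have "poly q a = 0" using m(3) q(2) by simp
  moreover have "q \<noteq> 0" using q m by auto
  ultimately have "degree m \<le> degree q" using m(5)[OF q(1)] by simp
  then have "degree d = 0" using q(2) \<open>q \<noteq> 0\<close> d0(1) by (simp add: degree_mult_eq)
  then obtain c where c: "d = [:c:]" by (metis degree_eq_zeroE)
  have cE: "c \<in> E" using d0(2) c by (auto simp: polys_over_def dest: spec[of _ 0])
  have c0: "c \<noteq> 0" using d0 c by auto
  have "c = poly v a * poly s a" using arg_cong[OF uv(3), of "\<lambda>p. poly p a"] m(3) c by simp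
  then have "inverse (poly s a) = poly (Polynomial.smult (inverse c) v) a"
    using assms(4) c0 by (auto simp: field_simps)
  then show ?thesis using uv cE by (intro that[of "Polynomial.smult (inverse c) v"]) auto
qed

lemma fext_algebraic_poly:
  assumes "is_subfield E" "is_min_poly E a m" "c \<in> fext E a"
  obtains r where "r \<in> polys_over E" "c = poly r a" "degree r < degree m"
proof -
  interpret E: subfld E by (rule subfld.intro) fact
  note m = E.min_polyD[OF assms(2)]
  obtain r s where rs: "r \<in> polys_over E" "s \<in> polys_over E" "poly s a \<noteq> 0" "c = poly r a / poly s a"
    using fext_quotient[OF assms(1,3)] .
  obtain v where v: "v \<in> polys_over E" "inverse (poly s a) = poly v a"
    using algebraic_inverse_poly[OF assms(1,2) rs(2,3)] .
  have c: "c = poly (r * v) a" using rs v by (simp add: divide_inverse)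
  obtain q t where t: "q \<in> polys_over E" "t \<in> polys_over E" "r * v = q * m + t" "t = 0 \<or> degree t < degree m"
    using E.polys_division[of "r * v" m] rs v m by blast
  have "c = poly t a" using c t(3) m(3) by simp
  moreover have "degree t < degree m" using t(4) E.min_poly_degree_pos[OF assms(2)] by auto
  ultimately show ?thesis using that[of t] t by blast
qed

text \<open>Any finite set of separable elements lies in such a tower. Closure properties of
  \<open>sep_closure\<close> therefore reduce to one claim: every element of a tower is separable
  over its base.\<close>

inductive sep_tower :: "'a::field set \<Rightarrow> 'a set \<Rightarrow> bool" for E where
  base: "sep_tower E E"
| step: "sep_tower E L \<Longrightarrow> simple_root_over L g \<Longrightarrow> sep_tower E (fext L g)"

lemma sep_tower_is_subfield: "sep_tower E L \<Longrightarrow> is_subfield E \<Longrightarrow> is_subfield L"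
  by (induction rule: sep_tower.induct) auto

lemma sep_tower_base: "sep_tower E L \<Longrightarrow> E \<subseteq> L"
proof (induction rule: sep_tower.induct)
  case (step L g)
  with fext_base[of L g] show ?case by blast
qed simp

lemma sep_tower_base_change:
  assumes "sep_tower E L" "E \<subseteq> F"
  shows "\<exists>L'. sep_tower F L' \<and> L \<subseteq> L'"
  using assms
proof (induction rule: sep_tower.induct)
  case (step L g)
  then obtain L' where L': "sep_tower F L'" "L \<subseteq> L'" by auto
  then have "sep_tower F (fext L' g)"
    by (intro sep_tower.step simple_root_over_mono[OF L'(2) step(2)])
  with fext_mono[OF L'(2)] show ?case by blast
qed (auto intro: sep_tower.base)

lemma simple_root_algebraic: "simple_root_over E a \<Longrightarrow> algebraic_over E a"
proof -
  assume "simple_root_over E a"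
  then obtain p where p: "p \<in> polys_over E" "poly p a = 0" "poly (pderiv p) a \<noteq> 0"
    by (auto simp: simple_root_over_def)
  then have "p \<noteq> 0" by auto
  with p show ?thesis by (auto simp: algebraic_over_def polys_over_def)
qed

text \<open>The minimal polynomials of \<open>g\<close> over \<open>F\<close> and over \<open>F(d)\<close> have the same, simple, roots,
  because the \<open>p\<close>-th power of the latter lies over \<open>F\<close>; hence they agree.\<close>

lemma p_th_power_descent:
  fixes d :: "'a::alg_closed_field"
  assumes F: "is_subfield F" and g: "simple_root_over F g"
    and p: "prime CHAR('a)" and dp: "d ^ CHAR('a) \<in> F" and d: "d \<in> fext F g"
  shows "d \<in> F"
proof -
  let ?p = "CHAR('a)"
  interpret F: subfld F by (rule subfld.intro) fact
  interpret Fd: subfld "fext F d" by (rule subfld.intro) simp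
  obtain m where m: "is_min_poly F g m" "rsquarefree m"
    using g separable_over_iff[OF F] by (auto simp: separable_over_def)
  note m' = F.min_polyD[OF m(1)]
  have mFd: "m \<in> polys_over (fext F d)" using m'(1) polys_over_mono fext_base by blast
  have "algebraic_over (fext F d) g"
    using mFd m' by (auto simp: algebraic_over_def polys_over_def)
  then obtain n where n: "is_min_poly (fext F d) g n" by (rule Fd.min_poly_exists)
  note n' = Fd.min_polyD[OF n]
  obtain q where q: "m = q * n" using Fd.min_poly_dvd[OF n mFd m'(3)] by metis
  have powF: "c ^ ?p \<in> F" if "c \<in> fext F d" for c
  proof -
    obtain r s where rs: "r \<in> polys_over F" "s \<in> polys_over F" "c = poly r d / poly s d"
      using fext_quotient[OF F \<open>c \<in> fext F d\<close>] .
    have *: "poly t d ^ ?p \<in> F" if "t \<in> polys_over F" for t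
    proof -
      have "poly t d ^ ?p = (\<Sum>i\<le>degree t. (coeff t i * d ^ i) ^ ?p)"
        unfolding poly_altdef by (rule freshmans_dream_sum[OF p refl])
      also have "\<dots> = (\<Sum>i\<le>degree t. coeff t i ^ ?p * (d ^ ?p) ^ i)"
        by (simp add: power_mult_distrib power_mult [symmetric] mult.commute)
      also have "\<dots> \<in> F"
        by (intro F.sum F.mult F.power[OF polys_overD[OF that]] F.power[OF dp])
      finally show ?thesis .
    qed
    show ?thesis using *[OF rs(1)] *[OF rs(2)] by (simp add: rs(3) power_divide)
  qed
  have cp: "prime CHAR('a poly)" using p by simp
  \<comment> \<open>Frobenius acts on each monomial separately, and p-th powers of elements of F(d)
    lie in \<open>F\<close> because d^p does.\<close>
  have "n ^ ?p \<in> polys_over F"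
  proof -
    have "n ^ ?p = (\<Sum>i\<le>degree n. monom (coeff n i) i) ^ CHAR('a poly)"
      by (simp add: poly_as_sum_of_monoms)
    also have "\<dots> = (\<Sum>i\<le>degree n. monom (coeff n i) i ^ CHAR('a poly))"
      by (rule freshmans_dream_sum[OF cp refl])
    also have "\<dots> \<in> polys_over F"
      using polys_overD[OF n'(1)] powF by (intro F.polys_sum) (auto simp: monom_power)
    finally show ?thesis .
  qed
  moreover have "poly (n ^ ?p) g = 0" using n'(3) p by (simp add: prime_gt_0_nat)
  ultimately obtain q' where q': "n ^ ?p = q' * m" using F.min_poly_dvd[OF m(1)] by metis
  \<comment> \<open>Since \<open>m\<close> divides a power of \<open>n\<close>, a root of
    \<open>q\<close> is also a root of \<open>n\<close>, hence a multiple root of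
    \<open>m = q * n\<close>.\<close>
  have "degree q = 0"
  proof (rule ccontr)
    assume "degree q \<noteq> 0"
    then obtain b where b: "poly q b = 0" using alg_closed_imp_poly_has_root[of q] by auto
    then have "poly m b = 0" by (simp add: q)
    then have "poly n b ^ ?p = 0" using arg_cong[OF q', of "\<lambda>p. poly p b"] by simp
    then have "poly n b = 0" by simp
    then have "poly (pderiv m) b = 0" using b by (simp add: q pderiv_mult)
    with \<open>poly m b = 0\<close> m m'(4) show False by (simp add: rsquarefree_iff)
  qed
  then have deg: "degree n = degree m"
    using q m'(4) by (metis add_0 degree_mult_eq mult_eq_0_iff)
  obtain r where r: "r \<in> polys_over F" "d = poly r g" "degree r < degree m"
    using fext_algebraic_poly[OF F m(1) d] .
  \<comment> \<open>\<open>d = poly r g\<close> makes \<open>g\<close> a root of this polynomial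
    over F(d). Its degree is below that of \<open>n\<close>, so it vanishes and \<open>d\<close> is
    the constant coefficient of \<open>r\<close>.\<close>
  have "r - [:d:] = 0"
  proof (rule Fd.min_poly_unique_degree[OF n])
    show "r - [:d:] \<in> polys_over (fext F d)"
      using r(1) polys_over_mono[OF fext_base[of F d]] by (intro Fd.polys_diff) auto
    show "degree (r - [:d:]) < degree n"
      using r(3) deg by (simp add: degree_diff_less)
  qed (use r in simp)
  then have "coeff r 0 = d" by simp
  then show ?thesis using polys_overD[OF r(1), of 0] by simp
qed

text \<open>The p-th power of \<open>d\<close> lies in every level, so the descent for a single step
  pushes \<open>d\<close> down from the top level to the base.\<close>

lemma sep_tower_p_th_power:
  fixes d :: "'a::alg_closed_field"
  assumes "sep_tower F L" "is_subfield F" "prime CHAR('a)" "d ^ CHAR('a) \<in> F" "d \<in> L"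
  shows "d \<in> F"
  using assms
proof (induction rule: sep_tower.induct)
  case (step L g)
  have "d \<in> L"
    by (rule p_th_power_descent[OF sep_tower_is_subfield[OF step(1,4)] step(2,5) _ step(7)])
      (use sep_tower_base[OF step(1)] step in blast)
  with step show ?case by auto
qed

text \<open>If d = r(d^p) / s(d^p), then \<open>d\<close> is a root of r(X^p) - X s(X^p). The
  derivative of X^p is 0, so this polynomial has derivative - s(X^p), which is nonzero at
  \<open>d\<close>.\<close>

lemma simple_root_over_p_th_power:
  fixes d :: "'a::field"
  assumes E: "is_subfield E" and p: "prime CHAR('a)" and d: "d \<in> fext E (d ^ CHAR('a))"
  shows "simple_root_over E d"
proof -
  interpret E: subfld E by (rule subfld.intro) fact
  let ?p = "CHAR('a)" and ?c = "d ^ CHAR('a)"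
  obtain r s where rs: "r \<in> polys_over E" "s \<in> polys_over E" "poly s ?c \<noteq> 0" "d = poly r ?c / poly s ?c"
    using fext_quotient[OF E d] .
  define xp where "xp = (monom 1 ?p :: 'a poly)"
  have dxp: "pderiv xp = 0" by (simp add: xp_def pderiv_monom)
  have pd: "pderiv (pcompose t xp) = 0" for t by (simp add: pderiv_pcompose dxp)
  have xp: "xp \<in> polys_over E" by (auto simp: xp_def)
  have ev: "poly xp d = ?c" by (simp add: xp_def poly_monom)
  define W where "W = pcompose r xp - [:0, 1:] * pcompose s xp"
  have "W \<in> polys_over E" using xp rs by (auto simp: W_def)
  moreover have "poly W d = 0"
  proof -
    have "poly r ?c = d * poly s ?c" using rs(3,4) by (metis nonzero_eq_divide_eq)
    then show ?thesis by (simp add: W_def poly_pcompose ev)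
  qed
  moreover have "poly (pderiv W) d \<noteq> 0"
  proof -
    have "pderiv W = - pcompose s xp"
      unfolding W_def pderiv_diff pderiv_mult pd by (simp add: pderiv_pCons)
    with rs(3) show ?thesis by (simp add: poly_pcompose ev)
  qed
  ultimately show ?thesis by (auto simp: simple_root_over_def)
qed

section \<open>Finite-dimensional extensions are algebraic\<close>

text \<open>A linear span built one term at a time: generators may repeat, and
  \<open>lspan_coeffs\<close> collects the coefficients afterwards.\<close>

inductive_set lspan :: "'a::field set \<Rightarrow> 'a set \<Rightarrow> 'a set" for E B where
  zero: "0 \<in> lspan E B"
| add: "x \<in> lspan E B \<Longrightarrow> e \<in> E \<Longrightarrow> b \<in> B \<Longrightarrow> x + e * b \<in> lspan E B"

lemma lspan_add_closed: "y \<in> lspan E B \<Longrightarrow> x \<in> lspan E B \<Longrightarrow> x + y \<in> lspan E B"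
  by (induction rule: lspan.induct) (auto simp: add.assoc [symmetric] intro: lspan.intros)

lemma lspan_sum: "(\<And>i. i \<in> I \<Longrightarrow> f i \<in> lspan E B) \<Longrightarrow> sum f I \<in> lspan E B"
  by (induction I rule: infinite_finite_induct) (auto intro: lspan.zero lspan_add_closed)

lemma lspan_coeffs:
  assumes "x \<in> lspan E B" "finite B" "is_subfield E"
  shows "\<exists>c. (\<forall>b\<in>B. c b \<in> E) \<and> x = (\<Sum>b\<in>B. c b * b)"
  using assms
proof (induction rule: lspan.induct)
  case zero
  interpret E: subfld E by (rule subfld.intro) fact
  show ?case by (intro exI[of _ "\<lambda>_. 0"]) auto
next
  case (add x e b)
  interpret E: subfld E by (rule subfld.intro) fact
  from add obtain c where c: "\<forall>b\<in>B. c b \<in> E" "x = (\<Sum>b\<in>B. c b * b)" by auto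
  have "(\<Sum>b'\<in>B. (if b' = b then e else 0) * b') = e * b"
    using add by (simp add: sum.delta if_distrib [of "\<lambda>z. z * _"] cong: if_cong)
  then have "x + e * b = (\<Sum>b'\<in>B. (c b' + (if b' = b then e else 0)) * b')"
    unfolding c(2) by (simp add: algebra_simps sum.distrib)
  then show ?case using c add by (intro exI[of _ "\<lambda>b'. c b' + (if b' = b then e else 0)"]) auto
qed

text \<open>Leibniz formula. \<open>P\<close> is a set closed under the ring operations rather than
  a field, so that the lemma also covers polynomial entries with restricted coefficients.\<close>

lemma det_over:
  assumes "0 \<in> P" "1 \<in> P" "\<And>x y. x \<in> P \<Longrightarrow> y \<in> P \<Longrightarrow> x + y \<in> P"
    "\<And>x y. x \<in> P \<Longrightarrow> y \<in> P \<Longrightarrow> x * y \<in> P" "\<And>x. x \<in> P \<Longrightarrow> - x \<in> P"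
    "A \<in> carrier_mat n n" "\<And>i j. i < n \<Longrightarrow> j < n \<Longrightarrow> A $$ (i, j) \<in> P"
  shows "det A \<in> P"
proof -
  have s: "(\<And>i. i \<in> I \<Longrightarrow> f i \<in> P) \<Longrightarrow> sum f I \<in> P" for f and I :: "(nat \<Rightarrow> nat) set"
    using assms by (induction I rule: infinite_finite_induct) auto
  have p: "(\<And>i. i \<in> I \<Longrightarrow> f i \<in> P) \<Longrightarrow> prod f I \<in> P" for f and I :: "nat set"
    using assms by (induction I rule: infinite_finite_induct) auto
  have sg: "signof p \<in> P" for p
    using assms(2,5) by (simp add: sign_def)
  show ?thesis
    unfolding det_def'[OF assms(6)]
    by (intro s assms(4) sg p assms(7)) (auto dest: permutes_in_image)
qed

lemma char_poly_over:
  fixes P :: "'b::comm_ring_1 set"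
  assumes P: "0 \<in> P" "1 \<in> P" "\<And>x y. x \<in> P \<Longrightarrow> y \<in> P \<Longrightarrow> x + y \<in> P"
    "\<And>x y. x \<in> P \<Longrightarrow> y \<in> P \<Longrightarrow> x * y \<in> P" "\<And>x. x \<in> P \<Longrightarrow> - x \<in> P"
    and A: "A \<in> carrier_mat n n" "\<And>i j. i < n \<Longrightarrow> j < n \<Longrightarrow> A $$ (i, j) \<in> P"
  shows "char_poly A \<in> polys_over P"
proof -
  have s: "(\<And>i. i \<in> I \<Longrightarrow> f i \<in> P) \<Longrightarrow> sum f I \<in> P" for f and I :: "nat set"
    using P by (induction I rule: infinite_finite_induct) auto
  have pC: "pCons a p \<in> polys_over P" if "a \<in> P" "p \<in> polys_over P" for a p
    using that by (auto simp: polys_over_def coeff_pCons split: nat.splits)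
  have "det (char_poly_matrix A) \<in> polys_over P"
  proof (rule det_over)
    show "char_poly_matrix A \<in> carrier_mat n n" using A by simp
    have z: "0 \<in> polys_over P" using P by (simp add: polys_over_def)
    fix i j assume "i < n" "j < n"
    then show "char_poly_matrix A $$ (i, j) \<in> polys_over P"
      using A P pC[OF _ z] pC[OF P(5)[OF A(2)], of _ _ 1]
      by (auto simp: char_poly_matrix_def one_pCons)
  qed (use P in \<open>auto simp: polys_over_def coeff_1 when_def coeff_mult intro!: s\<close>)
  then show ?thesis by (simp add: char_poly_def)
qed

text \<open>The eigenvalue criterion lives over fields. The detour through the fraction field makes
  it available for matrices of multivariate polynomials.\<close>

lemma char_poly_root:
  fixes A :: "'b::idom mat"
  assumes A: "A \<in> carrier_mat n n" and v: "v \<in> carrier_vec n" "v \<noteq> 0\<^sub>v n"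
    and ev: "A *\<^sub>v v = k \<cdot>\<^sub>v v"
  shows "poly (char_poly A) k = 0"
proof -
  interpret h: inj_comm_ring_hom "to_fract :: 'b \<Rightarrow> 'b fract"
    by (unfold_locales, auto)
  let ?A = "map_mat to_fract A" and ?v = "map_vec to_fract v"
  have "eigenvector ?A ?v (to_fract k)"
    unfolding eigenvector_def
  proof (intro conjI)
    show "?v \<in> carrier_vec (dim_row ?A)" using A v by simp
    show "?v \<noteq> 0\<^sub>v (dim_row ?A)"
    proof
      assume *: "?v = 0\<^sub>v (dim_row ?A)"
      have "v = 0\<^sub>v n"
      proof (rule eq_vecI)
        fix i assume "i < dim_vec (0\<^sub>v n :: 'b vec)"
        then show "v $ i = 0\<^sub>v n $ i"
          using A v arg_cong[OF *, of "\<lambda>w. vec_index w i"] by simp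
      qed (use v in simp)
      with v show False by simp
    qed
    show "?A *\<^sub>v ?v = to_fract k \<cdot>\<^sub>v ?v"
      using arg_cong[OF ev, of "map_vec to_fract"] A v
      by (simp add: h.mult_mat_vec_hom h.vec_hom_smult)
  qed
  then have "eigenvalue ?A (to_fract k)" by (auto simp: eigenvalue_def)
  then have "poly (char_poly ?A) (to_fract k) = 0"
    using eigenvalue_root_char_poly[of ?A n] A by simp
  then show ?thesis by (simp add: h.char_poly_hom[OF A])
qed

text \<open>The determinant trick: multiplication by \<open>d\<close> on the generators is given by
  a matrix over \<open>E\<close>, and the vector of generators is an eigenvector for
  \<open>d\<close>, nonzero because 1 is in the span. The monic characteristic polynomial then
  annihilates \<open>d\<close>.\<close>

lemma lspan_stable_algebraic:
  assumes E: "is_subfield E" and B: "finite B" and one: "1 \<in> lspan E B"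
    and st: "\<And>b. b \<in> B \<Longrightarrow> d * b \<in> lspan E B"
  shows "algebraic_over E d"
proof -
  interpret E: subfld E by (rule subfld.intro) fact
  obtain vs where vs: "set vs = B" "distinct vs" using finite_distinct_list[OF B] by blast
  define n where "n = length vs"
  have bij: "bij_betw (\<lambda>i. vs ! i) {..<n} B"
    using bij_betw_nth[OF vs(2), of "{..<n}" B] vs by (simp add: n_def)
  have nB: "vs ! i \<in> B" if "i < n" for i using that vs by (auto simp: n_def)
  obtain c where c: "\<And>b x. b \<in> B \<Longrightarrow> x \<in> B \<Longrightarrow> c b x \<in> E" "\<And>b. b \<in> B \<Longrightarrow> d * b = (\<Sum>x\<in>B. c b x * x)"
    using lspan_coeffs[OF st B E] by metis
  define A where "A = mat n n (\<lambda>(i, j). c (vs ! i) (vs ! j))"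
  have A: "A \<in> carrier_mat n n" by (simp add: A_def)
  define v where "v = vec n (\<lambda>i. vs ! i)"
  have "A *\<^sub>v v = d \<cdot>\<^sub>v v"
  proof (rule eq_vecI)
    fix i assume "i < dim_vec (d \<cdot>\<^sub>v v)"
    then have i: "i < n" by (simp add: v_def)
    have "(A *\<^sub>v v) $ i = (\<Sum>j<n. c (vs ! i) (vs ! j) * vs ! j)"
      using i by (simp add: A_def v_def scalar_prod_def atLeast0LessThan)
    also have "\<dots> = (\<Sum>x\<in>B. c (vs ! i) x * x)"
      by (rule sum.reindex_bij_betw[OF bij])
    also have "\<dots> = d * vs ! i" using c(2)[OF nB[OF i]] by simp
    finally show "(A *\<^sub>v v) $ i = (d \<cdot>\<^sub>v v) $ i" using i by (simp add: v_def)
  qed (simp add: A_def v_def)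
  moreover have "v \<noteq> 0\<^sub>v n"
  proof
    assume v0: "v = 0\<^sub>v n"
    have "b = 0" if "b \<in> B" for b
    proof -
      obtain i where "i < n" "b = vs ! i"
        using \<open>b \<in> B\<close> unfolding n_def vs(1) [symmetric] in_set_conv_nth by auto
      then show ?thesis using arg_cong[OF v0, of "\<lambda>w. vec_index w i"] by (simp add: v_def)
    qed
    then have "(\<Sum>b\<in>B. e b * b) = 0" for e by (intro sum.neutral ballI) simp
    moreover obtain e where "1 = (\<Sum>b\<in>B. e b * b)" using lspan_coeffs[OF one B E] by auto
    ultimately show False by simp
  qed
  ultimately have "poly (char_poly A) d = 0"
    by (intro char_poly_root[OF A]) (auto simp: v_def)
  moreover have "char_poly A \<in> polys_over E"
    by (rule char_poly_over[OF _ _ _ _ _ A]) (use c(1) nB in \<open>auto simp: A_def\<close>)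
  moreover have "char_poly A \<noteq> 0" using degree_monic_char_poly[OF A] by auto
  ultimately show ?thesis by (auto simp: algebraic_over_def polys_over_def)
qed

text \<open>Elements of L(g) are polynomials in \<open>g\<close> of bounded degree, so the products
  of elements of \<open>B\<close> with small powers of \<open>g\<close> span.\<close>

lemma fext_finite_span:
  assumes E: "is_subfield E" and L: "is_subfield L" and g: "algebraic_over L g"
    and B: "finite B" "L \<subseteq> lspan E B" "B \<subseteq> L"
  obtains B' where "finite B'" "fext L g \<subseteq> lspan E B'" "B' \<subseteq> fext L g"
proof -
  interpret L: subfld L by (rule subfld.intro) fact
  obtain m where m: "is_min_poly L g m" using L.min_poly_exists[OF g] .
  define B' where "B' = (\<lambda>(b, k). b * g ^ k) ` (B \<times> {..degree m})"
  have "x * g ^ k \<in> lspan E B'" if "x \<in> lspan E B" "k \<le> degree m" for x k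
    using that
  proof (induction rule: lspan.induct)
    case (add x e b)
    have "b * g ^ k \<in> B'" using add by (auto simp: B'_def)
    with add lspan.add[of "x * g ^ k" E B' e "b * g ^ k"] show ?case by (simp add: algebra_simps)
  qed (auto intro: lspan.zero)
  note mem = this
  have "c \<in> lspan E B'" if c: "c \<in> fext L g" for c
  proof -
    obtain r where r: "r \<in> polys_over L" "c = poly r g" "degree r < degree m"
      using fext_algebraic_poly[OF L m c] .
    have "coeff r i * g ^ i \<in> lspan E B'" if "i \<le> degree r" for i
      using mem[of "coeff r i" i] polys_overD[OF r(1), of i] B that r(3) by auto
    then show ?thesis unfolding r(2) poly_altdef by (intro lspan_sum) auto
  qed
  moreover have "B' \<subseteq> fext L g"
  proof -
    interpret Lg: subfld "fext L g" by (rule subfld.intro) simp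
    show ?thesis using B(3) fext_base[of L g] by (auto simp: B'_def)
  qed
  ultimately show ?thesis using that[of B'] B(1) by (auto simp: B'_def)
qed

lemma sep_tower_algebraic:
  assumes "sep_tower E L" "is_subfield E" "d \<in> L"
  shows "algebraic_over E d"
proof -
  \<comment> \<open>The inclusion of \<open>B\<close> in \<open>L\<close> is carried along because
    multiplication by an element of \<open>L\<close> must send \<open>B\<close> into the
    span.\<close>
  have "\<exists>B. finite B \<and> L \<subseteq> lspan E B \<and> B \<subseteq> L"
    using assms(1)
  proof (induction rule: sep_tower.induct)
    case base
    have "e \<in> lspan E {1}" if "e \<in> E" for e
      using lspan.add[OF lspan.zero that, of 1 "{1}"] by simp
    with assms(2) show ?case by (intro exI[of _ "{1}"]) (auto simp: is_subfield_iff)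
  next
    case (step L g)
    then obtain B where B: "finite B" "L \<subseteq> lspan E B" "B \<subseteq> L" by auto
    show ?case
      using fext_finite_span[OF assms(2) sep_tower_is_subfield[OF step(1) assms(2)] simple_root_algebraic[OF step(2)] B]
      by metis
  qed
  then obtain B where B: "finite B" "L \<subseteq> lspan E B" "B \<subseteq> L" by auto
  interpret L: subfld L by (rule subfld.intro) (rule sep_tower_is_subfield[OF assms(1,2)])
  show ?thesis
    by (rule lspan_stable_algebraic[OF assms(2) B(1)]) (use B assms L.mult L.one in blast)+
qed

section \<open>The separable closure is a field\<close>

text \<open>In characteristic 0 the derivative of the minimal polynomial has the degree as its
  leading coefficient. It is thus nonzero of smaller degree and cannot vanish at
  \<open>a\<close>.\<close>

lemma algebraic_char_0_simple_root:
  fixes a :: "'a::field"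
  assumes E: "is_subfield E" and c: "CHAR('a) = 0" and a: "algebraic_over E a"
  shows "simple_root_over E a"
proof -
  interpret E: subfld E by (rule subfld.intro) fact
  obtain m where m: "is_min_poly E a m" using E.min_poly_exists[OF a] .
  note m' = E.min_polyD[OF m]
  obtain k where k: "degree m = Suc k" using E.min_poly_degree_pos[OF m] gr0_implies_Suc by blast
  have "of_nat (Suc k) \<noteq> (0 :: 'a)"
    using c CHAR_eq0_iff[where 'a='a] by blast
  then have "coeff (pderiv m) k \<noteq> 0"
    using k m'(2) by (simp add: coeff_pderiv)
  then have "pderiv m \<noteq> 0" by auto
  then have "poly (pderiv m) a \<noteq> 0"
    using E.min_poly_unique_degree[OF m E.polys_pderiv[OF m'(1)]] k degree_pderiv_le[of m] by auto
  with m' show ?thesis by (auto simp: simple_root_over_def)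
qed

text \<open>In characteristic p the base is enlarged to E(d^p). There \<open>d\<close> still lies in
  a separable tower while its p-th power is in the base, so \<open>d\<close> itself belongs to
  E(d^p), which is the criterion for separability over \<open>E\<close>.\<close>

lemma sep_tower_simple_root:
  fixes E :: "'a::alg_closed_field set"
  assumes "sep_tower E L" "is_subfield E" "d \<in> L"
  shows "simple_root_over E d"
proof (cases "CHAR('a) = 0")
  case True
  show ?thesis
    by (rule algebraic_char_0_simple_root[OF assms(2) True sep_tower_algebraic[OF assms]])
next
  case False
  then have p: "prime CHAR('a)" by (intro prime_CHAR_semidom) simp
  let ?F = "fext E (d ^ CHAR('a))"
  obtain L' where L': "sep_tower ?F L'" "L \<subseteq> L'"
    using sep_tower_base_change[OF assms(1) fext_base] by blast
  have "d \<in> ?F"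
    by (rule sep_tower_p_th_power[OF L'(1) _ p]) (use assms(3) L'(2) in auto)
  then show ?thesis by (rule simple_root_over_p_th_power[OF assms(2) p])
qed

lemma finite_subset_sep_tower:
  assumes "finite C" "\<And>c. c \<in> C \<Longrightarrow> simple_root_over E c"
  shows "\<exists>L. sep_tower E L \<and> C \<subseteq> L"
  using assms
proof (induction C rule: finite_induct)
  case (insert c C)
  then obtain L where L: "sep_tower E L" "C \<subseteq> L" by auto
  have "sep_tower E (fext L c)"
    by (rule sep_tower.step[OF L(1)], rule simple_root_over_mono[OF sep_tower_base[OF L(1)]])
      (use insert in auto)
  with L(2) fext_base[of L c] show ?case by (intro exI[of _ "fext L c"]) auto
qed (auto intro: sep_tower.base)

lemma sep_closure_eq: "is_subfield E \<Longrightarrow> sep_closure E = {a. simple_root_over E a}"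
  by (simp add: sep_closure_def separable_over_iff)

lemma sep_closure_base: "is_subfield E \<Longrightarrow> E \<subseteq> sep_closure E"
  by (auto simp: sep_closure_eq simple_root_over_self)

lemma sep_closure_mono: "is_subfield E \<Longrightarrow> is_subfield F \<Longrightarrow> E \<subseteq> F \<Longrightarrow> sep_closure E \<subseteq> sep_closure F"
  by (auto simp: sep_closure_eq intro: simple_root_over_mono)

lemma sep_closure_is_subfield:
  assumes E: "is_subfield (E :: 'a::alg_closed_field set)"
  shows "is_subfield (sep_closure E)"
proof -
  have pair: "\<exists>L. is_subfield L \<and> a \<in> L \<and> b \<in> L \<and> L \<subseteq> sep_closure E"
    if ab: "a \<in> sep_closure E" "b \<in> sep_closure E" for a b
  proof -
    have "\<And>c. c \<in> {a, b} \<Longrightarrow> simple_root_over E c" using ab by (auto simp: sep_closure_eq[OF E])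
    then obtain L where L: "sep_tower E L" "{a, b} \<subseteq> L"
      using finite_subset_sep_tower[of "{a, b}" E] by blast
    have "L \<subseteq> sep_closure E"
      using sep_tower_simple_root[OF L(1) E] by (auto simp: sep_closure_eq[OF E])
    then show ?thesis using L sep_tower_is_subfield[OF L(1) E] by (intro exI[of _ L]) simp
  qed
  have one: "1 \<in> sep_closure E"
    using sep_closure_base[OF E] E by (auto simp: is_subfield_iff)
  show ?thesis
    unfolding is_subfield_iff
  proof (intro conjI ballI)
    fix x y assume "x \<in> sep_closure E" "y \<in> sep_closure E"
    then obtain L where L: "is_subfield L" "x \<in> L" "y \<in> L" "L \<subseteq> sep_closure E" using pair by blast
    interpret L: subfld L by (rule subfld.intro) fact
    have "- x \<in> L" "inverse x \<in> L" "x + y \<in> L" "x * y \<in> L" using L by auto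
    with L(4) show "- x \<in> sep_closure E" "inverse x \<in> sep_closure E"
      "x + y \<in> sep_closure E" "x * y \<in> sep_closure E" by blast+
  qed (fact one)
qed

text \<open>The finitely many coefficients of a witness lie in one tower over \<open>E\<close>, and
  adjoining \<open>a\<close> adds one more separable step to it.\<close>

lemma simple_root_over_trans:
  assumes E: "is_subfield (E :: 'a::alg_closed_field set)"
    and F: "F \<subseteq> sep_closure E" and a: "simple_root_over F a"
  shows "simple_root_over E a"
proof -
  obtain p where p: "p \<in> polys_over F" "poly p a = 0" "poly (pderiv p) a \<noteq> 0"
    using a unfolding simple_root_over_def by blast
  have sr: "simple_root_over E c" if "c \<in> coeff p ` {..degree p}" for c
  proof -
    have "c \<in> F" using that polys_overD[OF p(1)] by auto
    with F have "c \<in> sep_closure E" ..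
    then show ?thesis by (simp add: sep_closure_eq[OF E])
  qed
  have "\<exists>L. sep_tower E L \<and> coeff p ` {..degree p} \<subseteq> L"
    by (rule finite_subset_sep_tower[OF _ sr]) simp_all
  then obtain L where L: "sep_tower E L" "coeff p ` {..degree p} \<subseteq> L" by (elim exE conjE)
  interpret L: subfld L by (rule subfld.intro) (rule sep_tower_is_subfield[OF L(1) E])
  have "coeff p i \<in> L" for i
  proof (cases "i \<le> degree p")
    case True
    with L(2) show ?thesis by blast
  next
    case False
    then show ?thesis by (simp add: coeff_eq_0)
  qed
  then have "p \<in> polys_over L" by (simp add: polys_over_def)
  with p have "simple_root_over L a" unfolding simple_root_over_def by blast
  from sep_tower_simple_root[OF sep_tower.step[OF L(1) this] E fext_gen]
  show ?thesis .
qed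

lemma sep_closure_trans:
  assumes "is_subfield (E :: 'a::alg_closed_field set)" "is_subfield F" "E \<subseteq> F" "F \<subseteq> sep_closure E"
  shows "sep_closure F = sep_closure E"
  using simple_root_over_trans[OF assms(1,4)] simple_root_over_mono[OF assms(3)]
  unfolding sep_closure_eq[OF assms(1)] sep_closure_eq[OF assms(2)] by blast

section \<open>Multivariate polynomials\<close>

abbreviation "lookup \<equiv> Poly_Mapping.lookup"
abbreviation "keys \<equiv> Poly_Mapping.keys"
abbreviation "single \<equiv> Poly_Mapping.single"

definition mpvar :: "nat \<Rightarrow> 'a::zero_neq_one mpol"
  where "mpvar i = single (single i 1) 1"

definition mpconst :: "'a::zero \<Rightarrow> 'a mpol"
  where "mpconst c = single 0 c"

definition mon :: "(nat \<Rightarrow> 'b::comm_ring_1) \<Rightarrow> (nat \<Rightarrow>\<^sub>0 nat) \<Rightarrow> 'b"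
  where "mon x m = (\<Prod>i\<in>keys m. x i ^ lookup m i)"

lemma mpoly_sum_single:
  "(p :: 'k \<Rightarrow>\<^sub>0 'a::comm_monoid_add) = (\<Sum>m\<in>keys p. single m (lookup p m))"
proof (rule poly_mapping_eqI)
  fix k
  have "lookup (\<Sum>m\<in>keys p. single m (lookup p m)) k
      = (\<Sum>m\<in>keys p. if m = k then lookup p m else 0)"
    by (simp add: lookup_sum lookup_single when_def)
  also have "\<dots> = lookup p k" by (simp add: not_in_keys_iff_lookup_eq_zero)
  finally show "lookup p k = lookup (\<Sum>m\<in>keys p. single m (lookup p m)) k" ..
qed

lemma mon_superset:
  assumes "keys m \<subseteq> A" "finite A"
  shows "mon x m = (\<Prod>i\<in>A. x i ^ lookup m i)"
  unfolding mon_def using assms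
  by (intro prod.mono_neutral_left) (auto simp: not_in_keys_iff_lookup_eq_zero)

lemma mon_add: "mon x (m + m') = mon x m * mon x m'"
proof -
  let ?A = "keys m \<union> keys m'"
  have "mon x (m + m') = (\<Prod>i\<in>?A. x i ^ lookup (m + m') i)"
    by (rule mon_superset) (use Poly_Mapping.keys_add[of m m'] in auto)
  also have "\<dots> = (\<Prod>i\<in>?A. x i ^ lookup m i) * (\<Prod>i\<in>?A. x i ^ lookup m' i)"
    by (simp add: lookup_add power_add prod.distrib)
  also have "\<dots> = mon x m * mon x m'"
    by (simp add: mon_superset[of m ?A] mon_superset[of m' ?A])
  finally show ?thesis .
qed

lemma mon_zero [simp]: "mon x 0 = 1"
  by (simp add: mon_def)

lemma mon_single [simp]: "mon x (single i k) = x i ^ k"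
  by (cases "k = 0") (auto simp: mon_def)

section \<open>Evaluation of multivariate polynomials as a ring homomorphism\<close>

context comm_ring_hom
begin

lemma eval_superset:
  assumes "keys p \<subseteq> A" "finite A"
  shows "eval_mpoly hom x p = (\<Sum>m\<in>A. hom (lookup p m) * mon x m)"
  unfolding eval_mpoly_def mon_def [symmetric] using assms
  by (intro sum.mono_neutral_left) (auto simp: not_in_keys_iff_lookup_eq_zero)

lemma eval_zero [simp]: "eval_mpoly hom x 0 = 0"
  by (simp add: eval_mpoly_def)

lemma eval_single [simp]: "eval_mpoly hom x (single m c) = hom c * mon x m"
  using eval_superset[of "single m c" "{m}"] by (simp split: if_splits)

lemma eval_add [simp]: "eval_mpoly hom x (p + q) = eval_mpoly hom x p + eval_mpoly hom x q"
proof -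
  let ?A = "keys p \<union> keys q"
  have "eval_mpoly hom x (p + q) = (\<Sum>m\<in>?A. hom (lookup (p + q) m) * mon x m)"
    by (rule eval_superset) (use Poly_Mapping.keys_add[of p q] in auto)
  also have "\<dots> = (\<Sum>m\<in>?A. hom (lookup p m) * mon x m) + (\<Sum>m\<in>?A. hom (lookup q m) * mon x m)"
    by (simp add: lookup_add hom_add distrib_right sum.distrib)
  also have "\<dots> = eval_mpoly hom x p + eval_mpoly hom x q"
    by (simp add: eval_superset[of p ?A] eval_superset[of q ?A])
  finally show ?thesis .
qed

lemma eval_sum: "eval_mpoly hom x (sum f I) = (\<Sum>i\<in>I. eval_mpoly hom x (f i))"
  by (induction I rule: infinite_finite_induct) auto

lemma eval_mult [simp]: "eval_mpoly hom x (p * q) = eval_mpoly hom x p * eval_mpoly hom x q"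
proof -
  have "p * q = (\<Sum>m\<in>keys p. \<Sum>m'\<in>keys q.
      single (m + m') (lookup p m * lookup q m'))"
    by (subst (1) mpoly_sum_single[of p], subst (1) mpoly_sum_single[of q])
      (simp add: sum_product mult_single)
  then have "eval_mpoly hom x (p * q) = (\<Sum>m\<in>keys p. \<Sum>m'\<in>keys q.
      hom (lookup p m * lookup q m') * mon x (m + m'))"
    by (simp only: eval_sum eval_single)
  also have "\<dots> = (\<Sum>m\<in>keys p. hom (lookup p m) * mon x m) *
      (\<Sum>m\<in>keys q. hom (lookup q m) * mon x m)"
    by (simp add: sum_product hom_mult mon_add mult.assoc mult.left_commute)
  also have "\<dots> = eval_mpoly hom x p * eval_mpoly hom x q"
    by (simp add: eval_mpoly_def mon_def)
  finally show ?thesis .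
qed

lemma eval_one [simp]: "eval_mpoly hom x 1 = 1"
  using eval_single[of x 0 1] by (simp del: eval_single)

lemma eval_comm_ring_hom: "comm_ring_hom (eval_mpoly hom x)"
  by unfold_locales auto

lemma eval_mpconst [simp]: "eval_mpoly hom x (mpconst c) = hom c"
  by (simp add: mpconst_def)

lemma eval_mpvar [simp]: "eval_mpoly hom x (mpvar i) = x i"
  by (simp add: mpvar_def)

lemma eval_uminus [simp]: "eval_mpoly hom x (- p) = - eval_mpoly hom x p"
  using eval_add[of x p "- p"] by (simp del: eval_add add: eq_neg_iff_add_eq_0 add.commute)

lemma eval_diff [simp]: "eval_mpoly hom x (p - q) = eval_mpoly hom x p - eval_mpoly hom x q"
  using eval_add[of x p "- q"] by (simp del: eval_add)

lemma eval_power [simp]: "eval_mpoly hom x (p ^ k) = eval_mpoly hom x p ^ k"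
  by (induction k) auto

lemma eval_prod: "eval_mpoly hom x (prod f I) = (\<Prod>i\<in>I. eval_mpoly hom x (f i))"
  by (induction I rule: infinite_finite_induct) auto

lemma eval_cong:
  assumes "p \<in> mpolys n F" "\<And>i. i < n \<Longrightarrow> x i = y i"
  shows "eval_mpoly hom x p = eval_mpoly hom y p"
  unfolding eval_mpoly_def
proof (intro sum.cong refl arg_cong2[where f = "(*)"] prod.cong)
  fix m i assume "m \<in> keys p" "i \<in> keys m"
  then have "i < n" using assms(1) by (auto simp: mpolys_def)
  then show "x i ^ lookup m i = y i ^ lookup m i"
    using assms(2) by simp
qed

end

interpretation id_hom: comm_ring_hom "id :: 'a::comm_ring_1 \<Rightarrow> 'a"
  by unfold_locales auto

section \<open>Multivariate polynomials over a subfield\<close>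

lemma mpolys_mono: "n \<le> n' \<Longrightarrow> E \<subseteq> F \<Longrightarrow> mpolys n E \<subseteq> mpolys n' F"
  by (fastforce simp: mpolys_def)

context subfld
begin

lemma mpolys_zero [simp, intro]: "0 \<in> mpolys n E"
  by (simp add: mpolys_def)

lemma mpolys_single [intro]:
  "c \<in> E \<Longrightarrow> keys m \<subseteq> {..<n} \<Longrightarrow> single m c \<in> mpolys n E"
  by (auto simp: mpolys_def)

lemma mpolys_lookup: "p \<in> mpolys n E \<Longrightarrow> lookup p m \<in> E"
  by (cases "m \<in> keys p") (auto simp: mpolys_def not_in_keys_iff_lookup_eq_zero)

lemma mpolys_add [simp, intro]:
  assumes "p \<in> mpolys n E" "q \<in> mpolys n E"
  shows "p + q \<in> mpolys n E"
proof -
  have "lookup (p + q) m \<in> E" for m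
    using assms by (auto simp: lookup_add intro: mpolys_lookup)
  moreover have "keys m \<subseteq> {..<n}" if "m \<in> keys (p + q)" for m
    using that Poly_Mapping.keys_add[of p q] assms unfolding mpolys_def by blast
  ultimately show ?thesis by (simp add: mpolys_def)
qed

lemma mpolys_sum [intro]: "(\<And>i. i \<in> I \<Longrightarrow> f i \<in> mpolys n E) \<Longrightarrow> sum f I \<in> mpolys n E"
  by (induction I rule: infinite_finite_induct) auto

lemma mpolys_mult [simp, intro]:
  assumes "p \<in> mpolys n E" "q \<in> mpolys n E"
  shows "p * q \<in> mpolys n E"
proof -
  have "p * q = (\<Sum>m\<in>keys p. \<Sum>m'\<in>keys q.
      single (m + m') (lookup p m * lookup q m'))"
    by (subst (1) mpoly_sum_single[of p], subst (1) mpoly_sum_single[of q])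
      (simp add: sum_product mult_single)
  also have "\<dots> \<in> mpolys n E"
  proof (intro mpolys_sum mpolys_single mult mpolys_lookup[OF assms(1)] mpolys_lookup[OF assms(2)])
    fix m m' assume "m \<in> keys p" "m' \<in> keys q"
    then show "keys (m + m') \<subseteq> {..<n}"
      using Poly_Mapping.keys_add[of m m'] assms unfolding mpolys_def by blast
  qed
  finally show ?thesis .
qed

lemma mpolys_const [simp, intro]: "c \<in> E \<Longrightarrow> mpconst c \<in> mpolys n E"
  unfolding mpconst_def by auto

lemma mpolys_var [simp, intro]: "i < n \<Longrightarrow> mpvar i \<in> mpolys n E"
  unfolding mpvar_def by auto

lemma mpolys_one [simp, intro]: "1 \<in> mpolys n E"
  using mpolys_const[of 1 n] by (simp add: mpconst_def)

lemma mpolys_uminus [simp, intro]: "p \<in> mpolys n E \<Longrightarrow> - p \<in> mpolys n E"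
  using mpolys_mult[OF mpolys_const[of "- 1" n], of p] by (simp add: mpconst_def single_uminus)

lemma mpolys_diff [simp, intro]: "p \<in> mpolys n E \<Longrightarrow> q \<in> mpolys n E \<Longrightarrow> p - q \<in> mpolys n E"
  using mpolys_add[of p n "- q"] by simp

lemma mpolys_power [simp, intro]: "p \<in> mpolys n E \<Longrightarrow> p ^ k \<in> mpolys n E"
  by (induction k) auto

lemma mpolys_prod [intro]: "(\<And>i. i \<in> I \<Longrightarrow> f i \<in> mpolys n E) \<Longrightarrow> prod f I \<in> mpolys n E"
  by (induction I rule: infinite_finite_induct) auto

end

lemma mpconst_one [simp]: "mpconst 1 = 1"
  by (simp add: mpconst_def)

lemma single_conv_prod:
  "single m (c :: 'a::comm_ring_1) =
    mpconst c * (\<Prod>i\<in>keys m. mpvar i ^ lookup m i)"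
proof -
  have pw: "(mpvar i :: 'a mpol) ^ k = single (single i k) 1" for i k
    by (induction k) (auto simp: mpvar_def mult_single single_add [symmetric])
  have pr: "(\<Prod>i\<in>A. single (f i) (1::'a)) = single (sum f A) 1"
    if "finite A" for A and f :: "nat \<Rightarrow> nat \<Rightarrow>\<^sub>0 nat"
    using that by (induction A rule: finite_induct) (auto simp: mult_single)
  show ?thesis
    by (simp add: pw pr mpconst_def mult_single flip: mpoly_sum_single)
qed

lemma mpolys_induct [consumes 2, case_names const var add mult]:
  assumes "is_subfield E" "p \<in> mpolys n E"
    and c: "\<And>c. c \<in> E \<Longrightarrow> P (mpconst c)" and v: "\<And>i. i < n \<Longrightarrow> P (mpvar i)"
    and a: "\<And>p q. p \<in> mpolys n E \<Longrightarrow> q \<in> mpolys n E \<Longrightarrow> P p \<Longrightarrow> P q \<Longrightarrow> P (p + q)"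
    and m: "\<And>p q. p \<in> mpolys n E \<Longrightarrow> q \<in> mpolys n E \<Longrightarrow> P p \<Longrightarrow> P q \<Longrightarrow> P (p * q)"
  shows "P p"
proof -
  interpret E: subfld E by (rule subfld.intro) fact
  define Q where "Q = {q \<in> mpolys n E. P q}"
  have Q0: "0 \<in> Q" and Q1: "1 \<in> Q" using c[of 0] c[of 1] by (auto simp: Q_def mpconst_def)
  have S: "sum f I \<in> Q" if "\<And>i. i \<in> I \<Longrightarrow> f i \<in> Q" for f :: "_ \<Rightarrow> 'a mpol" and I :: "(nat \<Rightarrow>\<^sub>0 nat) set"
    using that Q0 by (induction I rule: infinite_finite_induct) (auto simp: Q_def intro: a)
  have W: "q ^ k \<in> Q" if "q \<in> Q" for q k
    using that Q1 by (induction k) (auto simp: Q_def intro: m)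
  have R: "prod f I \<in> Q" if "\<And>i. i \<in> I \<Longrightarrow> f i \<in> Q" for f :: "_ \<Rightarrow> 'a mpol" and I :: "nat set"
    using that Q1 by (induction I rule: infinite_finite_induct) (auto simp: Q_def intro: m)
  have M: "q * r \<in> Q" if "q \<in> Q" "r \<in> Q" for q r using that m by (auto simp: Q_def)
  have "(\<Sum>k\<in>keys p. single k (lookup p k)) \<in> Q"
    unfolding single_conv_prod
  proof (intro S M R W)
    show "mpconst (lookup p k) \<in> Q" for k
      using c E.mpolys_lookup[OF assms(2)] by (auto simp: Q_def)
    fix k i assume "k \<in> keys p" "i \<in> keys k"
    then have "i < n" using assms(2) by (auto simp: mpolys_def)
    then show "mpvar i \<in> Q" using v by (auto simp: Q_def)
  qed
  then show ?thesis by (simp add: Q_def flip: mpoly_sum_single)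
qed

lemma eval_mpoly_in_subfield:
  assumes "comm_ring_hom h" "is_subfield F" "p \<in> mpolys n E" "h ` E \<subseteq> F" "\<And>i. i < n \<Longrightarrow> x i \<in> F"
  shows "eval_mpoly h x p \<in> F"
proof -
  interpret F: subfld F by (rule subfld.intro) fact
  show ?thesis unfolding eval_mpoly_def
    by (intro F.sum F.mult F.prod F.power) (use assms(3-5) in \<open>auto simp: mpolys_def\<close>)
qed

text \<open>Uniqueness of base-\<open>N\<close> digits, which makes the Kronecker substitution below
  injective on the monomials of a given polynomial.\<close>

lemma radix_unique:
  fixes f g :: "nat \<Rightarrow> nat"
  assumes "\<forall>i<n. f i < N" "\<forall>i<n. g i < N" "(\<Sum>i<n. f i * N ^ i) = (\<Sum>i<n. g i * N ^ i)"
  shows "\<forall>i<n. f i = g i"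
  using assms
proof (induction n arbitrary: f g)
  case (Suc n)
  have sh: "(\<Sum>i<Suc n. h i * N ^ i) = h 0 + N * (\<Sum>i<n. h (Suc i) * N ^ i)" for h :: "nat \<Rightarrow> nat"
    by (subst sum.lessThan_Suc_shift) (simp add: sum_distrib_left algebra_simps)
  have eq: "f 0 + N * (\<Sum>i<n. f (Suc i) * N ^ i) = g 0 + N * (\<Sum>i<n. g (Suc i) * N ^ i)"
    using Suc.prems(3) unfolding sh .
  have lt: "f 0 < N" "g 0 < N" using Suc.prems by auto
  have z: "f 0 = g 0"
    using arg_cong[OF eq, of "\<lambda>k. k mod N"] lt by simp
  then have "(\<Sum>i<n. f (Suc i) * N ^ i) = (\<Sum>i<n. g (Suc i) * N ^ i)"
    using eq lt by simp
  then have "\<forall>i<n. f (Suc i) = g (Suc i)"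
    using Suc.prems by (intro Suc.IH[of "\<lambda>i. f (Suc i)" "\<lambda>i. g (Suc i)"]) auto
  with z show ?case using less_Suc_eq_0_disj by auto
qed simp

text \<open>Euclid's argument: over a finite field, 1 plus the product of all X - a has no
  root.\<close>

lemma infinite_alg_closed: "infinite (UNIV :: 'a::alg_closed_field set)"
proof
  assume fin: "finite (UNIV :: 'a set)"
  define p :: "'a poly" where "p = (\<Prod>a\<in>UNIV. [:- a, 1:])"
  have dp: "degree p > 0"
    unfolding p_def using fin by (subst degree_prod_sum_eq) (auto simp: card_gt_0_iff)
  have "degree (p + 1) > 0"
    using dp by (subst degree_add_eq_left) auto
  then obtain x where "poly (p + 1) x = 0" using alg_closed_imp_poly_has_root by blast
  moreover have "poly p x = 0" unfolding p_def poly_prod using fin by (intro prod_zero) auto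
  ultimately show False by simp
qed

text \<open>Kronecker substitution reduces the claim to one variable.\<close>

lemma mpoly_zeroI:
  fixes p :: "'a::alg_closed_field mpol"
  assumes p: "p \<in> mpolys n UNIV" and z: "\<And>b. b \<in> affine_space n \<Longrightarrow> eval_mpoly id b p = 0"
  shows "p = 0"
proof (rule ccontr)
  assume "p \<noteq> 0"
  have "keys p \<noteq> {}"
  proof
    assume "keys p = {}"
    then have "p = 0" by (subst mpoly_sum_single) simp
    with \<open>p \<noteq> 0\<close> show False ..
  qed
  then obtain m0 where m0: "m0 \<in> keys p" by blast
  \<comment> \<open>\<open>N\<close> exceeds every exponent that occurs, so exponent vectors can be
    read as base-\<open>N\<close> digits.\<close>
  define N where "N = Suc (\<Sum>m\<in>keys p. \<Sum>i<n. lookup m i)"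
  have N: "lookup m i < N" if "m \<in> keys p" "i < n" for m i
  proof -
    have "lookup m i \<le> (\<Sum>i<n. lookup m i)"
      using that by (intro member_le_sum) auto
    also have "\<dots> \<le> (\<Sum>m\<in>keys p. \<Sum>i<n. lookup m i)"
      using that by (intro member_le_sum) auto
    finally show ?thesis by (simp add: N_def)
  qed
  define w where "w = (\<lambda>m. \<Sum>i<n. lookup m i * N ^ i)"
  have inj: "m = m'" if mm: "m \<in> keys p" "m' \<in> keys p" "w m = w m'" for m m'
  proof (rule poly_mapping_eqI)
    fix i
    have "\<forall>i<n. lookup m i = lookup m' i"
      using radix_unique[of n "lookup m" N "lookup m'"] N mm by (auto simp: w_def)
    moreover have "lookup m i = 0 \<and> lookup m' i = 0" if "\<not> i < n"
      using that mm p unfolding mpolys_def by (auto simp: in_keys_iff subset_iff)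
    ultimately show "lookup m i = lookup m' i" by metis
  qed
  define P where "P = (\<Sum>m\<in>keys p. monom (lookup p m) (w m))"
  have "poly P t = 0" for t
  proof -
    have "poly P t = (\<Sum>m\<in>keys p. lookup p m * t ^ w m)"
      by (simp add: P_def poly_sum poly_monom)
    also have "\<dots> = eval_mpoly id (restrict (\<lambda>i. t ^ (N ^ i)) {..<n}) p"
      unfolding eval_mpoly_def mon_def [symmetric]
    proof (intro sum.cong refl)
      fix m assume "m \<in> keys p"
      then have "keys m \<subseteq> {..<n}" using p by (auto simp: mpolys_def)
      then have "mon (restrict (\<lambda>i. t ^ (N ^ i)) {..<n}) m = (\<Prod>i<n. (t ^ (N ^ i)) ^ lookup m i)"
        by (subst mon_superset[of _ "{..<n}"]) auto
      also have "\<dots> = t ^ w m"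
        by (simp add: w_def power_sum mult.commute flip: power_mult)
      finally show "lookup p m * t ^ w m =
          id (lookup p m) * mon (restrict (\<lambda>i. t ^ (N ^ i)) {..<n}) m" by simp
    qed
    also have "\<dots> = 0" by (rule z) (simp add: affine_space_def)
    finally show ?thesis .
  qed
  then have "P = 0"
    using poly_roots_finite[of P] infinite_alg_closed[where 'a='a] by auto
  then have "coeff P (w m0) = 0" by simp
  moreover have "coeff P (w m0) = (\<Sum>m\<in>keys p. if m = m0 then lookup p m else 0)"
    unfolding P_def coeff_sum by (intro sum.cong refl) (use inj m0 in auto)
  ultimately show False using m0 by (simp add: in_keys_iff)
qed

section \<open>Generic points and rational functions\<close>

lemma emb_hom: "comm_ring_hom (emb :: 'a::field \<Rightarrow> 'a universal_domain)"
proof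
  fix x y :: 'a
  show "emb (x + y) = emb x + emb y"
    by (simp add: emb_def single_add flip: to_ac_add)
  show "emb (x * y) = emb x * emb y"
    by (simp add: emb_def mult_single flip: to_ac_mult)
  show "emb (0::'a) = 0"
    by (simp add: emb_def Fraction_Field.Zero_fract_def [symmetric])
  show "emb (1::'a) = 1"
    by (simp add: emb_def Fraction_Field.One_fract_def [symmetric])
qed

interpretation emb: comm_ring_hom "emb :: 'a::field \<Rightarrow> 'a universal_domain"
  by (rule emb_hom)

lemma emb_eq_0_iff [simp]: "emb a = 0 \<longleftrightarrow> a = 0"
proof
  assume "emb a = 0"
  show "a = 0"
  proof (rule ccontr)
    assume "a \<noteq> 0"
    then have "emb a * emb (inverse a) = 1" by (simp flip: emb.hom_mult)
    with \<open>emb a = 0\<close> show False by simp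
  qed
qed simp

lemma adjoin_is_subfield [simp, intro]: "is_subfield (adjoin K n x)"
  by (simp add: adjoin_def)

lemma adjoin_emb: "a \<in> K \<Longrightarrow> emb a \<in> adjoin K n x"
  and adjoin_gen: "i < n \<Longrightarrow> x i \<in> adjoin K n x"
  unfolding adjoin_def by (auto intro: subsetD[OF genf_incl])

lemma adjoin_least:
  "is_subfield F \<Longrightarrow> emb ` K \<subseteq> F \<Longrightarrow> (\<And>i. i < n \<Longrightarrow> x i \<in> F) \<Longrightarrow> adjoin K n x \<subseteq> F"
  unfolding adjoin_def by (rule genf_least) auto

lemma adjoin_mono: "K \<subseteq> K' \<Longrightarrow> adjoin K n x \<subseteq> adjoin K' n x"
  unfolding adjoin_def by (rule genf_mono) auto

lemma adjoin_eval: "p \<in> mpolys n K \<Longrightarrow> eval_mpoly emb x p \<in> adjoin K n x"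
  by (rule eval_mpoly_in_subfield[OF emb_hom adjoin_is_subfield]) (auto intro: adjoin_emb adjoin_gen)

lemma adjoin_quotient:
  assumes K: "is_subfield K" and h: "h \<in> adjoin K n x"
  obtains f g where "f \<in> mpolys n K" "g \<in> mpolys n K" "eval_mpoly emb x g \<noteq> 0"
    "h = eval_mpoly emb x f / eval_mpoly emb x g"
proof -
  interpret K: subfld K by (rule subfld.intro) fact
  let ?e = "eval_mpoly emb x"
  define Q where "Q = {?e f / ?e g |f g. f \<in> mpolys n K \<and> g \<in> mpolys n K \<and> ?e g \<noteq> 0}"
  have QI: "?e f / ?e g \<in> Q" if "f \<in> mpolys n K" "g \<in> mpolys n K" "?e g \<noteq> 0" for f g
    using that by (auto simp: Q_def)
  have Q1: "1 \<in> Q" using QI[of 1 1] by simp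
  have "is_subfield Q"
    unfolding is_subfield_iff
  proof (intro conjI ballI)
    fix y z assume "y \<in> Q" "z \<in> Q"
    then obtain r s u v where y: "y = ?e r / ?e s" and z: "z = ?e u / ?e v"
      and P: "r \<in> mpolys n K" "s \<in> mpolys n K" "u \<in> mpolys n K" "v \<in> mpolys n K"
      and nz: "?e s \<noteq> 0" "?e v \<noteq> 0" by (auto simp: Q_def)
    show "- y \<in> Q" using QI[of "- r" s] P nz by (simp add: y)
    show "inverse y \<in> Q"
      using QI[of s r] QI[of 0 1] P nz by (cases "?e r = 0") (auto simp: y)
    show "y + z \<in> Q"
      using QI[of "r * v + u * s" "s * v"] P nz by (simp add: y z add_frac_eq)
    show "y * z \<in> Q"
      using QI[of "r * u" "s * v"] P nz by (simp add: y z)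
  qed (fact Q1)
  moreover have "emb ` K \<subseteq> Q"
  proof
    fix e assume "e \<in> emb ` K"
    then obtain k where "k \<in> K" "e = emb k" by auto
    then show "e \<in> Q" using QI[of "mpconst k" 1] by simp
  qed
  moreover have "x i \<in> Q" if "i < n" for i using QI[of "mpvar i" 1] that by simp
  ultimately have "adjoin K n x \<subseteq> Q" by (rule adjoin_least)
  with h that show ?thesis by (auto simp: Q_def)
qed

lemma vanishing_ideal_iff: "p \<in> mpolys n UNIV \<Longrightarrow> p \<in> vanishing_ideal n V \<longleftrightarrow> (\<forall>b\<in>V. eval_mpoly id b p = 0)"
  by (simp add: vanishing_ideal_def)

lemma generic_pointD:
  assumes "generic_point n V x" "p \<in> mpolys n UNIV"
  shows "eval_mpoly emb x p = 0 \<longleftrightarrow> (\<forall>b\<in>V. eval_mpoly id b p = 0)"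
  using assms by (auto simp: generic_point_def vanishing_ideal_iff)

lemma mpolys_UNIV: "p \<in> mpolys n K \<Longrightarrow> p \<in> mpolys n UNIV"
  using mpolys_mono[of n n K UNIV] by auto

lemma UNIV_is_subfield [simp, intro]: "is_subfield (UNIV :: 'a::field set)"
  by (simp add: is_subfield_iff)

locale subfld_ac = subfld E for E :: "'a::alg_closed_field set"

lemma subfld_acI: "is_subfield E \<Longrightarrow> subfld_ac E"
  by (intro subfld_ac.intro subfld.intro)

interpretation UN: subfld_ac "UNIV :: 'a::alg_closed_field set"
  by (rule subfld_acI) simp

section \<open>Values of rational functions\<close>

lemma rat_fun_value_mono:
  assumes "rat_fun_value K n x h b c" "K \<subseteq> K'"
  shows "rat_fun_value K' n x h b c"
  using assms mpolys_mono[OF order_refl assms(2), of n] unfolding rat_fun_value_def by blast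

lemma rat_fun_valueI:
  assumes "f \<in> mpolys n K" "g \<in> mpolys n K" "eval_mpoly emb x g \<noteq> 0" "eval_mpoly id b g \<noteq> 0"
  shows "rat_fun_value K n x (eval_mpoly emb x f / eval_mpoly emb x g) b (eval_mpoly id b f / eval_mpoly id b g)"
  using assms unfolding rat_fun_value_def by blast

text \<open>The cross difference f g' - f' g vanishes at the generic point, hence on all of
  \<open>V\<close>. The two coefficient sets may differ, which later identifies values computed over
  \<open>K\<close> with values computed over \<open>M\<close>.\<close>

lemma rat_fun_value_unique:
  assumes x: "generic_point n V x" and b: "b \<in> V"
    and "rat_fun_value K n x h b c" "rat_fun_value K' n x h b c'"
  shows "c = c'"
proof -
  obtain f g where fg: "f \<in> mpolys n UNIV" "g \<in> mpolys n UNIV" "eval_mpoly emb x g \<noteq> 0"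
     "h = eval_mpoly emb x f / eval_mpoly emb x g" "eval_mpoly id b g \<noteq> 0" "c = eval_mpoly id b f / eval_mpoly id b g"
    using assms(3) mpolys_UNIV unfolding rat_fun_value_def by blast
  obtain f' g' where fg': "f' \<in> mpolys n UNIV" "g' \<in> mpolys n UNIV" "eval_mpoly emb x g' \<noteq> 0"
     "h = eval_mpoly emb x f' / eval_mpoly emb x g'" "eval_mpoly id b g' \<noteq> 0" "c' = eval_mpoly id b f' / eval_mpoly id b g'"
    using assms(4) mpolys_UNIV unfolding rat_fun_value_def by blast
  have "eval_mpoly emb x (f * g' - f' * g) = 0"
    using fg(3,4) fg'(3,4) by (simp add: frac_eq_eq)
  then have "eval_mpoly id b (f * g' - f' * g) = 0"
    using generic_pointD[OF x, of "f * g' - f' * g"] fg fg' b by auto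
  then show ?thesis using fg(5,6) fg'(5,6) by (simp add: frac_eq_eq)
qed

context subfld_ac
begin

lemma rat_fun_value_eval:
  assumes "f \<in> mpolys n E"
  shows "rat_fun_value E n x (eval_mpoly emb x f) b (eval_mpoly id b f)"
  using rat_fun_valueI[of f n E 1 x b] assms by simp

lemma rat_fun_value_const: "a \<in> E \<Longrightarrow> rat_fun_value E n x (emb a) b a"
  using rat_fun_value_eval[of "mpconst a" n x b] by simp

lemma rat_fun_value_add:
  assumes "rat_fun_value E n x h b c" "rat_fun_value E n x h' b c'"
  shows "rat_fun_value E n x (h + h') b (c + c')"
proof -
  obtain f g where fg: "f \<in> mpolys n E" "g \<in> mpolys n E" "eval_mpoly emb x g \<noteq> 0"
     "h = eval_mpoly emb x f / eval_mpoly emb x g" "eval_mpoly id b g \<noteq> 0" "c = eval_mpoly id b f / eval_mpoly id b g"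
    using assms(1) unfolding rat_fun_value_def by blast
  obtain f' g' where fg': "f' \<in> mpolys n E" "g' \<in> mpolys n E" "eval_mpoly emb x g' \<noteq> 0"
     "h' = eval_mpoly emb x f' / eval_mpoly emb x g'" "eval_mpoly id b g' \<noteq> 0" "c' = eval_mpoly id b f' / eval_mpoly id b g'"
    using assms(2) unfolding rat_fun_value_def by blast
  have "h + h' = eval_mpoly emb x (f * g' + f' * g) / eval_mpoly emb x (g * g')"
    using fg fg' by (simp add: add_frac_eq)
  moreover have "c + c' = eval_mpoly id b (f * g' + f' * g) / eval_mpoly id b (g * g')"
    using fg fg' by (simp add: add_frac_eq)
  moreover have "rat_fun_value E n x (eval_mpoly emb x (f * g' + f' * g) / eval_mpoly emb x (g * g')) b
      (eval_mpoly id b (f * g' + f' * g) / eval_mpoly id b (g * g'))"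
    by (rule rat_fun_valueI) (use fg fg' in auto)
  ultimately show ?thesis by simp
qed

lemma rat_fun_value_mult:
  assumes "rat_fun_value E n x h b c" "rat_fun_value E n x h' b c'"
  shows "rat_fun_value E n x (h * h') b (c * c')"
proof -
  obtain f g where fg: "f \<in> mpolys n E" "g \<in> mpolys n E" "eval_mpoly emb x g \<noteq> 0"
     "h = eval_mpoly emb x f / eval_mpoly emb x g" "eval_mpoly id b g \<noteq> 0" "c = eval_mpoly id b f / eval_mpoly id b g"
    using assms(1) unfolding rat_fun_value_def by blast
  obtain f' g' where fg': "f' \<in> mpolys n E" "g' \<in> mpolys n E" "eval_mpoly emb x g' \<noteq> 0"
     "h' = eval_mpoly emb x f' / eval_mpoly emb x g'" "eval_mpoly id b g' \<noteq> 0" "c' = eval_mpoly id b f' / eval_mpoly id b g'"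
    using assms(2) unfolding rat_fun_value_def by blast
  have "rat_fun_value E n x (eval_mpoly emb x (f * f') / eval_mpoly emb x (g * g')) b
      (eval_mpoly id b (f * f') / eval_mpoly id b (g * g'))"
    by (rule rat_fun_valueI) (use fg fg' in auto)
  then show ?thesis using fg fg' by simp
qed

lemma rat_fun_value_sum:
  "(\<And>i. i \<in> I \<Longrightarrow> rat_fun_value E n x (h i) b (c i)) \<Longrightarrow> rat_fun_value E n x (sum h I) b (sum c I)"
proof (induction I rule: infinite_finite_induct)
  case (infinite I)
  then show ?case using rat_fun_value_const[of 0] by simp
next
  case empty
  then show ?case using rat_fun_value_const[of 0] by simp
qed (auto intro: rat_fun_value_add)

lemma rat_fun_value_power: "rat_fun_value E n x h b c \<Longrightarrow> rat_fun_value E n x (h ^ k) b (c ^ k)"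
proof (induction k)
  case 0
  then show ?case using rat_fun_value_const[of 1] by simp
qed (auto intro: rat_fun_value_mult)

lemma rat_fun_value_compose:
  assumes "p \<in> mpolys e E" "\<And>j. j < e \<Longrightarrow> rat_fun_value E n x (\<nu> j) b (c j)"
  shows "rat_fun_value E n x (eval_mpoly emb \<nu> p) b (eval_mpoly id c p)"
  using is_subfield assms(1)
proof (induction p rule: mpolys_induct)
  case (const a)
  have e: "eval_mpoly id c (mpconst a) = id a" by (rule id_hom.eval_mpconst)
  have "rat_fun_value E n x (emb a) b (id a)"
    using rat_fun_value_const[OF const] by simp
  then show ?case by (simp only: e emb.eval_mpconst)
next
  case (var i)
  then show ?case unfolding emb.eval_mpvar id_hom.eval_mpvar by (rule assms(2))
next
  case (add p q)
  then show ?case unfolding emb.eval_add id_hom.eval_add by (intro rat_fun_value_add)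
next
  case (mult p q)
  then show ?case unfolding emb.eval_mult id_hom.eval_mult by (intro rat_fun_value_mult)
qed

text \<open>\<open>D\<close> is the product of the denominators and of the nonzero numerators: off
  its zeros every function in \<open>H\<close> is defined and no nonzero one vanishes.\<close>

lemma common_denominator:
  assumes x: "generic_point n V x" and H: "finite H" "H \<subseteq> adjoin E n x"
  obtains D where "D \<in> mpolys n E" "eval_mpoly emb x D \<noteq> 0"
    "\<And>b h. b \<in> V \<Longrightarrow> eval_mpoly id b D \<noteq> 0 \<Longrightarrow> h \<in> H \<Longrightarrow>
       \<exists>c. rat_fun_value E n x h b c \<and> (h \<noteq> 0 \<longrightarrow> c \<noteq> 0)"
proof -
  have "\<exists>D\<in>mpolys n E. eval_mpoly emb x D \<noteq> 0 \<and> (\<forall>b\<in>V. eval_mpoly id b D \<noteq> 0 \<longrightarrow>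
      (\<forall>h\<in>H. \<exists>c. rat_fun_value E n x h b c \<and> (h \<noteq> 0 \<longrightarrow> c \<noteq> 0)))"
    using H
  proof (induction H rule: finite_induct)
    case empty
    show ?case by (rule bexI[of _ 1]) auto
  next
    case (insert h H)
    from insert.prems have "H \<subseteq> adjoin E n x" by blast
    from insert.IH[OF this] obtain D where D: "D \<in> mpolys n E" "eval_mpoly emb x D \<noteq> 0"
      "\<forall>b\<in>V. eval_mpoly id b D \<noteq> 0 \<longrightarrow> (\<forall>h\<in>H. \<exists>c. rat_fun_value E n x h b c \<and> (h \<noteq> 0 \<longrightarrow> c \<noteq> 0))"
      by (elim bexE conjE)
    obtain f g where fg: "f \<in> mpolys n E" "g \<in> mpolys n E" "eval_mpoly emb x g \<noteq> 0"
      "h = eval_mpoly emb x f / eval_mpoly emb x g"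
      using adjoin_quotient[OF is_subfield, of h n x] insert.prems by auto
    \<comment> \<open>The numerator of \<open>h = 0\<close> would make the product vanish at the
      generic point, so it is replaced by 1.\<close>
    define f' where "f' = (if h = 0 then 1 else f)"
    have f': "f' \<in> mpolys n E" "eval_mpoly emb x f' \<noteq> 0" using fg by (auto simp: f'_def)
    show ?case
    proof (intro bexI[of _ "D * g * f'"] conjI ballI impI)
      show "D * g * f' \<in> mpolys n E" using D fg f' by auto
      show "eval_mpoly emb x (D * g * f') \<noteq> 0" using D fg f' by auto
      fix b h1 assume b: "b \<in> V" "eval_mpoly id b (D * g * f') \<noteq> 0" and h1: "h1 \<in> insert h H"
      show "\<exists>c. rat_fun_value E n x h1 b c \<and> (h1 \<noteq> 0 \<longrightarrow> c \<noteq> 0)"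
      proof (cases "h1 = h")
        case True
        show ?thesis
          by (rule exI[of _ "eval_mpoly id b f / eval_mpoly id b g"])
            (use True fg b in \<open>auto simp: f'_def intro!: rat_fun_valueI\<close>)
      qed (use D(3) b h1 in auto)
    qed
  qed
  then show ?thesis using that by blast
qed

end

text \<open>A polynomial relation between the components of \<open>\<nu>\<close> is the same as a
  polynomial vanishing on the image. The criterion mentions neither \<open>K\<close> nor
  \<open>V\<close>, so dominance can be carried to other base fields and to open
  subvarieties.\<close>

lemma dominant_map_iff:
  fixes V :: "(nat \<Rightarrow> 'a::alg_closed_field) set"
  assumes K: "is_subfield K" and x: "generic_point n V x" and \<nu>: "rational_map K n x e \<nu>"
  shows "dominant_map K n V x e \<nu> \<longleftrightarrow> algebraically_independent e \<nu>"
proof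
  interpret K: subfld_ac K by (rule subfld_acI) fact
  let ?I = "{c. \<exists>b\<in>V. rat_map_value K n x e \<nu> b c}"
  assume dom: "dominant_map K n V x e \<nu>"
  show "algebraically_independent e \<nu>"
    unfolding algebraically_independent_def
  proof (intro ballI impI)
    fix p :: "'a mpol" assume p: "p \<in> mpolys e UNIV" "eval_mpoly emb \<nu> p = 0"
    have "eval_mpoly id c p = 0" if c: "c \<in> ?I" for c
    proof -
      obtain b where b: "b \<in> V" "\<And>j. j < e \<Longrightarrow> rat_fun_value K n x (\<nu> j) b (c j)"
        using c by (auto simp: rat_map_value_def)
      have "rat_fun_value UNIV n x (eval_mpoly emb \<nu> p) b (eval_mpoly id c p)"
        by (rule UN.rat_fun_value_compose[OF p(1)]) (rule rat_fun_value_mono[OF b(2)], auto)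
      moreover have "rat_fun_value UNIV n x (emb 0) b 0" by (rule UN.rat_fun_value_const) simp
      ultimately show ?thesis using rat_fun_value_unique[OF x b(1)] p(2) by auto
    qed
    then have "?I \<subseteq> zero_set e {p}" by (auto simp: zero_set_def rat_map_value_def)
    moreover have "zariski_closed e (zero_set e {p})" using p by (auto simp: zariski_closed_def)
    ultimately have "zariski_closure e ?I \<subseteq> zero_set e {p}" by (auto simp: zariski_closure_def)
    then have "affine_space e \<subseteq> zero_set e {p}" using dom by (simp add: dominant_map_def)
    then show "p = 0" by (intro mpoly_zeroI[OF p(1)]) (auto simp: zero_set_def)
  qed
next
  interpret K: subfld_ac K by (rule subfld_acI) fact
  let ?I = "{c. \<exists>b\<in>V. rat_map_value K n x e \<nu> b c}"
  assume ind: "algebraically_independent e \<nu>"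
  have "A = affine_space e" if A: "zariski_closed e A" "?I \<subseteq> A" for A
  proof -
    obtain S where S: "S \<subseteq> mpolys e UNIV" "A = zero_set e S" using A(1) by (auto simp: zariski_closed_def)
    have "p = 0" if "p \<in> S" for p
    proof -
      have p: "p \<in> mpolys e UNIV" using S that by auto
      let ?h = "eval_mpoly emb \<nu> p"
      have nuK: "\<nu> j \<in> adjoin K n x" if "j < e" for j
        using \<nu> that by (auto simp: rational_map_def)
      then have hU: "?h \<in> adjoin UNIV n x"
        using adjoin_mono[of K UNIV n x]
        by (intro eval_mpoly_in_subfield[OF emb_hom adjoin_is_subfield p]) (auto intro: adjoin_emb)
      obtain D where D: "D \<in> mpolys n K" "eval_mpoly emb x D \<noteq> 0"
        "\<And>b h. b \<in> V \<Longrightarrow> eval_mpoly id b D \<noteq> 0 \<Longrightarrow> h \<in> \<nu> ` {..<e} \<Longrightarrow>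
           \<exists>c. rat_fun_value K n x h b c \<and> (h \<noteq> 0 \<longrightarrow> c \<noteq> 0)"
        using K.common_denominator[OF x, of "\<nu> ` {..<e}"] nuK by auto
      \<comment> \<open>Off \<open>D'\<close> the function \<open>?h\<close> takes a nonzero value
        unless it is 0. But its value at \<open>b\<close> is \<open>p\<close> at an image point, and
        \<open>p\<close> vanishes there.\<close>
      obtain D' where D': "D' \<in> mpolys n UNIV" "eval_mpoly emb x D' \<noteq> 0"
        "\<And>b h. b \<in> V \<Longrightarrow> eval_mpoly id b D' \<noteq> 0 \<Longrightarrow> h \<in> {?h} \<Longrightarrow>
           \<exists>c. rat_fun_value UNIV n x h b c \<and> (h \<noteq> 0 \<longrightarrow> c \<noteq> 0)"
        using UN.common_denominator[OF x, of "{?h}"] hU by auto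
      have "eval_mpoly emb x (D * D') \<noteq> 0" using D D' by simp
      moreover have "D * D' \<in> mpolys n UNIV" using D D' mpolys_UNIV by blast
      ultimately obtain b where b: "b \<in> V" "eval_mpoly id b (D * D') \<noteq> 0"
        using generic_pointD[OF x] by blast
      have "\<forall>j. \<exists>c. j < e \<longrightarrow> rat_fun_value K n x (\<nu> j) b c"
        using D(3)[OF b(1)] b(2) by fastforce
      then obtain c0 where c0: "\<And>j. j < e \<Longrightarrow> rat_fun_value K n x (\<nu> j) b (c0 j)" by metis
      define c where "c = restrict c0 {..<e}"
      have c: "\<And>j. j < e \<Longrightarrow> rat_fun_value K n x (\<nu> j) b (c j)" "c \<in> affine_space e"
        using c0 by (auto simp: c_def affine_space_def)
      then have "c \<in> ?I" using b by (auto simp: rat_map_value_def)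
      then have "eval_mpoly id c p = 0" using A(2) S(2) that by (auto simp: zero_set_def)
      moreover have "rat_fun_value UNIV n x ?h b (eval_mpoly id c p)"
        by (rule UN.rat_fun_value_compose[OF p]) (rule rat_fun_value_mono[OF c(1)], auto)
      moreover obtain c' where "rat_fun_value UNIV n x ?h b c'" "?h \<noteq> 0 \<longrightarrow> c' \<noteq> 0"
        using D'(3)[OF b(1)] b(2) by auto
      ultimately have "?h = 0" using rat_fun_value_unique[OF x b(1)] by metis
      then show ?thesis using ind p by (auto simp: algebraically_independent_def)
    qed
    then have "eval_mpoly id c p = 0" if "p \<in> S" for c p
      using that id_hom.eval_zero by metis
    then show ?thesis unfolding S(2) zero_set_def by auto
  qed
  moreover have "zariski_closed e (affine_space e :: (nat \<Rightarrow> 'a) set)"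
    unfolding zariski_closed_def by (intro exI[of _ "{}"]) (auto simp: zero_set_def)
  moreover have "?I \<subseteq> affine_space e" by (auto simp: rat_map_value_def)
  ultimately show "dominant_map K n V x e \<nu>"
    unfolding dominant_map_def zariski_closure_def by blast
qed

text \<open>The vanishing ideal is the kernel of evaluation at \<open>x\<close> in a field, hence
  prime.\<close>

lemma generic_point_irreducible:
  assumes "generic_point n V x"
  shows "zariski_irreducible n V"
  unfolding zariski_irreducible_def
proof (intro conjI allI impI)
  show "V \<noteq> {}"
    using generic_pointD[OF assms, of 1] by auto
  fix A B assume AB: "zariski_closed n A \<and> zariski_closed n B \<and> V = A \<union> B"
  then obtain S T where S: "S \<subseteq> mpolys n UNIV" "A = zero_set n S" and T: "T \<subseteq> mpolys n UNIV" "B = zero_set n T"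
    by (auto simp: zariski_closed_def)
  show "V = A \<or> V = B"
  proof (rule ccontr)
    assume "\<not> (V = A \<or> V = B)"
    then obtain a b where ab: "a \<in> V" "a \<notin> A" "b \<in> V" "b \<notin> B" using AB by auto
    then have "a \<in> affine_space n" "b \<in> affine_space n" using AB S T by (auto simp: zero_set_def)
    then obtain p q where p: "p \<in> S" "eval_mpoly id a p \<noteq> 0" and q: "q \<in> T" "eval_mpoly id b q \<noteq> 0"
      using ab S T by (auto simp: zero_set_def)
    have "\<forall>c\<in>V. eval_mpoly id c (p * q) = 0"
      using AB p q S T by (auto simp: zero_set_def)
    moreover have "p \<in> mpolys n UNIV" "q \<in> mpolys n UNIV" using p q S T by auto
    ultimately have "eval_mpoly emb x p = 0 \<or> eval_mpoly emb x q = 0"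
      using generic_pointD[OF assms, of "p * q"] by auto
    then show False
      using generic_pointD[OF assms] p q ab \<open>p \<in> mpolys n UNIV\<close> \<open>q \<in> mpolys n UNIV\<close> by blast
  qed
qed

section \<open>Avoiding a hypersurface\<close>

context subfld
begin

text \<open>The Rabinowitsch trick: the last variable plays the role of \<open>1 / D\<close>.\<close>

lemma rabinowitsch_decomposition:
  assumes D: "D \<in> mpolys n E" and p: "p \<in> mpolys (Suc n) E"
  shows "\<exists>d. \<exists>q\<in>mpolys n E. \<exists>s\<in>mpolys (Suc n) E. p = (1 - mpvar n * D) * s + mpvar n ^ d * q"
  using is_subfield p
proof (induction p rule: mpolys_induct)
  case (const c)
  show ?case
    by (rule exI[of _ 0], rule bexI[of _ "mpconst c"], rule bexI[of _ 0]) (use const in auto)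
next
  case (var i)
  show ?case
  proof (cases "i = n")
    case True
    show ?thesis
      by (rule exI[of _ 1], rule bexI[of _ 1], rule bexI[of _ 0]) (use True in auto)
  next
    case False
    show ?thesis
      by (rule exI[of _ 0], rule bexI[of _ "mpvar i"], rule bexI[of _ 0]) (use var False in auto)
  qed
next
  case (add p1 p2)
  let ?z = "mpvar n :: 'a mpol" and ?u = "1 - mpvar n * D"
  have D': "D \<in> mpolys (Suc n) E" using D mpolys_mono[of n "Suc n" E E] by auto
  \<comment> \<open>Terms with different powers of \<open>?z\<close> must be brought to a common
    exponent before they can be added: modulo \<open>?u\<close> the product \<open>?z * D\<close> is
    1, so a factor \<open>?z ^ b * D ^ b\<close> may be inserted.\<close>
  have up: "\<exists>s\<in>mpolys (Suc n) E. ?z ^ a * r = ?u * s + ?z ^ (a + b) * (D ^ b * r)"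
    if r: "r \<in> mpolys n E" for a b r
  proof -
    have r': "r \<in> mpolys (Suc n) E" using r mpolys_mono[of n "Suc n" E E] by auto
    \<comment> \<open>The geometric sum exhibits \<open>1 - (?z * D) ^ b\<close> as a multiple of
      \<open>?u\<close>.\<close>
    define S where "S = (\<Sum>i<b. (?z * D) ^ i)"
    have *: "1 - (?z * D) ^ b = ?u * S" by (simp add: S_def one_diff_power_eq)
    have "?z ^ a * r = ?z ^ a * r * (1 - (?z * D) ^ b) + ?z ^ (a + b) * (D ^ b * r)"
      by (simp add: algebra_simps power_add power_mult_distrib)
    also have "\<dots> = ?u * (?z ^ a * r * S) + ?z ^ (a + b) * (D ^ b * r)"
      unfolding * by (simp add: algebra_simps)
    finally have eq: "?z ^ a * r = ?u * (?z ^ a * r * S) + ?z ^ (a + b) * (D ^ b * r)" .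
    have "S \<in> mpolys (Suc n) E"
      unfolding S_def by (intro mpolys_sum mpolys_power mpolys_mult D' mpolys_var) simp
    then have "?z ^ a * r * S \<in> mpolys (Suc n) E" using r' by auto
    with eq show ?thesis by blast
  qed
  from add obtain d1 q1 s1 where 1: "q1 \<in> mpolys n E" "s1 \<in> mpolys (Suc n) E"
    "p1 = ?u * s1 + ?z ^ d1 * q1" by blast
  from add obtain d2 q2 s2 where 2: "q2 \<in> mpolys n E" "s2 \<in> mpolys (Suc n) E"
    "p2 = ?u * s2 + ?z ^ d2 * q2" by blast
  obtain t1 where t1: "t1 \<in> mpolys (Suc n) E" "?z ^ d1 * q1 = ?u * t1 + ?z ^ (d1 + d2) * (D ^ d2 * q1)"
    using up[OF 1(1), of d1 d2] by blast
  obtain t2 where t2: "t2 \<in> mpolys (Suc n) E" "?z ^ d2 * q2 = ?u * t2 + ?z ^ (d1 + d2) * (D ^ d1 * q2)"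
    using up[OF 2(1), of d2 d1] by (auto simp: add.commute)
  show ?case
  proof (rule exI[of _ "d1 + d2"], rule bexI[of _ "D ^ d2 * q1 + D ^ d1 * q2"], rule bexI[of _ "s1 + s2 + t1 + t2"])
    show "p1 + p2 = ?u * (s1 + s2 + t1 + t2) + ?z ^ (d1 + d2) * (D ^ d2 * q1 + D ^ d1 * q2)"
      unfolding 1(3) 2(3) t1(2) t2(2) by (simp only: distrib_left add.assoc add.left_commute add.commute)
  qed (use D 1 2 t1 t2 in auto)
next
  case (mult p1 p2)
  let ?z = "mpvar n :: 'a mpol" and ?u = "1 - mpvar n * D"
  have m: "mpolys n E \<subseteq> mpolys (Suc n) E" by (rule mpolys_mono) auto
  from mult obtain d1 q1 s1 where 1: "q1 \<in> mpolys n E" "s1 \<in> mpolys (Suc n) E"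
    "p1 = ?u * s1 + ?z ^ d1 * q1" by blast
  from mult obtain d2 q2 s2 where 2: "q2 \<in> mpolys n E" "s2 \<in> mpolys (Suc n) E"
    "p2 = ?u * s2 + ?z ^ d2 * q2" by blast
  show ?case
  proof (rule exI[of _ "d1 + d2"], rule bexI[of _ "q1 * q2"], rule bexI[of _ "s1 * p2 + ?z ^ d1 * q1 * s2"])
    show "p1 * p2 = ?u * (s1 * p2 + ?z ^ d1 * q1 * s2) + ?z ^ (d1 + d2) * (q1 * q2)"
    proof -
      have "p1 * p2 = ?u * (s1 * p2) + ?z ^ d1 * q1 * p2"
        unfolding 1(3) by (simp add: algebra_simps)
      also have "?z ^ d1 * q1 * p2 = ?u * (?z ^ d1 * q1 * s2) + ?z ^ (d1 + d2) * (q1 * q2)"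
        unfolding 2(3) by (simp add: algebra_simps power_add)
      finally show ?thesis by (simp only: distrib_left add.assoc)
    qed
    show "s1 * p2 + ?z ^ d1 * q1 * s2 \<in> mpolys (Suc n) E"
      using mult(2) 1 2 m by (intro mpolys_add mpolys_mult mpolys_power mpolys_var) auto
  qed (use 1 2 in auto)
qed

end

lemma ideal_gen_subset_vanishing_ideal:
  assumes "S \<subseteq> vanishing_ideal n V"
  shows "ideal_gen n S \<subseteq> vanishing_ideal n (V :: (nat \<Rightarrow> 'a::alg_closed_field) set)"
proof
  fix p assume "p \<in> ideal_gen n S"
  then obtain T c where T: "T \<subseteq> S" "\<And>r. r \<in> T \<Longrightarrow> c r \<in> mpolys n UNIV" "p = (\<Sum>r\<in>T. c r * r)"
    unfolding ideal_gen_def by blast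
  have "p \<in> mpolys n UNIV" unfolding T(3) using T(1,2) assms
    by (intro UN.mpolys_sum UN.mpolys_mult) (auto simp: vanishing_ideal_def)
  moreover have "eval_mpoly id b p = 0" if "b \<in> V" for b
    unfolding T(3) id_hom.eval_sum using T(1) that assms
    by (intro sum.neutral) (auto simp: vanishing_ideal_def)
  ultimately show "p \<in> vanishing_ideal n V" by (simp add: vanishing_ideal_def)
qed

text \<open>The principal open subset of \<open>V\<close> where \<open>D\<close> is nonzero, made
  Zariski closed in a space of one dimension more as the graph of \<open>1 / D\<close>.\<close>

definition shrink :: "nat \<Rightarrow> (nat \<Rightarrow> 'a::field) set \<Rightarrow> 'a mpol \<Rightarrow> (nat \<Rightarrow> 'a) set"
  where "shrink n V D = (\<lambda>b. b(n := inverse (eval_mpoly id b D))) ` {b \<in> V. eval_mpoly id b D \<noteq> 0}"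

context comm_ring_hom
begin

lemma eval_upd: "p \<in> mpolys n F \<Longrightarrow> eval_mpoly hom (x(n := z)) p = eval_mpoly hom x p"
  by (rule eval_cong) auto

end

locale shrinking = subfld_ac K for K :: "'a::alg_closed_field set" +
  fixes n :: nat and V :: "(nat \<Rightarrow> 'a) set" and x :: "nat \<Rightarrow> 'a universal_domain" and D :: "'a mpol"
  assumes var: "abs_irred_variety K n V" and gen: "generic_point n V x"
    and D: "D \<in> mpolys n K" and Dx: "eval_mpoly emb x D \<noteq> 0"
begin

abbreviation "\<delta> \<equiv> eval_mpoly emb x D"
abbreviation "x' \<equiv> x(n := inverse \<delta>)"

lemma DU: "D \<in> mpolys n UNIV"
  using D by (rule mpolys_UNIV)

lemma V_affine: "b \<in> V \<Longrightarrow> b \<in> affine_space n"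
  using var by (auto simp: abs_irred_variety_def zariski_closed_def zero_set_def)

lemma shrinkE:
  assumes "b' \<in> shrink n V D"
  obtains b where "b \<in> V" "eval_mpoly id b D \<noteq> 0" "b' = b(n := inverse (eval_mpoly id b D))"
  using assms by (auto simp: shrink_def)

text \<open>The substitution of \<open>1 / D\<close> for the last variable kills the multiple of
  \<open>1 - mpvar n * D\<close>. Up to a power of \<open>D\<close>, only a polynomial in the old
  variables remains.\<close>

lemma eval_decomposed:
  assumes "q \<in> mpolys n F" "p = (1 - mpvar n * D) * s + mpvar n ^ d * q"
  shows "eval_mpoly emb x' p = inverse \<delta> ^ d * eval_mpoly emb x q"
    "eval_mpoly id b D \<noteq> 0 \<Longrightarrow>
      eval_mpoly id (b(n := inverse (eval_mpoly id b D))) p = inverse (eval_mpoly id b D) ^ d * eval_mpoly id b q"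
  using assms Dx
  by (simp_all add: emb.eval_upd[OF D] emb.eval_upd[OF assms(1)] id_hom.eval_upd[OF D] id_hom.eval_upd[OF assms(1)])

lemma generic_shrink: "generic_point (Suc n) (shrink n V D) x'"
  unfolding generic_point_def
proof (intro conjI ballI)
  show "x' \<in> affine_space (Suc n)"
    using gen by (auto simp: generic_point_def affine_space_def PiE_def extensional_def)
  fix p :: "'a mpol" assume p: "p \<in> mpolys (Suc n) UNIV"
  obtain d q s where q: "q \<in> mpolys n UNIV" "p = (1 - mpvar n * D) * s + mpvar n ^ d * q"
    using UN.rabinowitsch_decomposition[OF DU p] by blast
  \<comment> \<open>The factor \<open>D\<close> turns vanishing on the open subset into vanishing on
    all of \<open>V\<close>, where genericity of \<open>x\<close> applies.\<close>
  have "eval_mpoly emb x' p = 0 \<longleftrightarrow> eval_mpoly emb x (D * q) = 0"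
    using eval_decomposed(1)[OF q] Dx by simp
  also have "\<dots> \<longleftrightarrow> (\<forall>b\<in>V. eval_mpoly id b D = 0 \<or> eval_mpoly id b q = 0)"
    using generic_pointD[OF gen, of "D * q"] DU q by auto
  also have "\<dots> \<longleftrightarrow> (\<forall>b\<in>shrink n V D. eval_mpoly id b p = 0)"
    using eval_decomposed(2)[OF q] by (auto simp: shrink_def)
  finally show "eval_mpoly emb x' p = 0 \<longleftrightarrow> p \<in> vanishing_ideal (Suc n) (shrink n V D)"
    using p by (simp add: vanishing_ideal_iff)
qed

lemma closed_shrink: "zariski_closed (Suc n) (shrink n V D)"
proof -
  obtain S where S: "S \<subseteq> mpolys n UNIV" "V = zero_set n S"
    using var by (auto simp: abs_irred_variety_def zariski_closed_def)
  let ?T = "insert (1 - mpvar n * D) S"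
  have "shrink n V D = zero_set (Suc n) ?T"
  proof (intro equalityI subsetI)
    fix b' assume "b' \<in> shrink n V D"
    then obtain b where b: "b \<in> V" "eval_mpoly id b D \<noteq> 0" "b' = b(n := inverse (eval_mpoly id b D))"
      by (rule shrinkE)
    have "b' \<in> affine_space (Suc n)"
      using V_affine[OF b(1)] b(3) by (auto simp: affine_space_def PiE_def extensional_def)
    moreover have "eval_mpoly id b' p = 0" if "p \<in> S" for p
    proof -
      have "p \<in> mpolys n UNIV" using that S by auto
      then have "eval_mpoly id b' p = eval_mpoly id b p" unfolding b(3) by (rule id_hom.eval_upd)
      with b(1) S(2) that show ?thesis by (simp add: zero_set_def)
    qed
    moreover have "eval_mpoly id b' (1 - mpvar n * D) = 0"
      using b(2) by (simp add: b(3) id_hom.eval_upd[OF D])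
    ultimately show "b' \<in> zero_set (Suc n) ?T" by (simp add: zero_set_def)
  next
    fix b' assume b': "b' \<in> zero_set (Suc n) ?T"
    define b where "b = restrict b' {..<n}"
    have eq: "eval_mpoly id b p = eval_mpoly id b' p" if "p \<in> mpolys n F" for p F
      by (rule id_hom.eval_cong[OF that]) (simp add: b_def)
    have bV: "b \<in> V"
      unfolding S(2) zero_set_def
    proof (intro CollectI conjI ballI)
      show "b \<in> affine_space n" by (auto simp: b_def affine_space_def)
      fix p assume "p \<in> S"
      with S(1) have "p \<in> mpolys n UNIV" by auto
      from eq[OF this] b' \<open>p \<in> S\<close> show "eval_mpoly id b p = 0" by (simp add: zero_set_def)
    qed
    have "eval_mpoly id b' (1 - mpvar n * D) = 0" using b' by (simp add: zero_set_def)
    then have one: "b' n * eval_mpoly id b D = 1" by (simp add: eq[OF D])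
    have "b' = b(n := inverse (eval_mpoly id b D))"
    proof
      fix i
      have "b' i = undefined" if "\<not> i < Suc n"
        using b' that by (auto simp: zero_set_def affine_space_def PiE_def extensional_def)
      moreover have "b' n = inverse (eval_mpoly id b D)"
        using one by (metis inverse_unique mult.commute)
      ultimately show "b' i = (b(n := inverse (eval_mpoly id b D))) i"
        by (auto simp: b_def restrict_def less_Suc_eq)
    qed
    moreover have "eval_mpoly id b D \<noteq> 0" using one by auto
    ultimately show "b' \<in> shrink n V D" using bV unfolding shrink_def by blast
  qed
  moreover have "?T \<subseteq> mpolys (Suc n) UNIV"
    using S(1) DU mpolys_mono[of n "Suc n" UNIV UNIV] by auto
  ultimately show ?thesis unfolding zariski_closed_def by (intro exI[of _ ?T] conjI)
qed

lemma ideal_genI: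
  assumes "finite T" "T \<subseteq> S" "\<And>q. q \<in> T \<Longrightarrow> c q \<in> mpolys m UNIV"
  shows "(\<Sum>q\<in>T. c q * q) \<in> ideal_gen m S"
  using assms unfolding ideal_gen_def by blast

text \<open>The ideal of the graph is generated by the ideal of \<open>V\<close> together with
  \<open>1 - mpvar n * D\<close>, and both have generators over \<open>K\<close>.\<close>

lemma abs_irred_shrink: "abs_irred_variety K (Suc n) (shrink n V D)"
  unfolding abs_irred_variety_def
proof (intro conjI closed_shrink generic_point_irreducible[OF generic_shrink])
  let ?I = "vanishing_ideal (Suc n) (shrink n V D)" and ?u = "1 - mpvar n * D :: 'a mpol"
  let ?G = "?I \<inter> mpolys (Suc n) K"
  have sub: "mpolys n F \<subseteq> mpolys (Suc n) F" for F :: "'a set" by (rule mpolys_mono) auto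
  have in_G: "r \<in> ?G" if "r \<in> vanishing_ideal n V \<inter> mpolys n K" for r
  proof -
    have r: "r \<in> mpolys n UNIV" "\<And>b. b \<in> V \<Longrightarrow> eval_mpoly id b r = 0"
      using that by (auto simp: vanishing_ideal_def)
    have "eval_mpoly id b' r = 0" if "b' \<in> shrink n V D" for b'
      using that r(2) by (auto simp: shrink_def id_hom.eval_upd[OF r(1)])
    with r sub that show ?thesis by (auto simp: vanishing_ideal_def)
  qed
  have uG: "?u \<in> ?G"
  proof -
    have "eval_mpoly id b' ?u = 0" if "b' \<in> shrink n V D" for b'
      using that by (auto simp: shrink_def id_hom.eval_upd[OF D])
    moreover have "?u \<in> mpolys (Suc n) K" using D sub by (intro mpolys_diff mpolys_mult) auto
    ultimately show ?thesis using mpolys_UNIV by (auto simp: vanishing_ideal_def)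
  qed
  show "?I = ideal_gen (Suc n) ?G"
  proof (intro equalityI subsetI)
    fix p assume "p \<in> ?I"
    then have p: "p \<in> mpolys (Suc n) UNIV" "eval_mpoly emb x' p = 0"
      using generic_shrink by (auto simp: generic_point_def vanishing_ideal_def)
    obtain d q s where q: "q \<in> mpolys n UNIV" "p = ?u * s + mpvar n ^ d * q" "s \<in> mpolys (Suc n) UNIV"
      using UN.rabinowitsch_decomposition[OF DU p(1)] by blast
    have "eval_mpoly emb x q = 0" using eval_decomposed(1)[OF q(1,2)] p(2) Dx by simp
    then have "q \<in> vanishing_ideal n V" using gen q(1) by (simp add: generic_point_def)
    then have "q \<in> ideal_gen n (vanishing_ideal n V \<inter> mpolys n K)"
      using var by (simp add: abs_irred_variety_def)
    then obtain T c where T: "finite T" "T \<subseteq> vanishing_ideal n V \<inter> mpolys n K"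
      "\<And>r. r \<in> T \<Longrightarrow> c r \<in> mpolys n UNIV" "q = (\<Sum>r\<in>T. c r * r)"
      unfolding ideal_gen_def by blast
    \<comment> \<open>The polynomial \<open>?u\<close> may already occur in \<open>T\<close>; its
      two coefficients are then added.\<close>
    define c' where "c' = (\<lambda>r. (if r \<in> T then mpvar n ^ d * c r else 0) + (if r = ?u then s else 0))"
    have "(\<Sum>r\<in>insert ?u T. c' r * r) =
        (\<Sum>r\<in>insert ?u T. (if r \<in> T then mpvar n ^ d * c r * r else 0)) +
        (\<Sum>r\<in>insert ?u T. if r = ?u then s * r else 0)"
      unfolding sum.distrib [symmetric] by (intro sum.cong) (auto simp: c'_def distrib_right)
    also have "(\<Sum>r\<in>insert ?u T. (if r \<in> T then mpvar n ^ d * c r * r else 0)) = mpvar n ^ d * q"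
      unfolding T(4) sum_distrib_left using T(1)
      by (intro sum.mono_neutral_cong_right) (auto simp: mult.assoc)
    also have "(\<Sum>r\<in>insert ?u T. if r = ?u then s * r else 0) = ?u * s"
      using T(1) by (simp add: mult.commute)
    finally have "p = (\<Sum>r\<in>insert ?u T. c' r * r)" using q(2) by (simp add: add.commute)
    moreover have "(\<Sum>r\<in>insert ?u T. c' r * r) \<in> ideal_gen (Suc n) ?G"
    proof (rule ideal_genI)
      show "insert ?u T \<subseteq> ?G" using uG in_G T(2) by blast
      show "c' r \<in> mpolys (Suc n) UNIV" for r
        using T(3) q(3) sub[of UNIV] by (auto simp: c'_def)
    qed (use T(1) in simp)
    ultimately show "p \<in> ideal_gen (Suc n) ?G" by simp
  next
    fix p assume "p \<in> ideal_gen (Suc n) ?G"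
    then show "p \<in> ?I"
      using ideal_gen_subset_vanishing_ideal[of ?G "Suc n" "shrink n V D"] by blast
  qed
qed

text \<open>The new coordinate is the inverse of an element already in the function field.
  \<open>F\<close> ranges over fields above \<open>K\<close> because dimension is measured over the
  whole ambient field and separability over \<open>K\<close>.\<close>

lemma adjoin_shrink:
  assumes "is_subfield F" "K \<subseteq> F"
  shows "adjoin F (Suc n) x' = adjoin F n x"
proof (intro equalityI adjoin_least)
  interpret A: subfld "adjoin F n x" by (rule subfld.intro) simp
  have "\<delta> \<in> adjoin F n x" using adjoin_eval[of D n F x] D mpolys_mono[OF order_refl assms(2)] by blast
  then show "x' i \<in> adjoin F n x" if "i < Suc n" for i
    using that adjoin_gen[of i n x F] by (auto simp: less_Suc_eq)
  show "x i \<in> adjoin F (Suc n) x'" if "i < n" for i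
    using adjoin_gen[of i "Suc n" x' F] that by simp
qed (auto intro: adjoin_emb)

text \<open>Numerator and denominator are reduced to polynomials in the old variables times powers
  of \<open>1 / D\<close>; cross-multiplying these powers gives a quotient in the old
  variables.\<close>

lemma rat_fun_value_shrink:
  assumes v: "rat_fun_value K (Suc n) x' h (b(n := inverse (eval_mpoly id b D))) c"
    and b: "eval_mpoly id b D \<noteq> 0"
  shows "rat_fun_value K n x h b c"
proof -
  let ?\<beta> = "eval_mpoly id b D" and ?b = "b(n := inverse (eval_mpoly id b D))"
  obtain f g where fg: "f \<in> mpolys (Suc n) K" "g \<in> mpolys (Suc n) K" "eval_mpoly emb x' g \<noteq> 0"
     "h = eval_mpoly emb x' f / eval_mpoly emb x' g" "eval_mpoly id ?b g \<noteq> 0" "c = eval_mpoly id ?b f / eval_mpoly id ?b g"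
    using v unfolding rat_fun_value_def by blast
  obtain d q s where q: "q \<in> mpolys n K" "f = (1 - mpvar n * D) * s + mpvar n ^ d * q"
    using rabinowitsch_decomposition[OF D fg(1)] by blast
  obtain d' q' s' where q': "q' \<in> mpolys n K" "g = (1 - mpvar n * D) * s' + mpvar n ^ d' * q'"
    using rabinowitsch_decomposition[OF D fg(2)] by blast
  note ef = eval_decomposed(1)[OF q] eval_decomposed(2)[OF q b]
  note eg = eval_decomposed(1)[OF q'] eval_decomposed(2)[OF q' b]
  have "rat_fun_value K n x (eval_mpoly emb x (D ^ d' * q) / eval_mpoly emb x (D ^ d * q')) b
      (eval_mpoly id b (D ^ d' * q) / eval_mpoly id b (D ^ d * q'))"
    by (rule rat_fun_valueI) (use D q q' fg(3,5) eg Dx b in auto)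
  moreover have "h = eval_mpoly emb x (D ^ d' * q) / eval_mpoly emb x (D ^ d * q')"
    using fg(3,4) Dx unfolding ef eg by (simp add: field_simps)
  moreover have "c = eval_mpoly id b (D ^ d' * q) / eval_mpoly id b (D ^ d * q')"
    using fg(5,6) b unfolding ef eg by (simp add: field_simps)
  ultimately show ?thesis by simp
qed

end

text \<open>A rational point on the graph of \<open>1 / D\<close> over \<open>V\<close> projects to
  a rational point of \<open>V\<close> at which \<open>D\<close> is invertible.\<close>

lemma pac_avoid:
  assumes pac: "pac_extension K K0" and e: "1 \<le> e" and V: "abs_irred_variety K n V"
    and x: "generic_point n V x" and td: "has_trdeg n x e" and \<nu>: "rational_map K n x e \<nu>"
    and dom: "dominant_map K n V x e \<nu>" and sep: "separable_map K n x e \<nu>"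
    and D: "D \<in> mpolys n K" "eval_mpoly emb x D \<noteq> 0"
  shows "\<exists>b\<in>rational_points K n V. eval_mpoly id b D \<noteq> 0 \<and>
    (\<exists>c. rat_map_value K n x e \<nu> b c \<and> (\<forall>j<e. c j \<in> K0))"
proof -
  have K: "is_subfield K" using pac by (simp add: pac_extension_def)
  interpret shrinking K n V x D
    by (intro shrinking.intro subfld_acI shrinking_axioms.intro) fact+
  have "has_trdeg (Suc n) x' e"
    using td by (simp add: has_trdeg_def adjoin_shrink)
  moreover have r: "rational_map K (Suc n) x' e \<nu>"
    using \<nu> by (simp add: rational_map_def adjoin_shrink[OF K])
  moreover have "dominant_map K (Suc n) (shrink n V D) x' e \<nu>"
    using dom dominant_map_iff[OF K x \<nu>] dominant_map_iff[OF K generic_shrink r] by simp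
  moreover have "separable_map K (Suc n) x' e \<nu>"
    using sep by (simp add: separable_map_def adjoin_shrink[OF K])
  ultimately obtain b' c where b': "b' \<in> rational_points K (Suc n) (shrink n V D)"
    and c: "rat_map_value K (Suc n) x' e \<nu> b' c" "\<forall>j<e. c j \<in> K0"
    using pac e abs_irred_shrink generic_shrink unfolding pac_extension_def by blast
  obtain b where b: "b \<in> V" "eval_mpoly id b D \<noteq> 0" "b' = b(n := inverse (eval_mpoly id b D))"
    using b' by (auto simp: rational_points_def elim: shrinkE)
  have "b i \<in> K" if "i < n" for i
    using b' that b(3) by (auto simp: rational_points_def dest: spec[of _ i])
  then have "b \<in> rational_points K n V" using b(1) by (simp add: rational_points_def)
  moreover have "rat_map_value K n x e \<nu> b c"
    using c(1) rat_fun_value_shrink b(2,3) by (auto simp: rat_map_value_def)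
  ultimately show ?thesis using b(2) c(2) by blast
qed

section \<open>The PAC property of the relative separable closure\<close>

lemma ideal_gen_mono: "S \<subseteq> T \<Longrightarrow> ideal_gen n S \<subseteq> ideal_gen n T"
  unfolding ideal_gen_def by blast

lemma abs_irred_variety_mono:
  fixes V :: "(nat \<Rightarrow> 'a::alg_closed_field) set"
  assumes "abs_irred_variety M n V" "M \<subseteq> K"
  shows "abs_irred_variety K n V"
proof -
  let ?I = "vanishing_ideal n V"
  have "?I = ideal_gen n (?I \<inter> mpolys n M)" using assms by (simp add: abs_irred_variety_def)
  also have "\<dots> \<subseteq> ideal_gen n (?I \<inter> mpolys n K)"
    using mpolys_mono[OF order_refl assms(2), of n] by (intro ideal_gen_mono) blast
  finally have "?I \<subseteq> ideal_gen n (?I \<inter> mpolys n K)" .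
  moreover have "ideal_gen n (?I \<inter> mpolys n K) \<subseteq> ?I"
    by (rule ideal_gen_subset_vanishing_ideal) blast
  ultimately show ?thesis using assms by (auto simp: abs_irred_variety_def)
qed

lemma emb_of_nat [simp]: "emb (of_nat k) = of_nat k"
  by (induction k) (auto simp: emb.hom_add)

text \<open>After multiplication by a common denominator the coefficients are polynomials in
  \<open>\<nu>\<close>, so they have a value at every point where \<open>\<nu>\<close> has
  one.\<close>

lemma clear_denominators:
  assumes M: "is_subfield M" and p: "p \<in> polys_over (adjoin M e \<nu>)"
  obtains g q where "g \<in> mpolys e M" "eval_mpoly emb \<nu> g \<noteq> 0" "\<And>k. q k \<in> mpolys e M"
    "\<And>k. eval_mpoly emb \<nu> g * coeff p k = eval_mpoly emb \<nu> (q k)"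
proof -
  interpret M: subfld M by (rule subfld.intro) fact
  have ex: "\<exists>f g. f \<in> mpolys e M \<and> g \<in> mpolys e M \<and> eval_mpoly emb \<nu> g \<noteq> 0 \<and>
      coeff p k = eval_mpoly emb \<nu> f / eval_mpoly emb \<nu> g" for k
    using adjoin_quotient[OF M polys_overD[OF p, of k]] by metis
  then obtain f g where fg: "\<And>k. f k \<in> mpolys e M" "\<And>k. g k \<in> mpolys e M"
    "\<And>k. eval_mpoly emb \<nu> (g k) \<noteq> 0" "\<And>k. coeff p k = eval_mpoly emb \<nu> (f k) / eval_mpoly emb \<nu> (g k)"
    by metis
  define d where "d = degree p"
  define G where "G = (\<Prod>k\<le>d. g k)"
  define q where "q = (\<lambda>k. if k \<le> d then f k * (\<Prod>j\<in>{..d} - {k}. g j) else 0)"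
  show ?thesis
  proof (rule that[of G q])
    show "G \<in> mpolys e M" unfolding G_def using fg by auto
    show "eval_mpoly emb \<nu> G \<noteq> 0" unfolding G_def emb.eval_prod using fg(3) by simp
    show "q k \<in> mpolys e M" for k unfolding q_def using fg by auto
    show "eval_mpoly emb \<nu> G * coeff p k = eval_mpoly emb \<nu> (q k)" for k
    proof (cases "k \<le> d")
      case True
      then have "G = g k * (\<Prod>j\<in>{..d} - {k}. g j)" unfolding G_def by (intro prod.remove) auto
      then show ?thesis using True fg(3)[of k] fg(4)[of k] by (simp add: q_def)
    next
      case False
      then show ?thesis by (simp add: q_def d_def coeff_eq_0)
    qed
  qed
qed

lemma poly_pderiv_altdef: "poly (pderiv p) y = (\<Sum>k\<le>degree p. of_nat k * coeff p k * y ^ (k - 1))"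
proof -
  have "pderiv p = pderiv (\<Sum>k\<le>degree p. monom (coeff p k) k)"
    by (simp add: poly_as_sum_of_monoms)
  also have "\<dots> = (\<Sum>k\<le>degree p. monom (of_nat k * coeff p k) (k - 1))"
    using pderiv_sum[of "\<lambda>k. monom (coeff p k) k" "{..degree p}"] by (simp add: pderiv_monom)
  finally show ?thesis by (simp add: poly_sum poly_monom)
qed

text \<open>The larger function field is generated by constants and the coordinates of
  \<open>x\<close>, and the elements separable over the image field form a field.\<close>

lemma separable_map_mono:
  assumes M: "is_subfield M" and K: "is_subfield (K :: 'a::alg_closed_field set)" and MK: "M \<subseteq> K"
    and sep: "separable_map M n x e \<nu>"
  shows "separable_map K n x e \<nu>"
proof -
  let ?F = "adjoin K e \<nu>"
  have "adjoin K n x \<subseteq> sep_closure ?F"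
  proof (rule adjoin_least[OF sep_closure_is_subfield])
    show "emb ` K \<subseteq> sep_closure ?F"
      using sep_closure_base[of ?F] adjoin_emb[of _ K e \<nu>] by auto
    fix i assume "i < n"
    then have "separable_over (adjoin M e \<nu>) (x i)"
      using sep adjoin_gen[of i n x M] by (auto simp: separable_map_def)
    then have "simple_root_over (adjoin M e \<nu>) (x i)" by (simp add: separable_over_iff)
    then show "x i \<in> sep_closure ?F"
      using adjoin_mono[OF MK] by (auto simp: sep_closure_eq intro: simple_root_over_mono)
  qed simp
  then show ?thesis by (auto simp: separable_map_def sep_closure_def)
qed

lemma Int_is_subfield: "is_subfield E \<Longrightarrow> is_subfield F \<Longrightarrow> is_subfield (E \<inter> F)"
  by (simp add: is_subfield_iff)

text \<open>For each coordinate of the generic point we fix a polynomial over \<open>M(\<nu>)\<close> with that coordinate as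
  a simple root; a \<open>K\<close>-rational point at which all derivatives involved stay nonzero has coordinates
  separable over \<open>M\<close>.\<close>

theorem pac_extension_sep_closure:
  fixes K K0 :: "'a::alg_closed_field set"
  assumes pac: "pac_extension K K0"
  shows "pac_extension (K \<inter> sep_closure K0) K0"
proof -
  define M where "M = K \<inter> sep_closure K0"
  have K: "is_subfield K" and K0: "is_subfield K0" and K0K: "K0 \<subseteq> K"
    using pac by (auto simp: pac_extension_def)
  have M: "is_subfield M" unfolding M_def by (intro Int_is_subfield K sep_closure_is_subfield K0)
  have K0M: "K0 \<subseteq> M" using K0K sep_closure_base[OF K0] by (auto simp: M_def)
  have MK: "M \<subseteq> K" by (simp add: M_def)
  interpret M: subfld_ac M by (rule subfld_acI) fact
  have "\<exists>b\<in>rational_points M n V. \<exists>c. rat_map_value M n x e \<nu> b c \<and> (\<forall>j<e. c j \<in> K0)"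
    if e: "1 \<le> e" and V: "abs_irred_variety M n V" and x: "generic_point n V x"
      and td: "has_trdeg n x e" and \<nu>: "rational_map M n x e \<nu>"
      and dom: "dominant_map M n V x e \<nu>" and sep: "separable_map M n x e \<nu>"
    for n e V x \<nu>
  proof -
    have nuM: "\<nu> j \<in> adjoin M n x" if "j < e" for j
      using \<nu> that by (auto simp: rational_map_def)
    have \<nu>K: "rational_map K n x e \<nu>"
      using \<nu> adjoin_mono[OF MK, of n x] by (auto simp: rational_map_def)
    have domK: "dominant_map K n V x e \<nu>"
      using dom dominant_map_iff[OF M x \<nu>] dominant_map_iff[OF K x \<nu>K] by simp
    have "\<exists>P q. poly P (x i) = 0 \<and> poly (pderiv P) (x i) \<noteq> 0 \<and>
        (\<forall>k. q k \<in> mpolys e M \<and> coeff P k = eval_mpoly emb \<nu> (q k))" if "i < n" for i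
    proof -
      have "separable_over (adjoin M e \<nu>) (x i)"
        using sep adjoin_gen[OF that] by (auto simp: separable_map_def)
      then obtain p where p: "p \<in> polys_over (adjoin M e \<nu>)" "poly p (x i) = 0" "poly (pderiv p) (x i) \<noteq> 0"
        by (auto simp: separable_over_iff simple_root_over_def)
      obtain g q where gq: "g \<in> mpolys e M" "eval_mpoly emb \<nu> g \<noteq> 0" "\<And>k. q k \<in> mpolys e M"
        "\<And>k. eval_mpoly emb \<nu> g * coeff p k = eval_mpoly emb \<nu> (q k)"
        using clear_denominators[OF M p(1)] by metis
      show ?thesis
        by (rule exI[of _ "Polynomial.smult (eval_mpoly emb \<nu> g) p"], rule exI[of _ q])
          (use p gq in \<open>auto simp: pderiv_smult\<close>)
    qed
    then obtain P q where Pq: "\<And>i. i < n \<Longrightarrow> poly (P i) (x i) = 0"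
      "\<And>i. i < n \<Longrightarrow> poly (pderiv (P i)) (x i) \<noteq> 0" "\<And>i k. i < n \<Longrightarrow> q i k \<in> mpolys e M"
      "\<And>i k. i < n \<Longrightarrow> coeff (P i) k = eval_mpoly emb \<nu> (q i k)"
      by metis
    \<comment> \<open>These derivatives are nonzero functions; joining them to the components of
      \<open>\<nu>\<close> in the common denominator keeps their values nonzero at the point found
      later.\<close>
    define s where "s = (\<lambda>i. poly (pderiv (P i)) (x i))"
    have "s i \<in> adjoin M n x" if "i < n" for i
    proof -
      interpret A: subfld "adjoin M n x" by (rule subfld.intro) simp
      have "coeff (P i) k \<in> adjoin M n x" for k
        unfolding Pq(4)[OF that]
        by (rule eval_mpoly_in_subfield[OF emb_hom adjoin_is_subfield Pq(3)[OF that]])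
          (use nuM in \<open>auto intro: adjoin_emb\<close>)
      then show ?thesis unfolding s_def using adjoin_gen[OF that]
        by (intro A.polys_eval A.polys_pderiv polys_overI) auto
    qed
    then have "finite (\<nu> ` {..<e} \<union> s ` {..<n})" "\<nu> ` {..<e} \<union> s ` {..<n} \<subseteq> adjoin M n x"
      using nuM by auto
    then obtain D where D: "D \<in> mpolys n M" "eval_mpoly emb x D \<noteq> 0"
      "\<And>b h. b \<in> V \<Longrightarrow> eval_mpoly id b D \<noteq> 0 \<Longrightarrow> h \<in> \<nu> ` {..<e} \<union> s ` {..<n} \<Longrightarrow>
         \<exists>c. rat_fun_value M n x h b c \<and> (h \<noteq> 0 \<longrightarrow> c \<noteq> 0)"
      using M.common_denominator[OF x] by metis
    have "D \<in> mpolys n K" using D(1) mpolys_mono[OF order_refl MK] by blast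
    from pac_avoid[OF pac e abs_irred_variety_mono[OF V MK] x td \<nu>K domK separable_map_mono[OF M K MK sep] this D(2)]
    obtain b c where b: "b \<in> rational_points K n V" "eval_mpoly id b D \<noteq> 0"
      and c: "rat_map_value K n x e \<nu> b c" "\<forall>j<e. c j \<in> K0" by blast
    have bV: "b \<in> V" using b(1) by (simp add: rational_points_def)
    \<comment> \<open>The PAC property yields values represented over \<open>K\<close> only. Off
      \<open>D\<close> there is also a representation over \<open>M\<close>, and uniqueness
      identifies the two values.\<close>
    have vM: "rat_fun_value M n x (\<nu> j) b (c j)" if "j < e" for j
    proof -
      have "\<nu> j \<in> \<nu> ` {..<e} \<union> s ` {..<n}" using that by blast
      from D(3)[OF bV b(2) this] obtain c' where c': "rat_fun_value M n x (\<nu> j) b c'" by blast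
      moreover have "rat_fun_value K n x (\<nu> j) b (c j)" using c(1) that by (simp add: rat_map_value_def)
      ultimately show ?thesis using rat_fun_value_unique[OF x bV] by metis
    qed
    have "b i \<in> M" if i: "i < n" for i
    proof -
      define a where "a = (\<lambda>k. eval_mpoly id c (q i k))"
      \<comment> \<open>The specialisation of \<open>P i\<close> at \<open>b\<close>. The sum runs
        to the degree of \<open>P i\<close>, so the formula persists when the leading coefficient
        vanishes at \<open>b\<close>.\<close>
      define T where "T = (\<Sum>k\<le>degree (P i). monom (a k) k)"
      have va: "rat_fun_value M n x (coeff (P i) k) b (a k)" for k
        unfolding a_def Pq(4)[OF i] by (rule M.rat_fun_value_compose[OF Pq(3)[OF i] vM])
      have vx: "rat_fun_value M n x (x i) b (b i)"
        using M.rat_fun_value_eval[OF M.mpolys_var[OF i]] by simp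
      have "rat_fun_value M n x (poly (P i) (x i)) b (\<Sum>k\<le>degree (P i). a k * b i ^ k)"
        unfolding poly_altdef by (intro M.rat_fun_value_sum M.rat_fun_value_mult M.rat_fun_value_power va vx)
      moreover have "rat_fun_value M n x 0 b 0" using M.rat_fun_value_const[of 0 n x b] by simp
      ultimately have "(\<Sum>k\<le>degree (P i). a k * b i ^ k) = 0"
        using rat_fun_value_unique[OF x bV] Pq(1)[OF i] by metis
      then have T0: "poly T (b i) = 0" by (simp add: T_def poly_sum poly_monom)
      have of: "rat_fun_value M n x (of_nat k) b (of_nat k)" for k
        using M.rat_fun_value_const[of "of_nat k" n x b] by simp
      have "rat_fun_value M n x (s i) b (\<Sum>k\<le>degree (P i). of_nat k * a k * b i ^ (k - 1))"
        unfolding s_def poly_pderiv_altdef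
        by (intro M.rat_fun_value_sum M.rat_fun_value_mult M.rat_fun_value_power va vx of)
      moreover obtain d where "rat_fun_value M n x (s i) b d" "d \<noteq> 0"
        using D(3)[OF bV b(2), of "s i"] i Pq(2)[OF i] by (auto simp: s_def)
      ultimately have "(\<Sum>k\<le>degree (P i). of_nat k * a k * b i ^ (k - 1)) \<noteq> 0"
        using rat_fun_value_unique[OF x bV] by metis
      moreover have "pderiv T = (\<Sum>k\<le>degree (P i). monom (of_nat k * a k) (k - 1))"
        unfolding T_def using pderiv_sum[of "\<lambda>k. monom (a k) k" "{..degree (P i)}"] by (simp add: pderiv_monom)
      ultimately have T1: "poly (pderiv T) (b i) \<noteq> 0" by (simp add: poly_sum poly_monom)
      have "a k \<in> M" for k
        unfolding a_def
        by (rule eval_mpoly_in_subfield[OF id_hom.comm_ring_hom_axioms M Pq(3)[OF i]]) (use c(2) K0M in auto)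
      then have "T \<in> polys_over M" unfolding T_def by (intro M.polys_sum M.polys_monom)
      with T0 T1 have "b i \<in> sep_closure M" by (auto simp: sep_closure_eq[OF M] simple_root_over_def)
      \<comment> \<open>Being separable over \<open>K0\<close> and an element of \<open>K\<close> is
        membership in \<open>M\<close>.\<close>
      also have "sep_closure M = sep_closure K0"
        by (rule sep_closure_trans[OF K0 M K0M]) (simp add: M_def)
      finally show ?thesis using b(1) i by (auto simp: M_def rational_points_def)
    qed
    then have "b \<in> rational_points M n V" using bV by (simp add: rational_points_def)
    moreover have "rat_map_value M n x e \<nu> b c" using c(1) vM by (simp add: rat_map_value_def)
    ultimately show ?thesis using c(2) by blast
  qed
  then show ?thesis
    using M K0 K0M unfolding M_def [symmetric] pac_extension_def by simp
qed

section \<open>Generic elements of a separable extension\<close>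

lemma mpconst_hom: "comm_ring_hom (mpconst :: 'a::comm_ring_1 \<Rightarrow> 'a mpol)"
  by unfold_locales (auto simp: mpconst_def single_add mult_single)

interpretation mpc: comm_ring_hom "mpconst :: 'a::comm_ring_1 \<Rightarrow> 'a mpol"
  by (rule mpconst_hom)

lemma poly_zero_distinct_roots:
  fixes q :: "'b::idom poly"
  assumes "inj_on t {..<e}" "\<And>i. i < e \<Longrightarrow> poly q (t i) = 0" "degree q < e"
  shows "q = 0"
proof (rule ccontr)
  assume "q \<noteq> 0"
  have "t ` {..<e} \<subseteq> {a. poly q a = 0}" using assms(2) by auto
  then have "card (t ` {..<e}) \<le> card {a. poly q a = 0}"
    using poly_roots_finite[OF \<open>q \<noteq> 0\<close>] by (intro card_mono)
  also have "\<dots> \<le> degree q" by (rule card_poly_roots_bound[OF \<open>q \<noteq> 0\<close>])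
  finally show False using assms(1,3) by (simp add: card_image)
qed

lemma prod_linear_degree_monic:
  fixes t :: "nat \<Rightarrow> 'b::idom"
  shows "degree (\<Prod>i<e. [:- t i, 1:]) = e" "lead_coeff (\<Prod>i<e. [:- t i, 1:]) = 1"
  by (subst degree_prod_sum_eq) (auto simp: lead_coeff_prod)

lemma poly_eq_prod_distinct_roots:
  fixes p :: "'b::idom poly"
  assumes "inj_on t {..<e}" "\<And>i. i < e \<Longrightarrow> poly p (t i) = 0" "degree p = e" "lead_coeff p = 1"
  shows "p = (\<Prod>i<e. [:- t i, 1:])"
proof (cases "e = 0")
  case True
  then obtain a where "p = [:a:]" using assms(3) by (metis degree_eq_zeroE)
  with assms(4) True show ?thesis by (simp add: one_pCons)
next
  case False
  let ?P = "\<Prod>i<e. [:- t i, 1:]"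
  have "p - ?P = 0"
  proof (rule poly_zero_distinct_roots[OF assms(1)])
    fix i assume "i < e"
    then have "poly ?P (t i) = 0" by (auto simp: poly_prod)
    then show "poly (p - ?P) (t i) = 0" using assms(2) \<open>i < e\<close> by simp
  next
    have "degree (p - ?P) \<le> e"
      using degree_diff_le_max[of p ?P] assms(3) prod_linear_degree_monic(1)[of t e] by simp
    moreover have "coeff (p - ?P) e = 0"
      using assms(3,4) prod_linear_degree_monic[of t e] by simp
    ultimately show "degree (p - ?P) < e"
      using False leading_coeff_0_iff[of "p - ?P"] by (cases "p - ?P = 0") (auto simp: le_less)
  qed
  then show ?thesis by simp
qed

lemma prod_linear_simple_root:
  fixes t :: "nat \<Rightarrow> 'b::idom"
  assumes "inj_on t {..<e}" "i < e"
  shows "poly (pderiv (\<Prod>i<e. [:- t i, 1:])) (t i) \<noteq> 0"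
proof -
  define Q where "Q = (\<Prod>j\<in>{..<e} - {i}. [:- t j, 1:])"
  have "(\<Prod>j<e. [:- t j, 1:]) = [:- t i, 1:] * Q"
    unfolding Q_def using assms(2) by (intro prod.remove) auto
  then have "poly (pderiv (\<Prod>j<e. [:- t j, 1:])) (t i) = poly Q (t i)"
    unfolding pderiv_mult by (simp only: pderiv_mult) (simp add: pderiv_pCons)
  moreover have "poly Q (t i) \<noteq> 0"
    using assms by (auto simp: Q_def poly_prod inj_on_def)
  ultimately show ?thesis by simp
qed

lemma (in subfld) det_mpolys:
  assumes "A \<in> carrier_mat m m" "\<And>i j. i < m \<Longrightarrow> j < m \<Longrightarrow> A $$ (i, j) \<in> mpolys n E"
  shows "det A \<in> mpolys n E"
  by (rule det_over[OF _ _ _ _ _ assms]) auto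

lemma (in subfld) adj_mat_mpolys:
  assumes A: "A \<in> carrier_mat m m" "\<And>i j. i < m \<Longrightarrow> j < m \<Longrightarrow> A $$ (i, j) \<in> mpolys n E"
    and ij: "i < m" "j < m"
  shows "adj_mat A $$ (i, j) \<in> mpolys n E"
proof -
  have "det (mat_delete A j i) \<in> mpolys n E"
  proof (rule det_mpolys)
    show "mat_delete A j i \<in> carrier_mat (m - 1) (m - 1)"
      using A by (auto simp: mat_delete_def)
    fix k l assume "k < m - 1" "l < m - 1"
    then show "mat_delete A j i $$ (k, l) \<in> mpolys n E"
      using A ij by (auto simp: mat_delete_def)
  qed
  then show ?thesis using A ij by (auto simp: adj_mat_def cofactor_def)
qed

text \<open>The bound \<open>2 \<le> e\<close> makes index 1 available, that is, \<alpha> itself is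
  one of the basis elements 1, \<alpha>, ..., \<alpha>^(e-1). Degree 1 is treated apart in
  \<open>sep_closure_generated\<close>.\<close>

locale conjugates = subfld_ac K for K :: "'a::alg_closed_field set" +
  fixes e :: nat and f :: "'a poly" and \<alpha> :: "nat \<Rightarrow> 'a"
  assumes e: "2 \<le> e" and f: "f \<in> polys_over K" "degree f = e"
    and root: "\<And>i. i < e \<Longrightarrow> poly f (\<alpha> i) = 0" and inj: "inj_on \<alpha> {..<e}"
begin

text \<open>The remainder of X^k modulo \<open>f\<close>: its coefficients express the k-th power in
  the basis 1, \<alpha>, ..., and they serve all conjugates at once.\<close>

definition red :: "nat \<Rightarrow> 'a poly"
  where "red k = (SOME r. r \<in> polys_over K \<and> degree r < e \<and> (\<forall>i<e. poly r (\<alpha> i) = \<alpha> i ^ k))"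

lemma red: "red k \<in> polys_over K" "degree (red k) < e" "i < e \<Longrightarrow> poly (red k) (\<alpha> i) = \<alpha> i ^ k"
proof -
  have f0: "f \<noteq> 0" using f e by auto
  obtain q r where qr: "q \<in> polys_over K" "r \<in> polys_over K" "monom 1 k = q * f + r" "r = 0 \<or> degree r < degree f"
    using polys_division[OF polys_monom[OF one] f(1) f0] .
  have "poly r (\<alpha> i) = \<alpha> i ^ k" if "i < e" for i
    using arg_cong[OF qr(3), of "\<lambda>p. poly p (\<alpha> i)"] root[OF that] by (simp add: poly_monom)
  moreover have "degree r < e" using qr(4) f e by auto
  ultimately have "\<exists>r. r \<in> polys_over K \<and> degree r < e \<and> (\<forall>i<e. poly r (\<alpha> i) = \<alpha> i ^ k)"
    using qr(2) by blast
  from someI_ex[OF this]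
  show "red k \<in> polys_over K" "degree (red k) < e" "i < e \<Longrightarrow> poly (red k) (\<alpha> i) = \<alpha> i ^ k"
    unfolding red_def by blast+
qed

lemma red_sum: "i < e \<Longrightarrow> (\<Sum>l<e. coeff (red k) l * \<alpha> i ^ l) = \<alpha> i ^ k"
proof -
  assume i: "i < e"
  have "(\<Sum>l<e. coeff (red k) l * \<alpha> i ^ l) = (\<Sum>l\<le>degree (red k). coeff (red k) l * \<alpha> i ^ l)"
    using red(2)[of k] by (intro sum.mono_neutral_right) (auto simp: coeff_eq_0)
  then show ?thesis using red(3)[OF i, of k] by (simp add: poly_altdef)
qed

text \<open>The conjugates of the generic element \<open>\<Sum>\<^sub>j X\<^sub>j \<alpha>\<^sup>j\<close>, the matrix of multiplication by it in the
  basis \<open>1, \<alpha>, \<dots>\<close>, and the matrix of its powers in that basis.\<close>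

definition gconj :: "nat \<Rightarrow> 'a mpol"
  where "gconj i = (\<Sum>j<e. mpvar j * mpconst (\<alpha> i ^ j))"

definition gmul :: "nat \<Rightarrow> nat \<Rightarrow> 'a mpol"
  where "gmul k l = (\<Sum>j<e. mpvar j * mpconst (coeff (red (k + j)) l))"

primrec gpow :: "nat \<Rightarrow> nat \<Rightarrow> 'a mpol"
  where "gpow 0 l = (if l = 0 then 1 else 0)"
  | "gpow (Suc k) l = (\<Sum>m<e. gpow k m * gmul m l)"

lemma gmul_mpolys: "gmul k l \<in> mpolys e K"
  unfolding gmul_def by (intro mpolys_sum mpolys_mult mpolys_var mpolys_const polys_overD red) auto

lemma gpow_mpolys: "gpow k l \<in> mpolys e K"
  by (induction k arbitrary: l) (auto intro: gmul_mpolys)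

lemma gconj_mpolys: "gconj i \<in> mpolys e UNIV"
  unfolding gconj_def by (intro UN.mpolys_sum UN.mpolys_mult UN.mpolys_var UN.mpolys_const) auto

text \<open>Multiplication by the generic element, expressed in the power basis, has the vector of
  powers of each conjugate as an eigenvector.\<close>

lemma gmul_eigen:
  assumes i: "i < e"
  shows "(\<Sum>l<e. gmul k l * mpconst (\<alpha> i ^ l)) = gconj i * mpconst (\<alpha> i ^ k)"
proof -
  have "(\<Sum>l<e. gmul k l * mpconst (\<alpha> i ^ l)) =
      (\<Sum>l<e. \<Sum>j<e. mpvar j * mpconst (coeff (red (k + j)) l * \<alpha> i ^ l))"
    by (simp add: gmul_def sum_distrib_right mpc.hom_mult mult.assoc)
  also have "\<dots> = (\<Sum>j<e. mpvar j * mpconst (\<Sum>l<e. coeff (red (k + j)) l * \<alpha> i ^ l))"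
    by (subst sum.swap) (simp add: sum_distrib_left mpc.hom_sum)
  also have "\<dots> = (\<Sum>j<e. mpvar j * mpconst (\<alpha> i ^ (k + j)))"
    by (simp add: red_sum[OF i])
  also have "\<dots> = gconj i * mpconst (\<alpha> i ^ k)"
    by (simp add: gconj_def sum_distrib_right power_add mpc.hom_mult mult.assoc)
      (simp add: mult.left_commute mult.commute)
  finally show ?thesis .
qed

lemma gpow_eigen:
  assumes i: "i < e"
  shows "(\<Sum>l<e. gpow k l * mpconst (\<alpha> i ^ l)) = gconj i ^ k"
proof (induction k)
  case 0
  have "(\<Sum>l<e. gpow 0 l * mpconst (\<alpha> i ^ l)) = (\<Sum>l<e. if l = 0 then 1 else 0)"
    by (intro sum.cong) auto
  also have "\<dots> = 1" using e by simp
  finally show ?case by simp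
next
  case (Suc k)
  have "(\<Sum>l<e. gpow (Suc k) l * mpconst (\<alpha> i ^ l)) =
      (\<Sum>l<e. \<Sum>m<e. gpow k m * (gmul m l * mpconst (\<alpha> i ^ l)))"
    by (simp add: sum_distrib_right mult.assoc)
  also have "\<dots> = (\<Sum>m<e. gpow k m * (\<Sum>l<e. gmul m l * mpconst (\<alpha> i ^ l)))"
    by (subst sum.swap) (simp add: sum_distrib_left)
  also have "\<dots> = gconj i * (\<Sum>m<e. gpow k m * mpconst (\<alpha> i ^ m))"
    unfolding gmul_eigen[OF i] by (simp add: sum_distrib_left mult.left_commute)
  finally show ?case using Suc by simp
qed

lemma eval_gconj:
  assumes "comm_ring_hom h"
  shows "eval_mpoly h y (gconj i) = (\<Sum>j<e. y j * h (\<alpha> i ^ j))"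
proof -
  interpret h: comm_ring_hom h by fact
  show ?thesis by (simp add: gconj_def h.eval_sum)
qed

text \<open>The point at which the generic element specialises to \<alpha>; evaluating here shows
  that polynomials built from the generic element are distinct or nonzero.\<close>

definition unit_pt :: "nat \<Rightarrow> 'a"
  where "unit_pt = (\<lambda>j. if j = 1 then 1 else 0)"

lemma eval_gconj_unit_pt: "eval_mpoly id unit_pt (gconj i) = \<alpha> i"
proof -
  have "eval_mpoly id unit_pt (gconj i) = (\<Sum>j<e. if j = 1 then \<alpha> i ^ j else 0)"
    unfolding eval_gconj[OF id_hom.comm_ring_hom_axioms]
    by (intro sum.cong) (auto simp: unit_pt_def)
  also have "\<dots> = \<alpha> i" using e by simp
  finally show ?thesis .
qed

lemma gconj_inj: "inj_on gconj {..<e}"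
proof (rule inj_onI)
  fix i j assume "i \<in> {..<e}" "j \<in> {..<e}" "gconj i = gconj j"
  then show "i = j"
    using inj eval_gconj_unit_pt[of i] eval_gconj_unit_pt[of j] by (auto simp: inj_on_def)
qed

text \<open>The matrix description shows that the coefficients lie over \<open>K\<close>; the
  product over the conjugates in \<open>gcp_prod\<close> shows the roots.\<close>

definition gcp :: "'a mpol poly"
  where "gcp = char_poly (mat e e (\<lambda>(k, l). gmul k l))"

lemma gcp_over: "gcp \<in> polys_over (mpolys e K)"
  unfolding gcp_def
  by (rule char_poly_over[where n = e]) (auto intro: gmul_mpolys)

lemma gcp_monic: "degree gcp = e" "coeff gcp e = 1"
  using degree_monic_char_poly[of "mat e e (\<lambda>(k, l). gmul k l)" e] by (auto simp: gcp_def)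

text \<open>The generic conjugates are \<open>e\<close> distinct eigenvalues, so they exhaust the
  roots of this monic polynomial of degree \<open>e\<close>.\<close>

lemma gcp_prod: "gcp = (\<Prod>i<e. [:- gconj i, 1:])"
proof (rule poly_eq_prod_distinct_roots[OF gconj_inj])
  fix i assume i: "i < e"
  let ?v = "vec e (\<lambda>l. mpconst (\<alpha> i ^ l) :: 'a mpol)" and ?A = "mat e e (\<lambda>(k, l). gmul k l)"
  show "poly gcp (gconj i) = 0"
    unfolding gcp_def
  proof (rule char_poly_root[of _ e ?v])
    show "?v \<noteq> 0\<^sub>v e"
    proof
      assume "?v = 0\<^sub>v e"
      then have "vec_index ?v 0 = vec_index (0\<^sub>v e) 0" by simp
      then show False using e by simp
    qed
    show "?A *\<^sub>v ?v = gconj i \<cdot>\<^sub>v ?v"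
    proof (rule eq_vecI)
      fix k assume "k < dim_vec (gconj i \<cdot>\<^sub>v ?v)"
      then have k: "k < e" by simp
      have "vec_index (?A *\<^sub>v ?v) k = (\<Sum>l<e. gmul k l * mpconst (\<alpha> i ^ l))"
        using k by (simp add: scalar_prod_def atLeast0LessThan)
      also have "\<dots> = vec_index (gconj i \<cdot>\<^sub>v ?v) k" using k by (simp add: gmul_eigen[OF i])
      finally show "vec_index (?A *\<^sub>v ?v) k = vec_index (gconj i \<cdot>\<^sub>v ?v) k" .
    qed simp
  qed auto
qed (use gcp_monic in auto)

text \<open>The determinant of the passage from the powers of \<alpha> to the powers of the generic
  element; where it is nonzero, the specialised element still generates \<alpha>.\<close>

definition gdet :: "'a mpol"
  where "gdet = det (mat e e (\<lambda>(k, l). gpow k l))"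

text \<open>Rows are counted from 0, so row 1 of the adjugate is the one that solves for
  \<alpha>.\<close>

definition gcof :: "nat \<Rightarrow> 'a mpol"
  where "gcof k = adj_mat (mat e e (\<lambda>(k, l). gpow k l)) $$ (1, k)"

lemma gdet_mpolys: "gdet \<in> mpolys e K"
  unfolding gdet_def by (rule det_mpolys[of _ e]) (auto intro: gpow_mpolys)

lemma gcof_mpolys: "k < e \<Longrightarrow> gcof k \<in> mpolys e K"
  unfolding gcof_def by (rule adj_mat_mpolys[of _ e]) (use e in \<open>auto intro: gpow_mpolys\<close>)

text \<open>Cramer's rule for the system that expresses the powers of the generic element through
  the powers of \<alpha>.\<close>

lemma gdet_conj:
  assumes i: "i < e"
  shows "gdet * mpconst (\<alpha> i) = (\<Sum>k<e. gcof k * gconj i ^ k)"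
proof -
  let ?N = "mat e e (\<lambda>(k, l). gpow k l)"
  have N: "?N \<in> carrier_mat e e" by simp
  have adj: "(\<Sum>k<e. gcof k * gpow k l) = (if l = 1 then gdet else 0)" if "l < e" for l
  proof -
    have "(adj_mat ?N * ?N) $$ (1, l) = (gdet \<cdot>\<^sub>m 1\<^sub>m e) $$ (1, l)"
      using adj_mat(3)[OF N] by (simp add: gdet_def)
    then show ?thesis using e that adj_mat(1)[OF N]
      by (auto simp: gcof_def scalar_prod_def atLeast0LessThan times_mat_def)
  qed
  have "(\<Sum>k<e. gcof k * gconj i ^ k) = (\<Sum>k<e. \<Sum>l<e. gcof k * gpow k l * mpconst (\<alpha> i ^ l))"
    by (simp add: sum_distrib_left mult.assoc flip: gpow_eigen[OF i])
  also have "\<dots> = (\<Sum>l<e. (\<Sum>k<e. gcof k * gpow k l) * mpconst (\<alpha> i ^ l))"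
    by (subst sum.swap) (simp add: sum_distrib_right)
  also have "\<dots> = (\<Sum>l<e. if l = 1 then gdet * mpconst (\<alpha> i ^ l) else 0)"
    using adj by (intro sum.cong) auto
  also have "\<dots> = gdet * mpconst (\<alpha> i)" using e by simp
  finally show ?thesis ..
qed

text \<open>At \<open>unit_pt\<close> the generic element is \<alpha>, and the matrix of its first
  \<open>e\<close> powers in the power basis is the identity.\<close>

lemma gdet_nonzero: "gdet \<noteq> 0"
proof -
  have gp: "eval_mpoly id unit_pt (gpow k l) = (if k = l then 1 else 0)" if kl: "k < e" "l < e" for k l
  proof -
    define q where "q = (\<Sum>l<e. monom (eval_mpoly id unit_pt (gpow k l)) l) - monom 1 k"
    have "q = 0"
    proof (rule poly_zero_distinct_roots[OF inj])
      fix i assume i: "i < e"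
      have "eval_mpoly id unit_pt (\<Sum>l<e. gpow k l * mpconst (\<alpha> i ^ l)) = \<alpha> i ^ k"
        unfolding gpow_eigen[OF i] id_hom.eval_power eval_gconj_unit_pt ..
      then show "poly q (\<alpha> i) = 0"
        by (simp add: q_def poly_sum poly_monom id_hom.eval_sum)
    next
      have "degree (\<Sum>l<e. monom (eval_mpoly id unit_pt (gpow k l)) l) < e"
        using e by (intro degree_sum_less le_less_trans[OF degree_monom_le]) auto
      moreover have "degree (monom (1::'a) k) < e" using kl by (simp add: degree_monom_eq)
      ultimately show "degree q < e" unfolding q_def by (rule degree_diff_less)
    qed
    then have "coeff (\<Sum>l<e. monom (eval_mpoly id unit_pt (gpow k l)) l) l = coeff (monom 1 k) l"
      by (simp add: q_def)
    then show ?thesis using kl by (simp add: coeff_sum)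
  qed
  interpret ev: comm_ring_hom "eval_mpoly id unit_pt" by (rule id_hom.eval_comm_ring_hom)
  have "eval_mpoly id unit_pt gdet = det (map_mat (eval_mpoly id unit_pt) (mat e e (\<lambda>(k, l). gpow k l)))"
    by (simp add: gdet_def)
  also have "map_mat (eval_mpoly id unit_pt) (mat e e (\<lambda>(k, l). gpow k l)) = 1\<^sub>m e"
    by (rule eq_matI) (auto simp: gp)
  finally have "eval_mpoly id unit_pt gdet = 1" by (simp only: det_one)
  then show ?thesis using id_hom.eval_zero[of unit_pt] by (metis zero_neq_one)
qed

text \<open>The Lagrange basis for the nodes \<alpha>_i. Its coefficients invert the Vandermonde
  matrix of the conjugates.\<close>

definition lag :: "nat \<Rightarrow> 'a poly"
  where "lag i = (\<Prod>k\<in>{..<e} - {i}. Polynomial.smult (inverse (\<alpha> i - \<alpha> k)) [:- \<alpha> k, 1:])"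

lemma lag_eval: "i < e \<Longrightarrow> k < e \<Longrightarrow> poly (lag i) (\<alpha> k) = (if i = k then 1 else 0)"
proof -
  assume ik: "i < e" "k < e"
  show ?thesis
  proof (cases "i = k")
    case True
    have "poly (lag i) (\<alpha> i) = (\<Prod>k\<in>{..<e} - {i}. 1)"
      unfolding lag_def poly_prod
    proof (intro prod.cong refl)
      fix k assume "k \<in> {..<e} - {i}"
      then have "\<alpha> i - \<alpha> k \<noteq> 0" using inj ik by (auto simp: inj_on_def)
      then have "inverse (\<alpha> i - \<alpha> k) * (\<alpha> i - \<alpha> k) = 1" by simp
      then show "poly (Polynomial.smult (inverse (\<alpha> i - \<alpha> k)) [:- \<alpha> k, 1:]) (\<alpha> i) = 1"
        by (simp add: algebra_simps)
    qed
    with True show ?thesis by simp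
  next
    case False
    then show ?thesis using ik unfolding lag_def poly_prod
      by (subst prod_zero) (auto intro!: bexI[of _ k])
  qed
qed

lemma lag_degree: "i < e \<Longrightarrow> degree (lag i) < e"
proof -
  assume i: "i < e"
  have "degree (lag i) \<le> (\<Sum>k\<in>{..<e} - {i}. degree (Polynomial.smult (inverse (\<alpha> i - \<alpha> k)) [:- \<alpha> k, 1:]))"
    unfolding lag_def by (rule degree_prod_sum_le[unfolded o_def]) simp
  also have "\<dots> \<le> (\<Sum>k\<in>{..<e} - {i}. 1)"
    by (intro sum_mono) simp
  also have "\<dots> < e" using i by simp
  finally show ?thesis .
qed

text \<open>Interpolating the values of X^m at the nodes returns X^m. This recovers the coordinates
  from the conjugates.\<close>

lemma lag_coeffs:
  assumes "m < e" "j < e"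
  shows "(\<Sum>i<e. \<alpha> i ^ m * coeff (lag i) j) = (if m = j then 1 else 0)"
proof -
  define q where "q = (\<Sum>i<e. Polynomial.smult (\<alpha> i ^ m) (lag i)) - monom 1 m"
  have "q = 0"
  proof (rule poly_zero_distinct_roots[OF inj])
    fix k assume k: "k < e"
    have "(\<Sum>i<e. \<alpha> i ^ m * poly (lag i) (\<alpha> k)) = (\<Sum>i<e. if i = k then \<alpha> i ^ m else 0)"
      using k by (intro sum.cong) (auto simp: lag_eval)
    then show "poly q (\<alpha> k) = 0" using k by (simp add: q_def poly_sum poly_monom)
  next
    have "degree (\<Sum>i<e. Polynomial.smult (\<alpha> i ^ m) (lag i)) < e"
      using e by (intro degree_sum_less le_less_trans[OF degree_smult_le] lag_degree) auto
    moreover have "degree (monom (1::'a) m) < e" using assms by (simp add: degree_monom_eq)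
    ultimately show "degree q < e" unfolding q_def by (rule degree_diff_less)
  qed
  then have "coeff (\<Sum>i<e. Polynomial.smult (\<alpha> i ^ m) (lag i)) j = coeff (monom 1 m) j" by (simp add: q_def)
  then show ?thesis by (simp add: coeff_sum)
qed

text \<open>The opposite direction: coordinates can be chosen so that the conjugates take arbitrary
  prescribed values.\<close>

lemma lag_interpolate:
  assumes "k < e"
  shows "(\<Sum>j<e. (\<Sum>i<e. r i * coeff (lag i) j) * \<alpha> k ^ j) = r k"
proof -
  have pl: "(\<Sum>j<e. coeff (lag i) j * \<alpha> k ^ j) = (if i = k then 1 else 0)" if "i < e" for i
  proof -
    have "(\<Sum>j<e. coeff (lag i) j * \<alpha> k ^ j) = poly (lag i) (\<alpha> k)"
      unfolding poly_altdef using lag_degree[OF that]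
      by (intro sum.mono_neutral_right) (auto simp: coeff_eq_0)
    then show ?thesis using lag_eval[OF that assms] by simp
  qed
  have "(\<Sum>j<e. (\<Sum>i<e. r i * coeff (lag i) j) * \<alpha> k ^ j) = (\<Sum>i<e. \<Sum>j<e. r i * (coeff (lag i) j * \<alpha> k ^ j))"
    by (subst sum.swap) (simp add: sum_distrib_right mult.assoc)
  also have "\<dots> = (\<Sum>i<e. r i * (\<Sum>j<e. coeff (lag i) j * \<alpha> k ^ j))"
    by (simp only: sum_distrib_left)
  also have "\<dots> = (\<Sum>i<e. if i = k then r i else 0)"
    using pl by (intro sum.cong) auto
  also have "\<dots> = r k" using assms by simp
  finally show ?thesis .
qed

end

section \<open>Points of affine space\<close>

text \<open>The variables themselves, read in the rational function field. Evaluation at them only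
  embeds a polynomial, which makes the point generic in affine space.\<close>

definition aff_pt :: "nat \<Rightarrow> nat \<Rightarrow> 'a::alg_closed_field universal_domain"
  where "aff_pt e = restrict (\<lambda>i. to_ac (Fract (mpvar i) 1)) {..<e}"

lemma eval_aff_pt:
  fixes p :: "'a::alg_closed_field mpol"
  assumes "p \<in> mpolys e UNIV"
  shows "eval_mpoly emb (aff_pt e) p = to_ac (Fract p 1)"
  using UNIV_is_subfield assms
proof (induction p rule: mpolys_induct)
  case (const c)
  have "eval_mpoly emb (aff_pt e) (mpconst c) = emb c" by (rule emb.eval_mpconst)
  also have "emb c = to_ac (Fract (mpconst c) 1)" by (simp only: emb_def mpconst_def)
  finally show ?case .
next
  case (var i)
  then show ?case by (simp add: aff_pt_def)
next
  case (add p q)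
  then show ?case by (simp flip: to_ac_add)
next
  case (mult p q)
  then show ?case by (simp flip: to_ac_mult)
qed

lemma to_ac_eq_0: "to_ac (u :: 'b::field) = 0 \<longleftrightarrow> u = 0"
proof
  assume z: "to_ac u = 0"
  show "u = 0"
  proof (rule ccontr)
    assume "u \<noteq> 0"
    then have "to_ac u * to_ac (inverse u) = 1" by (simp flip: to_ac_mult)
    with z show False by simp
  qed
qed simp

lemma eval_aff_pt_eq_0:
  fixes p :: "'a::alg_closed_field mpol"
  assumes "p \<in> mpolys e UNIV"
  shows "eval_mpoly emb (aff_pt e) p = 0 \<longleftrightarrow> p = 0"
  by (simp add: eval_aff_pt[OF assms] to_ac_eq_0 eq_fract Fraction_Field.Zero_fract_def)

lemma aff_pt_independent: "algebraically_independent e (aff_pt e)"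
  by (simp add: algebraically_independent_def eval_aff_pt_eq_0)

lemma vanishing_ideal_affine_space:
  "vanishing_ideal e (affine_space e) = {0 :: 'a::alg_closed_field mpol}"
proof -
  have "eval_mpoly id b 0 = 0" for b :: "nat \<Rightarrow> 'a" by (rule id_hom.eval_zero)
  then show ?thesis using mpoly_zeroI by (auto simp: vanishing_ideal_def)
qed

lemma aff_pt_generic: "generic_point e (affine_space e :: (nat \<Rightarrow> 'a::alg_closed_field) set) (aff_pt e)"
  unfolding generic_point_def vanishing_ideal_affine_space
  by (simp add: eval_aff_pt_eq_0) (simp add: affine_space_def aff_pt_def)

lemma affine_space_variety:
  assumes "is_subfield (K :: 'a::alg_closed_field set)"
  shows "abs_irred_variety K e (affine_space e)"
  unfolding abs_irred_variety_def
proof (intro conjI generic_point_irreducible[OF aff_pt_generic])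
  interpret K: subfld K by (rule subfld.intro) fact
  show "zariski_closed e (affine_space e :: (nat \<Rightarrow> 'a) set)"
    unfolding zariski_closed_def by (intro exI[of _ "{}"]) (auto simp: zero_set_def)
  let ?I = "vanishing_ideal e (affine_space e) :: 'a mpol set"
  have "0 \<in> ideal_gen e (?I \<inter> mpolys e K)"
    unfolding ideal_gen_def by (intro CollectI exI[of _ "{}"] exI[of _ "\<lambda>_. 0"]) auto
  then have "?I \<subseteq> ideal_gen e (?I \<inter> mpolys e K)"
    by (simp add: vanishing_ideal_affine_space)
  moreover have "ideal_gen e (?I \<inter> mpolys e K) \<subseteq> ?I"
    by (rule ideal_gen_subset_vanishing_ideal) blast
  ultimately show "?I = ideal_gen e (?I \<inter> mpolys e K)" by blast
qed

lemma aff_pt_trdeg: "has_trdeg e (aff_pt e :: nat \<Rightarrow> 'a::alg_closed_field universal_domain) e"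
  unfolding has_trdeg_def
proof (intro exI[of _ "aff_pt e"] conjI ballI allI impI aff_pt_independent adjoin_gen)
  fix h assume "h \<in> adjoin UNIV e (aff_pt e :: nat \<Rightarrow> 'a universal_domain)"
  then show "algebraic_over (adjoin UNIV e (aff_pt e)) h"
    by (intro simple_root_algebraic simple_root_over_self) auto
qed

text \<open>The form in which the PAC property is used for Galois groups. Surjectivity on points
  over the ambient field stands for dominance; separability is asked of the coordinates over every
  field containing the constants and the components.\<close>

lemma pac_affine_space:
  fixes P :: "nat \<Rightarrow> 'a::alg_closed_field mpol"
  assumes pac: "pac_extension K K0" and e: "1 \<le> e" and P: "\<And>j. j < e \<Longrightarrow> P j \<in> mpolys e K"
    and dom: "\<And>c. c \<in> affine_space e \<Longrightarrow> \<exists>b\<in>affine_space e. \<forall>j<e. eval_mpoly id b (P j) = c j"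
    and sep: "\<And>F i. is_subfield F \<Longrightarrow> emb ` K \<subseteq> F \<Longrightarrow> (\<And>j. j < e \<Longrightarrow> eval_mpoly emb (aff_pt e) (P j) \<in> F) \<Longrightarrow>
      i < e \<Longrightarrow> aff_pt e i \<in> sep_closure F"
    and D: "D \<in> mpolys e K" "D \<noteq> 0"
  obtains b where "\<And>i. i < e \<Longrightarrow> b i \<in> K" "eval_mpoly id b D \<noteq> 0" "\<And>j. j < e \<Longrightarrow> eval_mpoly id b (P j) \<in> K0"
proof -
  have K: "is_subfield K" using pac by (simp add: pac_extension_def)
  interpret K: subfld_ac K by (rule subfld_acI) fact
  let ?x = "aff_pt e :: nat \<Rightarrow> 'a universal_domain"
  define \<nu> where "\<nu> = restrict (\<lambda>j. eval_mpoly emb ?x (P j)) {..<e}"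
  have val: "rat_fun_value K e ?x (\<nu> j) b (eval_mpoly id b (P j))" if "j < e" for b j
    using K.rat_fun_value_eval[OF P[OF that]] that by (simp add: \<nu>_def)
  have \<nu>: "rational_map K e ?x e \<nu>"
    unfolding rational_map_def \<nu>_def using adjoin_eval[OF P] by auto
  have "c \<in> {c. \<exists>b\<in>affine_space e. rat_map_value K e ?x e \<nu> b c}" if c: "c \<in> affine_space e" for c
  proof -
    obtain b where b: "b \<in> affine_space e" "\<forall>j<e. eval_mpoly id b (P j) = c j" using dom[OF c] by blast
    have "rat_map_value K e ?x e \<nu> b c"
      unfolding rat_map_value_def using c b(2) val[of _ b] by auto
    with b(1) show ?thesis by blast
  qed
  then have "affine_space e \<subseteq> zariski_closure e {c. \<exists>b\<in>affine_space e. rat_map_value K e ?x e \<nu> b c}"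
    unfolding zariski_closure_def by blast
  moreover have "zariski_closed e (affine_space e :: (nat \<Rightarrow> 'a) set)"
    using affine_space_variety[OF K] by (simp add: abs_irred_variety_def)
  then have "zariski_closure e {c. \<exists>b\<in>affine_space e. rat_map_value K e ?x e \<nu> b c} \<subseteq> affine_space e"
    unfolding zariski_closure_def by (intro Inter_lower) (auto simp: rat_map_value_def)
  ultimately have dom': "dominant_map K e (affine_space e) ?x e \<nu>"
    by (simp add: dominant_map_def)
  let ?F = "adjoin K e \<nu>"
  have "adjoin K e ?x \<subseteq> sep_closure ?F"
  proof (rule adjoin_least[OF sep_closure_is_subfield])
    have emb: "emb ` K \<subseteq> ?F" using adjoin_emb[of _ K e \<nu>] by auto
    then show "emb ` K \<subseteq> sep_closure ?F" using sep_closure_base[of ?F] by auto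
    have "eval_mpoly emb ?x (P j) \<in> ?F" if "j < e" for j
      using adjoin_gen[OF that, of \<nu> K] that by (simp add: \<nu>_def)
    then show "?x i \<in> sep_closure ?F" if "i < e" for i
      using emb that by (intro sep) auto
  qed simp
  then have sep': "separable_map K e ?x e \<nu>" by (auto simp: separable_map_def sep_closure_def)
  have "eval_mpoly emb ?x D \<noteq> 0" using D eval_aff_pt_eq_0[OF mpolys_UNIV] by blast
  from pac_avoid[OF pac e affine_space_variety[OF K] aff_pt_generic aff_pt_trdeg \<nu> dom' sep' D(1) this]
  obtain b c where b: "b \<in> rational_points K e (affine_space e)" "eval_mpoly id b D \<noteq> 0"
    and c: "rat_map_value K e ?x e \<nu> b c" "\<forall>j<e. c j \<in> K0" by blast
  have bA: "b \<in> affine_space e" using b(1) by (simp add: rational_points_def)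
  have "eval_mpoly id b (P j) \<in> K0" if j: "j < e" for j
  proof -
    have "rat_fun_value K e ?x (\<nu> j) b (c j)" using c(1) j by (simp add: rat_map_value_def)
    from rat_fun_value_unique[OF aff_pt_generic bA this val[OF j]] c(2) j show ?thesis by metis
  qed
  then show ?thesis using that[of b] b by (auto simp: rational_points_def)
qed

text \<open>Were \<open>K0\<close> finite, the identity map of the line, with \<open>D\<close>
  vanishing exactly at the points of \<open>K0\<close>, would produce a point of \<open>K0\<close>
  outside \<open>K0\<close>.\<close>

lemma pac_infinite:
  assumes "pac_extension K (K0 :: 'a::alg_closed_field set)"
  shows "infinite K0"
proof
  assume fin: "finite K0"
  define D where "D = (\<Prod>a\<in>K0. mpvar 0 - mpconst a)"
  have K: "is_subfield K" and K0K: "K0 \<subseteq> K" using assms by (auto simp: pac_extension_def)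
  interpret K: subfld K by (rule subfld.intro) fact
  have f: "mpvar 0 - mpconst a \<noteq> (0 :: 'a mpol)" for a :: 'a
  proof
    assume "mpvar 0 - mpconst a = (0 :: 'a mpol)"
    then have "eval_mpoly id (\<lambda>_. a + 1) (mpvar 0 - mpconst a) = eval_mpoly id (\<lambda>_. a + 1) 0" by simp
    then show False unfolding id_hom.eval_diff id_hom.eval_mpvar id_hom.eval_mpconst id_hom.eval_zero by simp
  qed
  show False
  proof (rule pac_affine_space[OF assms, of 1 "\<lambda>_. mpvar 0" D])
    show "D \<in> mpolys 1 K" unfolding D_def using K0K by (intro K.mpolys_prod K.mpolys_diff) auto
    show "D \<noteq> 0" unfolding D_def using f fin by simp
    show "\<exists>b\<in>affine_space 1. \<forall>j<1. eval_mpoly id b (mpvar 0) = c j" if "c \<in> affine_space 1" for c :: "nat \<Rightarrow> 'a"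
      using that by (intro bexI[of _ c]) auto
    show "aff_pt 1 i \<in> sep_closure F" if "is_subfield F" "i < 1"
      "\<And>j::nat. j < 1 \<Longrightarrow> eval_mpoly emb (aff_pt 1) (mpvar 0) \<in> F" for F i
      using that(3)[of 0] that(2) sep_closure_base[OF that(1)] by auto
    fix b assume b: "eval_mpoly id b D \<noteq> 0" "\<And>j::nat. j < 1 \<Longrightarrow> eval_mpoly id b (mpvar 0) \<in> K0"
    have "b 0 \<in> K0" using b(2)[of 0] unfolding id_hom.eval_mpvar by simp
    then have "eval_mpoly id b D = 0"
      unfolding D_def id_hom.eval_prod using fin by (intro prod_zero) (auto intro!: bexI[of _ "b 0"])
    with b(1) show False by simp
  qed (auto intro: K.mpolys_var)
qed

section \<open>The separable closure is generated by the separable closure of the base\<close>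

lemma simple_root_over_emb:
  assumes "is_subfield E" "simple_root_over E a"
  shows "simple_root_over (emb ` E) (emb a)"
proof -
  obtain p where p: "p \<in> polys_over E" "poly p a = 0" "poly (pderiv p) a \<noteq> 0"
    using assms(2) by (auto simp: simple_root_over_def)
  interpret E: subfld E by (rule subfld.intro) fact
  have c: "coeff (map_poly emb p) k = emb (coeff p k)" for k by (simp add: coeff_map_poly)
  have ev: "poly (map_poly emb p) (emb a) = emb (poly p a)" for p
  proof -
    have "degree (map_poly emb p) = degree p" by (rule degree_map_poly) simp
    then show ?thesis by (simp add: poly_altdef coeff_map_poly emb.hom_sum emb.hom_mult emb.hom_power)
  qed
  have pd: "pderiv (map_poly emb p) = map_poly emb (pderiv p)"
    by (rule poly_eqI) (simp add: coeff_pderiv coeff_map_poly emb.hom_mult emb.hom_add flip: emb_of_nat)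
  have "map_poly emb p \<in> polys_over (emb ` E)"
    using polys_overD[OF p(1)] by (auto simp: polys_over_def c)
  with p show ?thesis
    unfolding simple_root_over_def by (intro bexI[of _ "map_poly emb p"]) (auto simp: pd ev)
qed

lemma prod_linear_hom:
  assumes "comm_ring_hom h"
  shows "map_poly h (\<Prod>i<e. [:- t i, 1:]) = (\<Prod>i<(e::nat). [:- h (t i), 1:])"
proof -
  interpret h: comm_ring_hom h by fact
  interpret m: map_poly_comm_ring_hom h ..
  show ?thesis by (simp add: m.hom_prod h.hom_uminus)
qed

lemma monic_splits:
  fixes p :: "'a::alg_closed_field poly"
  assumes "lead_coeff p = 1"
  obtains r where "p = (\<Prod>i<degree p. [:- r i, 1:])"
proof -
  have "p \<noteq> 0" using assms by auto
  then obtain A where A: "size A = degree p" "p = Polynomial.smult (lead_coeff p) (\<Prod>x\<in>#A. [:- x, 1:])"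
    using alg_closed_imp_factorization by blast
  obtain rs where rs: "mset rs = A" using ex_mset by blast
  have len: "length rs = degree p" using A(1) rs by auto
  have "p = (\<Prod>x\<in>#A. [:- x, 1:])"
    using A(2) unfolding assms by simp
  also have "\<dots> = (\<Prod>x\<leftarrow>rs. [:- x, 1:])"
    unfolding rs [symmetric] by (simp add: prod_mset_prod_list flip: mset_map)
  also have "\<dots> = (\<Prod>i<degree p. [:- (rs ! i), 1:])"
    by (simp add: prod.list_conv_set_nth len atLeast0LessThan)
  finally show ?thesis by (rule that)
qed

context conjugates
begin

lemma coeff_prod_conj:
  assumes "comm_ring_hom h"
  shows "coeff (\<Prod>i<e. [:- eval_mpoly h y (gconj i), 1:]) j = eval_mpoly h y (coeff gcp j)"
proof -
  interpret h: comm_ring_hom h by fact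
  have "(\<Prod>i<e. [:- eval_mpoly h y (gconj i), 1:]) = map_poly (eval_mpoly h y) gcp"
    unfolding gcp_prod by (rule prod_linear_hom[OF h.eval_comm_ring_hom, symmetric])
  then show ?thesis by (simp add: coeff_map_poly)
qed

lemma gcp_coeff: "coeff gcp j \<in> mpolys e K"
  by (rule polys_overD[OF gcp_over])

text \<open>The prescribed coefficients determine a monic polynomial, which splits in the ambient
  field; interpolation then finds a point whose generic conjugates specialise to its roots.\<close>

lemma gcp_coeffs_surj:
  assumes c: "c \<in> affine_space e"
  shows "\<exists>b\<in>affine_space e. \<forall>j<e. eval_mpoly id b (coeff gcp j) = c j"
proof -
  define Q where "Q = monom 1 e + (\<Sum>j<e. monom (c j) j)"
  have dl: "degree (\<Sum>j<e. monom (c j) j) < e"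
    using e by (intro degree_sum_less le_less_trans[OF degree_monom_le]) auto
  have dQ: "degree Q = e"
    unfolding Q_def using dl by (subst degree_add_eq_left) (auto simp: degree_monom_eq)
  have Qc: "coeff Q j = c j" if "j < e" for j using that by (simp add: Q_def coeff_sum)
  have lQ: "lead_coeff Q = 1" using dl by (simp add: dQ) (simp add: Q_def coeff_eq_0)
  obtain r where Qr: "Q = (\<Prod>i<e. [:- r i, 1:])"
    using monic_splits[OF lQ] unfolding dQ .
  define b where "b = restrict (\<lambda>j. \<Sum>i<e. r i * coeff (lag i) j) {..<e}"
  have "eval_mpoly id b (gconj k) = r k" if "k < e" for k
    using lag_interpolate[OF that, of r] unfolding eval_gconj[OF id_hom.comm_ring_hom_axioms]
    by (simp add: b_def)
  then have "(\<Prod>i<e. [:- eval_mpoly id b (gconj i), 1:]) = Q"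
    unfolding Qr by (intro prod.cong) auto
  then have "\<forall>j<e. eval_mpoly id b (coeff gcp j) = c j"
    using coeff_prod_conj[OF id_hom.comm_ring_hom_axioms, of b] Qc by metis
  moreover have "b \<in> affine_space e" by (simp add: b_def affine_space_def)
  ultimately show ?thesis by blast
qed

lemma prod_conj_over:
  assumes "comm_ring_hom h" "is_subfield F" "\<And>j. j < e \<Longrightarrow> eval_mpoly h y (coeff gcp j) \<in> F"
  shows "(\<Prod>i<e. [:- eval_mpoly h y (gconj i), 1:]) \<in> polys_over F"
proof (rule polys_overI)
  fix j
  interpret h: comm_ring_hom h by fact
  interpret F: subfld F by (rule subfld.intro) fact
  have "j < e \<or> j = e \<or> j > e" by auto
  then show "coeff (\<Prod>i<e. [:- eval_mpoly h y (gconj i), 1:]) j \<in> F"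
    unfolding coeff_prod_conj[OF assms(1)] using assms(3) gcp_monic by (auto simp: coeff_eq_0)
qed

lemma conj_simple_root:
  assumes "comm_ring_hom (h :: 'a \<Rightarrow> 'b::field)" "is_subfield F" "\<And>j. j < e \<Longrightarrow> eval_mpoly h y (coeff gcp j) \<in> F"
    and inj: "inj_on (\<lambda>i. eval_mpoly h y (gconj i)) {..<e}" and i: "i < e"
  shows "simple_root_over F (eval_mpoly h y (gconj i))"
  unfolding simple_root_over_def
proof (intro bexI[OF _ prod_conj_over[OF assms(1-3)]] conjI)
  show "poly (\<Prod>i<e. [:- eval_mpoly h y (gconj i), 1:]) (eval_mpoly h y (gconj i)) = 0"
    using i by (auto simp: poly_prod)
  show "poly (pderiv (\<Prod>i<e. [:- eval_mpoly h y (gconj i), 1:])) (eval_mpoly h y (gconj i)) \<noteq> 0"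
    by (rule prod_linear_simple_root[OF inj i])
qed

text \<open>The generic conjugates are distinct roots of \<open>gcp\<close>, hence separable over
  \<open>F\<close>. The coordinates are their combinations with Lagrange coefficients, which are
  separable over \<open>K\<close>.\<close>

lemma aff_pt_separable:
  assumes conj: "\<And>i. i < e \<Longrightarrow> \<alpha> i \<in> sep_closure K"
    and F: "is_subfield F" "emb ` K \<subseteq> F" "\<And>j. j < e \<Longrightarrow> eval_mpoly emb (aff_pt e) (coeff gcp j) \<in> F"
    and j: "j < e"
  shows "aff_pt e j \<in> sep_closure F"
proof -
  let ?\<theta> = "\<lambda>i. eval_mpoly emb (aff_pt e) (gconj i)"
  interpret S: subfld "sep_closure F" by (rule subfld.intro) (rule sep_closure_is_subfield[OF F(1)])
  interpret Ks: subfld "sep_closure K" by (rule subfld.intro) (rule sep_closure_is_subfield[OF is_subfield])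
  have "inj_on ?\<theta> {..<e}"
  proof (rule inj_onI)
    fix i k assume ik: "i \<in> {..<e}" "k \<in> {..<e}" "?\<theta> i = ?\<theta> k"
    then have "eval_mpoly emb (aff_pt e) (gconj i - gconj k) = 0" by simp
    then have "gconj i = gconj k"
      using eval_aff_pt_eq_0[of "gconj i - gconj k" e] gconj_mpolys by auto
    with gconj_inj ik show "i = k" by (auto simp: inj_on_def)
  qed
  then have \<theta>: "?\<theta> i \<in> sep_closure F" if "i < e" for i
    using conj_simple_root[OF emb_hom F(1,3) _ that] by (simp add: sep_closure_eq[OF F(1)])
  have lagK: "coeff (lag i) j \<in> sep_closure K" if "i < e" for i
    unfolding lag_def using conj that
    by (intro polys_overD[of _ "sep_closure K"] Ks.polys_prod Ks.polys_smult Ks.polys_pCons) auto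
  have lagF: "emb (coeff (lag i) j) \<in> sep_closure F" if "i < e" for i
  proof -
    have "simple_root_over K (coeff (lag i) j)"
      using lagK[OF that] by (simp add: sep_closure_eq[OF is_subfield])
    from simple_root_over_mono[OF F(2) simple_root_over_emb[OF is_subfield this]]
    show ?thesis by (simp add: sep_closure_eq[OF F(1)])
  qed
  have "(\<Sum>i<e. ?\<theta> i * emb (coeff (lag i) j)) =
      (\<Sum>i<e. \<Sum>m<e. aff_pt e m * emb (\<alpha> i ^ m * coeff (lag i) j))"
    by (simp add: eval_gconj[OF emb_hom] sum_distrib_right emb.hom_mult mult.assoc)
  also have "\<dots> = (\<Sum>m<e. aff_pt e m * emb (\<Sum>i<e. \<alpha> i ^ m * coeff (lag i) j))"
    by (subst sum.swap) (simp add: sum_distrib_left emb.hom_sum)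
  also have "\<dots> = (\<Sum>m<e. if m = j then aff_pt e m else 0)"
    using j by (intro sum.cong) (auto simp: lag_coeffs)
  also have "\<dots> = aff_pt e j" using j by simp
  finally have "aff_pt e j = (\<Sum>i<e. ?\<theta> i * emb (coeff (lag i) j))" ..
  also have "\<dots> \<in> sep_closure F" by (intro S.sum S.mult \<theta> lagF) auto
  finally show ?thesis .
qed

text \<open>Cramer's rule specialised at \<open>b\<close>. One polynomial serves all indices, so
  distinct \<alpha>_i force distinct \<beta>_i.\<close>

lemma conj_expressed:
  assumes b: "\<And>i. i < e \<Longrightarrow> b i \<in> K" and D: "eval_mpoly id b gdet \<noteq> 0"
  obtains r where "r \<in> polys_over K" "\<And>i. i < e \<Longrightarrow> \<alpha> i = poly r (eval_mpoly id b (gconj i))"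
proof -
  define w where "w = (\<lambda>k. eval_mpoly id b (gcof k) / eval_mpoly id b gdet)"
  define r where "r = (\<Sum>k<e. monom (w k) k)"
  have ev: "eval_mpoly id b p \<in> K" if "p \<in> mpolys e K" for p
    by (rule eval_mpoly_in_subfield[OF id_hom.comm_ring_hom_axioms is_subfield that]) (use b in auto)
  have "r \<in> polys_over K"
    unfolding r_def w_def by (intro polys_sum polys_monom divide ev gcof_mpolys gdet_mpolys) simp
  moreover have "\<alpha> i = poly r (eval_mpoly id b (gconj i))" if i: "i < e" for i
  proof -
    have "eval_mpoly id b (gdet * mpconst (\<alpha> i)) = eval_mpoly id b (\<Sum>k<e. gcof k * gconj i ^ k)"
      by (simp only: gdet_conj[OF i])
    then have eq: "eval_mpoly id b gdet * \<alpha> i = (\<Sum>k<e. eval_mpoly id b (gcof k) * eval_mpoly id b (gconj i) ^ k)"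
      by (simp add: id_hom.eval_sum)
    have "poly r (eval_mpoly id b (gconj i)) =
        (\<Sum>k<e. eval_mpoly id b (gcof k) * eval_mpoly id b (gconj i) ^ k) / eval_mpoly id b gdet"
      by (simp add: r_def w_def poly_sum poly_monom sum_divide_distrib)
    then show ?thesis using D by (simp flip: eq)
  qed
  ultimately show ?thesis using that by blast
qed

end

lemma min_poly_roots:
  fixes E :: "'a::alg_closed_field set"
  assumes "is_subfield E" "is_min_poly E a m" "rsquarefree m"
  obtains \<alpha> where "inj_on \<alpha> {..<degree m}" "\<And>i. i < degree m \<Longrightarrow> poly m (\<alpha> i) = 0"
    "m = (\<Prod>i<degree m. [:- \<alpha> i, 1:])"
proof -
  interpret E: subfld E by (rule subfld.intro) fact
  note m = E.min_polyD[OF assms(2)]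
  obtain r where mr: "m = (\<Prod>i<degree m. [:- r i, 1:])"
    using monic_splits[OF m(2)] .
  have root: "poly m (r i) = 0" if "i < degree m" for i
    by (subst mr) (use that in \<open>auto simp: poly_prod\<close>)
  have "inj_on r {..<degree m}"
  proof (rule inj_onI, rule ccontr)
    fix i j assume ij: "i \<in> {..<degree m}" "j \<in> {..<degree m}" "r i = r j" "i \<noteq> j"
    define Q where "Q = (\<Prod>k\<in>{..<degree m} - {i}. [:- r k, 1:])"
    have "(\<Prod>k<degree m. [:- r k, 1:]) = [:- r i, 1:] * Q"
      unfolding Q_def using ij by (intro prod.remove) auto
    then have "m = [:- r i, 1:] * Q" using mr by simp
    moreover have "poly Q (r i) = 0" using ij unfolding Q_def poly_prod
      by (subst prod_zero) (auto intro!: bexI[of _ j])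
    ultimately have "poly (pderiv m) (r i) = 0"
      by (simp only: pderiv_mult) (simp add: pderiv_pCons)
    then show False using assms(3) root[of i] ij m(4) by (auto simp: rsquarefree_iff)
  qed
  with root mr that show ?thesis by blast
qed

lemma (in subfld) min_poly_degree_1:
  assumes m: "is_min_poly E a m" and d1: "degree m = 1"
  shows "a \<in> E"
proof -
  note m' = min_polyD[OF m]
  obtain v u where vu: "m = [:u, v:]" "v \<noteq> 0" using d1 by (rule degree1_coeffs)
  have "v = coeff m 1" unfolding vu(1) by simp
  also have "\<dots> = 1" using m'(2) unfolding d1 .
  finally have "v = 1" .
  have "u + a * v = poly m a" unfolding vu(1) by simp
  also have "\<dots> = 0" by (rule m'(3))
  finally have "a + u = 0" unfolding \<open>v = 1\<close> by (simp add: add.commute)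
  then have au: "a = - u" by (simp add: eq_neg_iff_add_eq_0)
  have "u = coeff m 0" unfolding vu(1) by (rule coeff_pCons_0 [symmetric])
  then have "u \<in> E" using polys_overD[OF m'(1), of 0] by (simp only:)
  then show ?thesis unfolding au by (rule uminus)
qed

theorem sep_closure_generated:
  fixes K K0 :: "'a::alg_closed_field set"
  assumes pac: "pac_extension K K0" and a: "a \<in> sep_closure K"
  obtains \<beta> r where "\<beta> \<in> sep_closure K0" "r \<in> polys_over K" "a = poly r \<beta>"
proof -
  have K: "is_subfield K" and K0: "is_subfield K0" using pac by (auto simp: pac_extension_def)
  interpret K: subfld K by (rule subfld.intro) fact
  obtain m where m: "is_min_poly K a m" "rsquarefree m"
    using a by (auto simp: sep_closure_def separable_over_def)
  note m' = K.min_polyD[OF m(1)]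
  show ?thesis
  proof (cases "2 \<le> degree m")
    case False
    then have "degree m = 1" using K.min_poly_degree_pos[OF m(1)] by simp
    then have "a \<in> K" by (rule K.min_poly_degree_1[OF m(1)])
    interpret K0: subfld K0 by (rule subfld.intro) fact
    \<comment> \<open>In degree 1 the element lies in \<open>K\<close> and is written as a constant
      polynomial, evaluated at 0.\<close>
    have "0 \<in> sep_closure K0" using sep_closure_base[OF K0] K0.zero by blast
    moreover have "[:a:] \<in> polys_over K" using \<open>a \<in> K\<close> by simp
    ultimately show ?thesis by (rule that) simp
  next
    case True
    obtain \<alpha> where \<alpha>: "inj_on \<alpha> {..<degree m}" "\<And>i. i < degree m \<Longrightarrow> poly m (\<alpha> i) = 0"
      "m = (\<Prod>i<degree m. [:- \<alpha> i, 1:])"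
      by (rule min_poly_roots[OF K m]) (rule that)
    interpret conjugates K "degree m" m \<alpha>
      by (intro conjugates.intro subfld_acI K conjugates_axioms.intro) (use True m'(1) \<alpha>(1,2) in auto)
    have conj: "\<alpha> i \<in> sep_closure K" if "i < degree m" for i
      using K.min_poly_conjugate[OF m(1) \<alpha>(2)[OF that]] m(2)
      by (auto simp: sep_closure_def separable_over_def)
    obtain b where b: "\<And>i. i < degree m \<Longrightarrow> b i \<in> K" "eval_mpoly id b gdet \<noteq> 0"
      "\<And>j. j < degree m \<Longrightarrow> eval_mpoly id b (coeff gcp j) \<in> K0"
    proof (rule pac_affine_space[OF pac, of "degree m" "coeff gcp" gdet])
      show "1 \<le> degree m" using True by simp
      show "aff_pt (degree m) i \<in> sep_closure F"
        if "is_subfield F" "emb ` K \<subseteq> F" "i < degree m"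
          "\<And>j. j < degree m \<Longrightarrow> eval_mpoly emb (aff_pt (degree m)) (coeff gcp j) \<in> F" for F i
        by (rule aff_pt_separable[OF conj that(1,2,4,3)])
      show "coeff gcp j \<in> mpolys (degree m) K" for j by (rule gcp_coeff)
      show "\<exists>b\<in>affine_space (degree m). \<forall>j<degree m. eval_mpoly id b (coeff gcp j) = c j"
        if "c \<in> affine_space (degree m)" for c using that by (rule gcp_coeffs_surj)
      show "gdet \<in> mpolys (degree m) K" by (rule gdet_mpolys)
      show "gdet \<noteq> 0" by (rule gdet_nonzero)
    qed (rule that)
    obtain r where r: "r \<in> polys_over K" "\<And>i. i < degree m \<Longrightarrow> \<alpha> i = poly r (eval_mpoly id b (gconj i))"
    proof (rule conj_expressed[of b])
      show "b i \<in> K" if "i < degree m" for i using that by (rule b(1))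
      show "eval_mpoly id b gdet \<noteq> 0" by (rule b(2))
    qed (rule that)
    \<comment> \<open>\<open>r\<close> carries the specialised conjugates to the distinct
      \<alpha>_i, so they are simple roots of the specialised \<open>gcp\<close>, whose coefficients
      lie in \<open>K0\<close>.\<close>
    have "inj_on (\<lambda>i. eval_mpoly id b (gconj i)) {..<degree m}"
      using \<alpha>(1) r(2) by (auto simp: inj_on_def)
    then have sr: "eval_mpoly id b (gconj i) \<in> sep_closure K0" if "i < degree m" for i
      using conj_simple_root[OF id_hom.comm_ring_hom_axioms K0 b(3) _ that]
      by (simp add: sep_closure_eq[OF K0])
    have "poly m a = (\<Prod>i<degree m. a - \<alpha> i)"
      by (subst \<alpha>(3)) (simp add: poly_prod)
    then have "(\<Prod>i<degree m. a - \<alpha> i) = 0" using m'(3) by simp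
    then obtain i where i: "i < degree m" "a = \<alpha> i" by auto
    show ?thesis
      by (rule that[OF sr[OF i(1)] r(1)]) (use i r(2) in simp)
  qed
qed

section \<open>Primitive elements\<close>

text \<open>For all but finitely many \<open>c\<close>, the only common root of \<open>g\<close> and
  f(\<gamma> - c X) is \<beta>'. Its separable minimal polynomial over E(\<gamma>) divides both, so
  it is linear.\<close>

lemma primitive_element:
  fixes E :: "'a::alg_closed_field set"
  assumes E: "is_subfield E" and inf: "infinite E"
    and ab: "\<beta> \<in> sep_closure E" "\<beta>' \<in> sep_closure E"
  obtains \<gamma> u v where "\<gamma> \<in> sep_closure E" "u \<in> polys_over E" "v \<in> polys_over E"
    "\<beta> = poly u \<gamma>" "\<beta>' = poly v \<gamma>"
proof -
  interpret E: subfld E by (rule subfld.intro) fact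
  interpret S: subfld "sep_closure E" by (rule subfld.intro) (rule sep_closure_is_subfield[OF E])
  obtain f where f: "is_min_poly E \<beta> f" using ab by (auto simp: sep_closure_def separable_over_def)
  obtain g where g: "is_min_poly E \<beta>' g" using ab by (auto simp: sep_closure_def separable_over_def)
  note f' = E.min_polyD[OF f] and g' = E.min_polyD[OF g]
  \<comment> \<open>The values of \<open>c\<close> for which \<gamma> - c b is a conjugate
    \<open>a\<close> of \<beta> for some conjugate \<open>b\<close> other than \<beta>'. For
    \<open>b = \<beta>'\<close> division by zero contributes only the value 0.\<close>
  define Bad where "Bad = (\<lambda>(a, b). (a - \<beta>) / (\<beta>' - b)) ` ({a. poly f a = 0} \<times> {b. poly g b = 0})"
  have "finite Bad" unfolding Bad_def
    using poly_roots_finite[OF f'(4)] poly_roots_finite[OF g'(4)] by (intro finite_imageI finite_cartesian_product)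
  then obtain c where c: "c \<in> E" "c \<notin> Bad" using inf by (meson finite_subset subsetI)
  define \<gamma> where "\<gamma> = \<beta> + c * \<beta>'"
  have \<gamma>: "\<gamma> \<in> sep_closure E"
    unfolding \<gamma>_def using ab c sep_closure_base[OF E] by (intro S.add S.mult) auto
  let ?F = "fext E \<gamma>"
  interpret F: subfld ?F by (rule subfld.intro) simp
  have EF: "E \<subseteq> ?F" by (rule fext_base)
  have "\<beta>' \<in> sep_closure ?F" using sep_closure_mono[OF E _ EF] ab by auto
  then obtain n where n: "is_min_poly ?F \<beta>' n" "rsquarefree n"
    by (auto simp: sep_closure_def separable_over_def)
  define h where "h = pcompose f [:\<gamma>, - c:]"
  have "h \<in> polys_over ?F"
    unfolding h_def using f'(1) polys_over_mono[OF EF] c EF by (intro F.polys_pcompose F.polys_pCons F.uminus) auto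
  moreover have "poly h \<beta>' = 0"
    using f'(3) by (simp add: h_def poly_pcompose \<gamma>_def mult.commute)
  ultimately have hb: "poly h b = 0" if "poly n b = 0" for b
    using F.min_poly_root_transfer[OF n(1) that] by blast
  have "g \<in> polys_over ?F" using g'(1) polys_over_mono[OF EF] by blast
  then have gb: "poly g b = 0" if "poly n b = 0" for b
    using F.min_poly_root_transfer[OF n(1) that] g'(3) by blast
  have uniq: "b = \<beta>'" if "poly n b = 0" for b
  proof (rule ccontr)
    assume "b \<noteq> \<beta>'"
    have "poly f (\<gamma> - c * b) = 0" using hb[OF that] by (simp add: h_def poly_pcompose mult.commute)
    then have "((\<gamma> - c * b) - \<beta>) / (\<beta>' - b) \<in> Bad"
      unfolding Bad_def using gb[OF that] by (intro image_eqI[of _ _ "(\<gamma> - c * b, b)"]) auto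
    moreover have "((\<gamma> - c * b) - \<beta>) / (\<beta>' - b) = c"
      using \<open>b \<noteq> \<beta>'\<close> by (simp add: \<gamma>_def field_simps)
    ultimately show False using c by simp
  qed
  obtain r where r: "inj_on r {..<degree n}" "\<And>i. i < degree n \<Longrightarrow> poly n (r i) = 0"
    by (rule min_poly_roots[OF _ n]) (simp, rule that)
  have "degree n = 1"
  proof (rule ccontr)
    assume "degree n \<noteq> 1"
    then have d: "0 < degree n" "1 < degree n" using F.min_poly_degree_pos[OF n(1)] by auto
    then have "r 0 = r 1" using uniq[OF r(2)] by metis
    with r(1) d show False by (auto simp: inj_on_def)
  qed
  then have b': "\<beta>' \<in> ?F" by (rule F.min_poly_degree_1[OF n(1)])
  then have "\<gamma> - c * \<beta>' \<in> ?F" using c EF by (intro F.diff F.mult) auto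
  then have b: "\<beta> \<in> ?F" by (simp add: \<gamma>_def)
  obtain m where m: "is_min_poly E \<gamma> m" using \<gamma> by (auto simp: sep_closure_def separable_over_def)
  obtain u where u: "u \<in> polys_over E" "\<beta> = poly u \<gamma>" using fext_algebraic_poly[OF E m b] by metis
  obtain v where v: "v \<in> polys_over E" "\<beta>' = poly v \<gamma>" using fext_algebraic_poly[OF E m b'] by metis
  show ?thesis by (rule that[OF \<gamma> u(1) v(1) u(2) v(2)])
qed

section \<open>Absolute Galois groups\<close>

definition galois_aut :: "'a::alg_closed_field set \<Rightarrow> ('a \<Rightarrow> 'a) \<Rightarrow> bool"
  where "galois_aut K \<sigma> \<longleftrightarrow> \<sigma> \<in> carrier (abs_galois_group K)"

lemma galois_autD:
  assumes "galois_aut K \<sigma>"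
  shows "\<sigma> \<in> Bij (sep_closure K)" "\<And>a b. a \<in> sep_closure K \<Longrightarrow> b \<in> sep_closure K \<Longrightarrow> \<sigma> (a + b) = \<sigma> a + \<sigma> b"
    "\<And>a b. a \<in> sep_closure K \<Longrightarrow> b \<in> sep_closure K \<Longrightarrow> \<sigma> (a * b) = \<sigma> a * \<sigma> b"
    "\<And>a. a \<in> K \<Longrightarrow> \<sigma> a = a" "inj_on \<sigma> (sep_closure K)" "\<sigma> ` sep_closure K = sep_closure K"
    "\<sigma> \<in> extensional (sep_closure K)"
  using assms by (auto simp: galois_aut_def abs_galois_group_def Bij_def bij_betw_def)

lemma galois_autI:
  assumes "\<sigma> \<in> extensional (sep_closure K)" "bij_betw \<sigma> (sep_closure K) (sep_closure K)"
    "\<And>a b. a \<in> sep_closure K \<Longrightarrow> b \<in> sep_closure K \<Longrightarrow> \<sigma> (a + b) = \<sigma> a + \<sigma> b"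
    "\<And>a b. a \<in> sep_closure K \<Longrightarrow> b \<in> sep_closure K \<Longrightarrow> \<sigma> (a * b) = \<sigma> a * \<sigma> b"
    "\<And>a. a \<in> K \<Longrightarrow> \<sigma> a = a"
  shows "galois_aut K \<sigma>"
  using assms by (auto simp: galois_aut_def abs_galois_group_def Bij_def)

lemma galois_aut_poly:
  assumes K: "is_subfield K" and \<sigma>: "galois_aut K \<sigma>" and p: "p \<in> polys_over K" and a: "a \<in> sep_closure K"
  shows "\<sigma> (poly p a) = poly p (\<sigma> a)"
  using p
proof (induction p)
  case 0
  interpret K: subfld K by (rule subfld.intro) fact
  show ?case using galois_autD(4)[OF \<sigma> K.zero] by simp
next
  case (pCons c p)
  interpret S: subfld "sep_closure K" by (rule subfld.intro) (rule sep_closure_is_subfield[OF K])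
  have cp: "c \<in> K" "p \<in> polys_over K"
    using pCons.prems by (auto simp: polys_over_def coeff_pCons split: nat.splits)
  have "poly p a \<in> sep_closure K"
    using cp(2) polys_over_mono[OF sep_closure_base[OF K]] a by (intro S.polys_eval) auto
  then have "\<sigma> (a * poly p a) = \<sigma> a * \<sigma> (poly p a)" "a * poly p a \<in> sep_closure K"
    using galois_autD(3)[OF \<sigma> a] a by auto
  then have "\<sigma> (c + a * poly p a) = \<sigma> c + \<sigma> a * \<sigma> (poly p a)"
    using galois_autD(2)[OF \<sigma>, of c "a * poly p a"] cp(1) sep_closure_base[OF K] by auto
  then show ?case using pCons.IH[OF cp(2)] galois_autD(4)[OF \<sigma> cp(1)] by simp
qed

text \<open>An injective map that fixes the coefficients preserves both the vanishing and the
  nonvanishing of a polynomial over \<open>E\<close>; this is applied to a witness and to its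
  derivative.\<close>

lemma galois_aut_simple_root_iff:
  assumes E: "is_subfield E" and K: "is_subfield K" and EK: "E \<subseteq> K" and \<sigma>: "galois_aut K \<sigma>" and a: "a \<in> sep_closure K"
  shows "\<sigma> a \<in> sep_closure E \<longleftrightarrow> a \<in> sep_closure E"
proof -
  interpret S: subfld "sep_closure K" by (rule subfld.intro) (rule sep_closure_is_subfield[OF K])
  interpret E: subfld E by (rule subfld.intro) fact
  have z: "poly p (\<sigma> a) = 0 \<longleftrightarrow> poly p a = 0" if p: "p \<in> polys_over E" for p
  proof -
    have pK: "p \<in> polys_over K" using p polys_over_mono[OF EK] by blast
    have "poly p a \<in> sep_closure K"
      using pK polys_over_mono[OF sep_closure_base[OF K]] a by (intro S.polys_eval) auto
    moreover have "\<sigma> 0 = 0" using galois_autD(4)[OF \<sigma>] EK E.zero by blast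
    ultimately have "\<sigma> (poly p a) = 0 \<longleftrightarrow> poly p a = 0"
      using inj_onD[OF galois_autD(5)[OF \<sigma>], of "poly p a" 0] S.zero by auto
    then show ?thesis by (simp add: galois_aut_poly[OF K \<sigma> pK a])
  qed
  then have "simple_root_over E (\<sigma> a) \<longleftrightarrow> simple_root_over E a"
    unfolding simple_root_over_def using E.polys_pderiv by blast
  then show ?thesis by (simp add: sep_closure_eq[OF E])
qed

lemma galois_restriction_aut:
  assumes E: "is_subfield E" and K: "is_subfield K" and EK: "E \<subseteq> K" and \<sigma>: "galois_aut K \<sigma>"
  shows "galois_aut E (galois_restriction E \<sigma>)"
proof -
  interpret S: subfld "sep_closure E" by (rule subfld.intro) (rule sep_closure_is_subfield[OF E])
  have sub: "sep_closure E \<subseteq> sep_closure K" by (rule sep_closure_mono[OF E K EK])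
  note iff = galois_aut_simple_root_iff[OF E K EK \<sigma>]
  show ?thesis
  proof (rule galois_autI)
    show "bij_betw (galois_restriction E \<sigma>) (sep_closure E) (sep_closure E)"
      unfolding bij_betw_def
    proof (intro conjI equalityI subsetI)
      show "inj_on (galois_restriction E \<sigma>) (sep_closure E)"
        using galois_autD(5)[OF \<sigma>] sub by (auto simp: inj_on_def galois_restriction_def)
      show "b \<in> sep_closure E" if "b \<in> galois_restriction E \<sigma> ` sep_closure E" for b
        using that iff sub by (auto simp: galois_restriction_def)
      fix b assume b: "b \<in> sep_closure E"
      then obtain a where a: "a \<in> sep_closure K" "b = \<sigma> a" using galois_autD(6)[OF \<sigma>] sub by blast
      then have "a \<in> sep_closure E" using iff b by blast
      with a show "b \<in> galois_restriction E \<sigma> ` sep_closure E"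
        by (auto simp: galois_restriction_def)
    qed
    show "galois_restriction E \<sigma> a = a" if "a \<in> E" for a
    proof -
      have "a \<in> sep_closure E" "a \<in> K" using that EK sep_closure_base[OF E] by auto
      then show ?thesis using galois_autD(4)[OF \<sigma>] by (simp add: galois_restriction_def)
    qed
  next
    fix a b assume ab: "a \<in> sep_closure E" "b \<in> sep_closure E"
    then have "a + b \<in> sep_closure E" "a * b \<in> sep_closure E" by auto
    moreover have "a \<in> sep_closure K" "b \<in> sep_closure K" using ab sub by auto
    ultimately show "galois_restriction E \<sigma> (a + b) = galois_restriction E \<sigma> a + galois_restriction E \<sigma> b"
      "galois_restriction E \<sigma> (a * b) = galois_restriction E \<sigma> a * galois_restriction E \<sigma> b"
      using ab galois_autD(2,3)[OF \<sigma>] by (simp_all add: galois_restriction_def)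
  qed (simp add: galois_restriction_def)
qed

text \<open>What the Galois part takes from the PAC property: \<open>M\<close> is infinite and
  separably closed in \<open>K\<close>, and the separable closure of \<open>K\<close> is generated
  over \<open>K\<close> by that of \<open>M\<close>.\<close>

locale generated_closure =
  fixes M K :: "'a::alg_closed_field set"
  assumes M: "is_subfield M" and K: "is_subfield K" and inf: "infinite M"
    and M_eq: "M = K \<inter> sep_closure M"
    and gen: "\<And>a. a \<in> sep_closure K \<Longrightarrow> \<exists>\<beta>\<in>sep_closure M. \<exists>r\<in>polys_over K. a = poly r \<beta>"
begin

lemma MK: "M \<subseteq> K"
  using M_eq by blast

lemma sub: "sep_closure M \<subseteq> sep_closure K"
  by (rule sep_closure_mono[OF M K MK])

sublocale M: subfld M by (rule subfld.intro) (rule M)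
sublocale K: subfld K by (rule subfld.intro) (rule K)
sublocale Ms: subfld "sep_closure M" by (rule subfld.intro) (rule sep_closure_is_subfield[OF M])
sublocale Ks: subfld "sep_closure K" by (rule subfld.intro) (rule sep_closure_is_subfield[OF K])

text \<open>The minimal polynomial over \<open>K\<close> of an element separable over \<open>M\<close> has its coefficients in
  \<open>M\<close>, because its roots are separable over \<open>M\<close>.\<close>

lemma conjugate_relation:
  assumes \<tau>: "galois_aut M \<tau>" and g: "\<gamma> \<in> sep_closure M" and p: "p \<in> polys_over K" "poly p \<gamma> = 0"
  shows "poly p (\<tau> \<gamma>) = 0"
proof -
  have gK: "\<gamma> \<in> sep_closure K" using g sub by blast
  obtain n where n: "is_min_poly K \<gamma> n" "rsquarefree n"
    using gK by (auto simp: sep_closure_def separable_over_def)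
  obtain m where m: "is_min_poly M \<gamma> m" "rsquarefree m"
    using g by (auto simp: sep_closure_def separable_over_def)
  have mK: "m \<in> polys_over K" using M.min_polyD(1)[OF m(1)] polys_over_mono[OF MK] by blast
  obtain r where r: "\<And>i. i < degree n \<Longrightarrow> poly n (r i) = 0" "n = (\<Prod>i<degree n. [:- r i, 1:])"
    by (rule min_poly_roots[OF K n]) (rule that)
  have rs: "r i \<in> sep_closure M" if "i < degree n" for i
  proof -
    have "poly m (r i) = 0"
      by (rule K.min_poly_root_transfer[OF n(1) r(1)[OF that] mK M.min_polyD(3)[OF m(1)]])
    from M.min_poly_conjugate[OF m(1) this] m(2) show ?thesis
      by (auto simp: sep_closure_def separable_over_def)
  qed
  have "(\<Prod>i<degree n. [:- r i, 1:]) \<in> polys_over (sep_closure M)"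
    using rs by (intro Ms.polys_prod Ms.polys_pCons Ms.uminus) auto
  then have "n \<in> polys_over (sep_closure M)" using r(2) by metis
  then have nM: "n \<in> polys_over M"
    using K.min_polyD(1)[OF n(1)] M_eq by (auto simp: polys_over_def)
  have "poly n (\<tau> \<gamma>) = \<tau> (poly n \<gamma>)" by (rule galois_aut_poly[OF M \<tau> nM g, symmetric])
  also have "\<dots> = 0" using K.min_polyD(3)[OF n(1)] galois_autD(4)[OF \<tau> M.zero] by simp
  finally have "poly n (\<tau> \<gamma>) = 0" .
  then show ?thesis by (rule K.min_poly_root_transfer[OF n(1) _ p])
qed

text \<open>A primitive element turns two expressions into polynomials in one \<gamma>. The inner
  polynomials are over \<open>M\<close>, so the rewriting commutes with every automorphism over
  \<open>M\<close>.\<close>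

lemma common_generator:
  assumes "\<beta> \<in> sep_closure M" "\<beta>' \<in> sep_closure M" and r: "r \<in> polys_over K" "s \<in> polys_over K"
  obtains \<gamma> r' s' where "\<gamma> \<in> sep_closure M" "r' \<in> polys_over K" "s' \<in> polys_over K"
    "poly r \<beta> = poly r' \<gamma>" "poly s \<beta>' = poly s' \<gamma>"
    "\<And>\<tau>. galois_aut M \<tau> \<Longrightarrow> poly r (\<tau> \<beta>) = poly r' (\<tau> \<gamma>) \<and> poly s (\<tau> \<beta>') = poly s' (\<tau> \<gamma>)"
proof -
  obtain \<gamma> u v where g: "\<gamma> \<in> sep_closure M" and uv: "u \<in> polys_over M" "v \<in> polys_over M"
    and eq: "\<beta> = poly u \<gamma>" "\<beta>' = poly v \<gamma>"
    using primitive_element[OF M inf assms(1,2)] .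
  have uvK: "u \<in> polys_over K" "v \<in> polys_over K" using uv polys_over_mono[OF MK] by auto
  show ?thesis
  proof (rule that[of \<gamma> "pcompose r u" "pcompose s v"])
    fix \<tau> assume "galois_aut M \<tau>"
    then show "poly r (\<tau> \<beta>) = poly (pcompose r u) (\<tau> \<gamma>) \<and> poly s (\<tau> \<beta>') = poly (pcompose s v) (\<tau> \<gamma>)"
      unfolding eq using galois_aut_poly[OF M _ uv(1) g] galois_aut_poly[OF M _ uv(2) g]
      by (simp add: poly_pcompose)
  qed (use g r uvK in \<open>auto simp: eq poly_pcompose\<close>)
qed

text \<open>In a common generator the equality becomes a polynomial relation over \<open>K\<close>
  for one element, and \<open>conjugate_relation\<close> says that \<tau> preserves it.\<close>

lemma extension_well_defined:
  assumes \<tau>: "galois_aut M \<tau>" and "\<beta> \<in> sep_closure M" "\<beta>' \<in> sep_closure M"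
    and "r \<in> polys_over K" "s \<in> polys_over K" and eq: "poly r \<beta> = poly s \<beta>'"
  shows "poly r (\<tau> \<beta>) = poly s (\<tau> \<beta>')"
proof -
  obtain \<gamma> r' s' where g: "\<gamma> \<in> sep_closure M" "r' \<in> polys_over K" "s' \<in> polys_over K"
    "poly r \<beta> = poly r' \<gamma>" "poly s \<beta>' = poly s' \<gamma>"
    "\<And>\<tau>. galois_aut M \<tau> \<Longrightarrow> poly r (\<tau> \<beta>) = poly r' (\<tau> \<gamma>) \<and> poly s (\<tau> \<beta>') = poly s' (\<tau> \<gamma>)"
    by (rule common_generator[OF assms(2-5)]) (rule that)
  have "poly (r' - s') (\<tau> \<gamma>) = 0"
    by (rule conjugate_relation[OF \<tau> g(1)]) (use g(2-5) eq in auto)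
  then show ?thesis using g(6)[OF \<tau>] by simp
qed

lemma extension_exists:
  assumes \<tau>: "galois_aut M \<tau>"
  shows "\<exists>\<sigma>. galois_aut K \<sigma> \<and> galois_restriction M \<sigma> = \<tau>"
proof -
  have "\<forall>a. \<exists>\<beta> r. a \<in> sep_closure K \<longrightarrow> \<beta> \<in> sep_closure M \<and> r \<in> polys_over K \<and> a = poly r \<beta>"
    using gen by blast
  then obtain B G where BG: "\<And>a. a \<in> sep_closure K \<Longrightarrow> B a \<in> sep_closure M \<and> G a \<in> polys_over K \<and> a = poly (G a) (B a)"
    by metis
  have B: "B a \<in> sep_closure M" and G: "G a \<in> polys_over K" and GB: "poly (G a) (B a) = a"
    if "a \<in> sep_closure K" for a
    using BG[OF that] by auto
  \<comment> \<open>Each element gets an arbitrary chosen representation r(\<beta>);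
    well-definedness makes the value independent of that choice.\<close>
  define \<sigma> where "\<sigma> = restrict (\<lambda>a. poly (G a) (\<tau> (B a))) (sep_closure K)"
  have \<tau>M: "\<tau> \<beta> \<in> sep_closure M" if "\<beta> \<in> sep_closure M" for \<beta> using galois_autD(6)[OF \<tau>] that by blast
  have inK: "poly r \<beta> \<in> sep_closure K" if "r \<in> polys_over K" "\<beta> \<in> sep_closure M" for r \<beta>
    using that polys_over_mono[OF sep_closure_base[OF K]] sub by (intro Ks.polys_eval) auto
  have \<sigma>: "\<sigma> (poly r \<beta>) = poly r (\<tau> \<beta>)" if r: "r \<in> polys_over K" "\<beta> \<in> sep_closure M" for r \<beta>
  proof -
    note a = inK[OF r]
    have "poly (G (poly r \<beta>)) (\<tau> (B (poly r \<beta>))) = poly r (\<tau> \<beta>)"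
      by (rule extension_well_defined[OF \<tau> B[OF a] r(2) G[OF a] r(1) GB[OF a]])
    then show ?thesis using a by (simp add: \<sigma>_def)
  qed
  have \<sigma>K: "\<sigma> a = a" if "a \<in> K" for a
    \<comment> \<open>An element of \<open>K\<close> is represented as a constant polynomial at
      \<beta> = 0.\<close>
    using \<sigma>[of "[:a:]" 0] that by simp
  have op: "\<sigma> (a + b) = \<sigma> a + \<sigma> b \<and> \<sigma> (a * b) = \<sigma> a * \<sigma> b" if ab: "a \<in> sep_closure K" "b \<in> sep_closure K" for a b
  proof -
    obtain \<beta> r where a: "\<beta> \<in> sep_closure M" "r \<in> polys_over K" "a = poly r \<beta>" using gen[OF ab(1)] by blast
    obtain \<beta>' s where b: "\<beta>' \<in> sep_closure M" "s \<in> polys_over K" "b = poly s \<beta>'" using gen[OF ab(2)] by blast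
    obtain \<gamma> r' s' where g: "\<gamma> \<in> sep_closure M" "r' \<in> polys_over K" "s' \<in> polys_over K"
      "poly r \<beta> = poly r' \<gamma>" "poly s \<beta>' = poly s' \<gamma>"
      "\<And>\<tau>. galois_aut M \<tau> \<Longrightarrow> poly r (\<tau> \<beta>) = poly r' (\<tau> \<gamma>) \<and> poly s (\<tau> \<beta>') = poly s' (\<tau> \<gamma>)"
      by (rule common_generator[OF a(1) b(1) a(2) b(2)]) (rule that)
    have "a + b = poly (r' + s') \<gamma>" "a * b = poly (r' * s') \<gamma>"
      using a(3) b(3) g(4,5) by simp_all
    moreover have "\<sigma> (poly (r' + s') \<gamma>) = poly (r' + s') (\<tau> \<gamma>)" "\<sigma> (poly (r' * s') \<gamma>) = poly (r' * s') (\<tau> \<gamma>)"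
      by (rule \<sigma>[OF K.polys_add[OF g(2,3)] g(1)], rule \<sigma>[OF K.polys_mult[OF g(2,3)] g(1)])
    moreover have "\<sigma> a = poly r' (\<tau> \<gamma>)" "\<sigma> b = poly s' (\<tau> \<gamma>)"
      using a(3) b(3) g(1-5) \<sigma> by simp_all
    ultimately show ?thesis by simp
  qed
  have "galois_aut K \<sigma>"
  proof (rule galois_autI)
    show "bij_betw \<sigma> (sep_closure K) (sep_closure K)"
      unfolding bij_betw_def
    proof (intro conjI equalityI subsetI)
      show "inj_on \<sigma> (sep_closure K)"
      proof (rule inj_onI, rule ccontr)
        fix a b assume ab: "a \<in> sep_closure K" "b \<in> sep_closure K" "\<sigma> a = \<sigma> b" "a \<noteq> b"
        have "\<sigma> a = \<sigma> (a - b) + \<sigma> b" using op[of "a - b" b] ab by simp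
        then have "\<sigma> (a - b) = 0" using ab(3) by simp
        \<comment> \<open>A nonzero difference is invertible, so its image has to be invertible as
          well, since \<sigma> 1 = 1.\<close>
        moreover have "\<sigma> ((a - b) * inverse (a - b)) = \<sigma> (a - b) * \<sigma> (inverse (a - b))"
          using op[of "a - b" "inverse (a - b)"] ab by simp
        ultimately show False using ab(4) \<sigma>K[of 1] by simp
      qed
      show "b \<in> sep_closure K" if "b \<in> \<sigma> ` sep_closure K" for b
        using that inK[OF G \<tau>M[OF B]] by (auto simp: \<sigma>_def)
      fix b assume "b \<in> sep_closure K"
      then obtain \<beta> r where b: "\<beta> \<in> sep_closure M" "r \<in> polys_over K" "b = poly r \<beta>" using gen by blast
      obtain \<beta>0 where "\<beta>0 \<in> sep_closure M" "\<beta> = \<tau> \<beta>0" using galois_autD(6)[OF \<tau>] b(1) by blast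
      then have "b = \<sigma> (poly r \<beta>0)" "poly r \<beta>0 \<in> sep_closure K" using b \<sigma> inK by simp_all
      then show "b \<in> \<sigma> ` sep_closure K" by blast
    qed
  qed (use op \<sigma>K in \<open>auto simp: \<sigma>_def\<close>)
  moreover have "galois_restriction M \<sigma> = \<tau>"
  proof
    fix \<beta>
    show "galois_restriction M \<sigma> \<beta> = \<tau> \<beta>"
    proof (cases "\<beta> \<in> sep_closure M")
      case True
      then show ?thesis using \<sigma>[of "[:0, 1:]" \<beta>] by (simp add: galois_restriction_def)
    next
      case False
      then show ?thesis using galois_autD(7)[OF \<tau>] by (simp add: galois_restriction_def extensional_def)
    qed
  qed
  ultimately show ?thesis by blast
qed

lemma restriction_inj: "inj_on (galois_restriction M) (carrier (abs_galois_group K))"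
proof (rule inj_onI)
  fix \<sigma> \<sigma>' assume "\<sigma> \<in> carrier (abs_galois_group K)" "\<sigma>' \<in> carrier (abs_galois_group K)"
    and eq: "galois_restriction M \<sigma> = galois_restriction M \<sigma>'"
  then have \<sigma>: "galois_aut K \<sigma>" and \<sigma>': "galois_aut K \<sigma>'" by (auto simp: galois_aut_def)
  show "\<sigma> = \<sigma>'"
  proof
    fix a
    show "\<sigma> a = \<sigma>' a"
    proof (cases "a \<in> sep_closure K")
      case True
      then obtain \<beta> r where a: "\<beta> \<in> sep_closure M" "r \<in> polys_over K" "a = poly r \<beta>" using gen by blast
      have "\<sigma> \<beta> = \<sigma>' \<beta>" using fun_cong[OF eq, of \<beta>] a(1) by (simp add: galois_restriction_def)
      then show ?thesis
        using galois_aut_poly[OF K \<sigma> a(2)] galois_aut_poly[OF K \<sigma>' a(2)] a sub by auto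
    next
      case False
      then show ?thesis
        using galois_autD(7)[OF \<sigma>] galois_autD(7)[OF \<sigma>'] by (simp add: extensional_def)
    qed
  qed
qed

lemma restriction_bij:
  "bij_betw (galois_restriction M) (carrier (abs_galois_group K)) (carrier (abs_galois_group M))"
  unfolding bij_betw_def
proof (intro conjI restriction_inj equalityI subsetI)
  show "\<tau> \<in> carrier (abs_galois_group M)" if "\<tau> \<in> galois_restriction M ` carrier (abs_galois_group K)" for \<tau>
    using that galois_restriction_aut[OF M K MK] by (auto simp: galois_aut_def)
  show "\<tau> \<in> galois_restriction M ` carrier (abs_galois_group K)" if "\<tau> \<in> carrier (abs_galois_group M)" for \<tau>
    using extension_exists[of \<tau>] that by (auto simp: galois_aut_def)
qed

lemma restriction_iso: "galois_restriction M \<in> iso (abs_galois_group K) (abs_galois_group M)"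
proof -
  have "galois_restriction M (\<sigma> \<otimes>\<^bsub>abs_galois_group K\<^esub> \<sigma>') =
      galois_restriction M \<sigma> \<otimes>\<^bsub>abs_galois_group M\<^esub> galois_restriction M \<sigma>'"
    if "\<sigma> \<in> carrier (abs_galois_group K)" "\<sigma>' \<in> carrier (abs_galois_group K)" for \<sigma> \<sigma>'
  proof -
    have \<sigma>: "galois_aut K \<sigma>" "galois_aut K \<sigma>'" using that by (auto simp: galois_aut_def)
    note r = galois_restriction_aut[OF M K MK \<sigma>(1)] galois_restriction_aut[OF M K MK \<sigma>(2)]
    have "galois_restriction M (compose (sep_closure K) \<sigma> \<sigma>') =
        compose (sep_closure M) (galois_restriction M \<sigma>) (galois_restriction M \<sigma>')"
    proof
      fix \<beta>
      show "galois_restriction M (compose (sep_closure K) \<sigma> \<sigma>') \<beta> =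
        compose (sep_closure M) (galois_restriction M \<sigma>) (galois_restriction M \<sigma>') \<beta>"
      proof (cases "\<beta> \<in> sep_closure M")
        case True
        moreover have "\<sigma>' \<beta> \<in> sep_closure M"
          using galois_aut_simple_root_iff[OF M K MK \<sigma>(2)] True sub by blast
        ultimately show ?thesis using sub
          by (auto simp: galois_restriction_def compose_def)
      qed (simp add: galois_restriction_def compose_def)
    qed
    then show ?thesis
      using galois_autD(1)[OF \<sigma>(1)] galois_autD(1)[OF \<sigma>(2)] galois_autD(1)[OF r(1)] galois_autD(1)[OF r(2)]
      by (simp add: abs_galois_group_def BijGroup_def)
  qed
  then show ?thesis
    using restriction_bij by (auto simp: iso_def hom_def bij_betw_def)
qed

section \<open>The Krull topology\<close>

lemma topspace_krull: "topspace (krull_topology E) = carrier (abs_galois_group E)"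
proof -
  have "carrier (abs_galois_group E) \<subseteq> sep_closure E \<rightarrow>\<^sub>E sep_closure E"
    by (auto simp: abs_galois_group_def Bij_def bij_betw_def extensional_def)
  then show ?thesis by (auto simp: krull_topology_def)
qed

lemma krull_projection:
  assumes "a \<in> sep_closure E"
  shows "continuous_map (krull_topology E) (discrete_topology (sep_closure E)) (\<lambda>\<sigma>. \<sigma> a)"
  unfolding krull_topology_def
  by (intro continuous_map_from_subtopology continuous_map_product_projection assms)

lemma krull_continuousI:
  assumes "\<And>\<sigma>. \<sigma> \<in> topspace Y \<Longrightarrow> f \<sigma> \<in> carrier (abs_galois_group E)"
    and "\<And>a. a \<in> sep_closure E \<Longrightarrow> continuous_map Y (discrete_topology (sep_closure E)) (\<lambda>\<sigma>. f \<sigma> a)"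
  shows "continuous_map Y (krull_topology E) f"
  unfolding krull_topology_def continuous_map_in_subtopology continuous_map_componentwise
  using assms by (auto simp: abs_galois_group_def Bij_def)

text \<open>Continuity is checked one coordinate at a time. For the inverse, the coordinate at
  \<open>a = poly r \<beta>\<close> is \<open>poly r (\<tau> \<beta>)\<close>, which depends on
  \<tau> only through its value at \<beta>.\<close>

lemma restriction_homeomorphic:
  "homeomorphic_map (krull_topology K) (krull_topology M) (galois_restriction M)"
proof -
  define g where "g = inv_into (carrier (abs_galois_group K)) (galois_restriction M)"
  have g: "g \<tau> \<in> carrier (abs_galois_group K)" "galois_restriction M (g \<tau>) = \<tau>"
    if "\<tau> \<in> carrier (abs_galois_group M)" for \<tau>
    unfolding g_def using bij_betw_inv_into_right[OF restriction_bij that]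
      bij_betwE[OF bij_betw_inv_into[OF restriction_bij]] that by auto
  have "continuous_map (krull_topology K) (krull_topology M) (galois_restriction M)"
  proof (rule krull_continuousI)
    show "galois_restriction M \<sigma> \<in> carrier (abs_galois_group M)" if "\<sigma> \<in> topspace (krull_topology K)" for \<sigma>
      using that galois_restriction_aut[OF M K MK] by (simp add: topspace_krull galois_aut_def)
    fix \<beta> assume b: "\<beta> \<in> sep_closure M"
    \<comment> \<open>The coordinate takes its values in \<open>sep_closure M\<close>, and a
      subspace of a discrete space is discrete.\<close>
    have "continuous_map (krull_topology K) (subtopology (discrete_topology (sep_closure K)) (sep_closure M)) (\<lambda>\<sigma>. \<sigma> \<beta>)"
      unfolding continuous_map_in_subtopology
    proof
      show "continuous_map (krull_topology K) (discrete_topology (sep_closure K)) (\<lambda>\<sigma>. \<sigma> \<beta>)"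
        using b sub by (intro krull_projection) auto
      show "(\<lambda>\<sigma>. \<sigma> \<beta>) \<in> topspace (krull_topology K) \<rightarrow> sep_closure M"
        using galois_aut_simple_root_iff[OF M K MK] b sub by (auto simp: topspace_krull galois_aut_def)
    qed
    then show "continuous_map (krull_topology K) (discrete_topology (sep_closure M)) (\<lambda>\<sigma>. galois_restriction M \<sigma> \<beta>)"
      using b sub by (simp add: galois_restriction_def Int_absorb1)
  qed
  moreover have "continuous_map (krull_topology M) (krull_topology K) g"
  proof (rule krull_continuousI)
    show "g \<tau> \<in> carrier (abs_galois_group K)" if "\<tau> \<in> topspace (krull_topology M)" for \<tau>
      using that g by (simp add: topspace_krull)
    fix a assume "a \<in> sep_closure K"
    then obtain \<beta> r where a: "\<beta> \<in> sep_closure M" "r \<in> polys_over K" "a = poly r \<beta>" using gen by blast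
    have "continuous_map (discrete_topology (sep_closure M)) (discrete_topology (sep_closure K)) (poly r)"
      using a(2) polys_over_mono[OF sep_closure_base[OF K]] sub by (auto intro!: Ks.polys_eval)
    from continuous_map_compose[OF krull_projection[OF a(1)] this]
    have "continuous_map (krull_topology M) (discrete_topology (sep_closure K)) (\<lambda>\<tau>. poly r (\<tau> \<beta>))"
      by (simp add: o_def)
    then show "continuous_map (krull_topology M) (discrete_topology (sep_closure K)) (\<lambda>\<tau>. g \<tau> a)"
    proof (rule continuous_map_eq)
      fix \<tau> assume "\<tau> \<in> topspace (krull_topology M)"
      then have t: "\<tau> \<in> carrier (abs_galois_group M)" by (simp add: topspace_krull)
      have "g \<tau> \<beta> = \<tau> \<beta>"
        using fun_cong[OF g(2)[OF t], of \<beta>] a(1) by (simp add: galois_restriction_def)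
      moreover have "g \<tau> (poly r \<beta>) = poly r (g \<tau> \<beta>)"
        by (rule galois_aut_poly[OF K _ a(2)]) (use g(1)[OF t] a(1) sub in \<open>auto simp: galois_aut_def\<close>)
      ultimately show "poly r (\<tau> \<beta>) = g \<tau> a" using a(3) by simp
    qed
  qed
  moreover have "g (galois_restriction M \<sigma>) = \<sigma>" if "\<sigma> \<in> carrier (abs_galois_group K)" for \<sigma>
    unfolding g_def by (rule inv_into_f_f[OF restriction_inj that])
  ultimately have "homeomorphic_maps (krull_topology K) (krull_topology M) (galois_restriction M) g"
    using g(2) by (simp add: homeomorphic_maps_def topspace_krull)
  then show ?thesis unfolding homeomorphic_map_maps by blast
qed

end

theorem theorem3p4p2:
  fixes K K0 :: "'a::alg_closed_field set"
  assumes "pac_extension K K0"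
  shows "pac_extension (K \<inter> sep_closure K0) K0 \<and>
    galois_restriction (K \<inter> sep_closure K0)
      \<in> iso (abs_galois_group K) (abs_galois_group (K \<inter> sep_closure K0)) \<and>
    homeomorphic_map (krull_topology K) (krull_topology (K \<inter> sep_closure K0))
      (galois_restriction (K \<inter> sep_closure K0))"
proof -
  define M where "M = K \<inter> sep_closure K0"
  have pac: "pac_extension M K0" unfolding M_def by (rule pac_extension_sep_closure[OF assms])
  have K: "is_subfield K" using assms by (simp add: pac_extension_def)
  have M: "is_subfield M" "is_subfield K0" "K0 \<subseteq> M" using pac by (auto simp: pac_extension_def)
  \<comment> \<open>\<open>M\<close> lies between \<open>K0\<close> and its separable closure. The
    generators found over \<open>K0\<close> thus serve over \<open>M\<close>, and \<open>M\<close>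
    is separably closed in \<open>K\<close>.\<close>
  have Ms: "sep_closure M = sep_closure K0"
    by (rule sep_closure_trans[OF M(2,1,3)]) (simp add: M_def)
  interpret generated_closure M K
  proof (rule generated_closure.intro[OF M(1) K])
    show "infinite M" using pac_infinite[OF assms] M(3) finite_subset by blast
    show "M = K \<inter> sep_closure M" unfolding Ms by (rule M_def)
    show "\<exists>\<beta>\<in>sep_closure M. \<exists>r\<in>polys_over K. a = poly r \<beta>" if "a \<in> sep_closure K" for a
      unfolding Ms using sep_closure_generated[OF assms that] by metis
  qed
  show ?thesis
    unfolding M_def [symmetric] using pac restriction_iso restriction_homeomorphic by simp
qed

end
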